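(* Let $B_0$ be a base hierarchy such that there is no $k\ge 2$ for which both $S_{B_0}(b)\le b\cdot\min B_0$ for every $b\in B_0$ and $\min B_0\le k$. Define $B_{i+1}=(B_i)_{+(i+1)}$ for every $i$ and $\mathcal B=(B_i)_{i\in\mathbb N}$. Then $\mathsf{RCA}_0+(\Sigma^0_2)\text{-}\mathrm{IND}$ does not prove that for every $n$ there is some $i$ such that $\mathbb G^{\mathcal B}_i(n)=0$.
   Context: Let $\mathbb N=\{0,1,2,\dots\}$; $\infty$ is regarded as greater than, and divisible by, every positive integer. For $b\ge 2$ and $n>0$, the $b$-decomposition of $n$ is the unique $n=b^e a+r$ with $b^e\le n<b^{e+1}$, $0<a<b$, $r<b^e$. For nonempty $B\subseteq\mathbb N\setminus\{0,1\}$: $\mathrm{base}_B(n)=\max\{b\in B: b\le n\}$ if $n\ge\min B$, else $\min B$; $S_B(n)=\min\{b\in B:b>n\}$ if this exists, else $\infty$. A base hierarchy is a nonempty $B\subseteq\mathbb N\setminus\{0,1\}$ with $b\mid S_B(b)$ for all $b\in B$. $n$ is $B$-critical if $\mathrm{base}_B(n)\mid n$. Upgrade: for base hierarchies $B,C$ with $\min B\le\min C$, define ${\uparrow}n={\uparrow}_B^C n\in\mathbb N\cup\{\infty\}$ recursively. If $n<\min B$, ${\uparrow}n=n$. Otherwise $b=\mathrm{base}_B(n)$; for an integer $c\ge2$ define $\langle b\to c\rangle m={\uparrow}m$ if $m<b$, and $\langle b\to c\rangle m=c^{\langle b\to c\rangle e}\cdot{\uparrow}a+\langle b\to c\rangle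 r$ if $m\ge b$ has $b$-decomposition $m=b^ea+r$. Then ${\uparrow}n=\langle b\to c\rangle n$ where $c$ is the least element of $C$ with ${\uparrow}(n-1)<\langle b\to c\rangle n<S_C(c)$; ${\uparrow}n=\infty$ if none exists. Ouroboros successor: for a base hierarchy $B$ and integer $i\ge1$, $B_{+i}=\bigcup_{n}B^n_{+i}$, where recursively $B^n_{+i}=\{\min B+1\}$ for $n\le\min B$, and for $n>\min B$, with $c=\max B^{n-1}_{+i}$ and operators $\langle\cdot\to\cdot\rangle$ taken with respect to ${\uparrow}_B^{B^{n-1}_{+i}}$: (a) if $n$ is not $B$-critical, $B^n_{+i}=B^{n-1}_{+i}$; (b) if $n\in B$, let $b=\mathrm{base}_B(n-1)$ and $B^n_{+i}=B^{n-1}_{+i}\cup\{ca\}$ with $a$ least such that $\langle b\to c\rangle(n-1)<ca$; (c) if $n\notin B$ is $B$-critical, let $b=\mathrm{base}_B(n)$, $d_0=c$, $d_{j+1}=\langle b\to d_j\rangle n$, and $B^n_{+i}=B^{n-1}_{+i}\cup\{d_1,\dots,d_i\}$. Goodstein sequence: $\mathbb G^{\mathcal B}_0(n)=n$, $\mathbb G^{\mathcal B}_{i+1}(n)={\uparrow}_{B_i}^{B_{i+1}}\mathbb G^{\mathcal B}_i(n)-1$ if $\mathbb G^{\mathcal B}_i(n)>0$, else $0$. *)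

theory Defs
  imports Main "HOL-Library.Extended_Nat"
begin

section \<open>Base hierarchies and Goodstein sequences\<close>

definition succ_base :: "nat set \<Rightarrow> nat \<Rightarrow> enat" where
  "succ_base B n = (if \<exists>b\<in>B. n < b then enat (LEAST b. b \<in> B \<and> n < b) else \<infinity>)"

text \<open>In \<open>enat\<close>, a positive integer divides \<open>\<infinity>\<close>.\<close>

definition base_hierarchy :: "nat set \<Rightarrow> bool" where
  "base_hierarchy B \<longleftrightarrow> B \<noteq> {} \<and> 0 \<notin> B \<and> 1 \<notin> B \<and> (\<forall>b\<in>B. enat b dvd succ_base B b)"

definition base_of :: "nat set \<Rightarrow> nat \<Rightarrow> nat" where
  "base_of B n = (if Inf B \<le> n then Max {b\<in>B. b \<le> n} else Inf B)"

text \<open>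
  \<open>change u b c m\<close> is \<open>\<langle>b \<rightarrow> c\<rangle> m\<close> with respect to the upgrade function \<open>u\<close>. Values are \<open>\<infinity>\<close> as
  soon as one of the values from which they are computed is \<open>\<infinity>\<close>.
\<close>

function change :: "(nat \<Rightarrow> enat) \<Rightarrow> nat \<Rightarrow> nat \<Rightarrow> nat \<Rightarrow> enat" where
  "change u b c m =
    (if m < b then u m
     else if b < 2 then \<infinity>
     else let e = (GREATEST e. b ^ e \<le> m); a = m div b ^ e; r = m mod b ^ e in
       (case (change u b c e, u a, change u b c r) of
          (enat e', enat a', enat r') \<Rightarrow> enat (c ^ e' * a' + r')
        | _ \<Rightarrow> \<infinity>))"
  by pat_completeness auto

lemma greatest_exponent:
  assumes "2 \<le> b" "0 < (m::nat)"
  shows "b ^ (GREATEST e. b ^ e \<le> m) \<le> m" "m < b ^ Suc (GREATEST e. b ^ e \<le> m)"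
proof -
  have bd: "b ^ e \<le> m \<Longrightarrow> e \<le> m" for e
    using less_exp[of e] power_mono[of 2 b e] assms(1) by linarith
  show "b ^ (GREATEST e. b ^ e \<le> m) \<le> m"
    by (rule GreatestI_nat[where k=0 and b=m]) (use assms bd in auto)
  show "m < b ^ Suc (GREATEST e. b ^ e \<le> m)"
  proof (rule ccontr)
    assume "\<not> m < b ^ Suc (GREATEST e. b ^ e \<le> m)"
    then have "Suc (GREATEST e. b ^ e \<le> m) \<le> (GREATEST e. b ^ e \<le> m)"
      by (intro Greatest_le_nat[where b=m]) (use bd in auto)
    then show False by simp
  qed
qed

lemma greatest_exponent_less:
  assumes "2 \<le> b" "0 < (m::nat)"
  shows "(GREATEST e. b ^ e \<le> m) < m"
  using greatest_exponent(1)[OF assms] less_exp[of "GREATEST e. b ^ e \<le> m"]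
    power_mono[of 2 b "GREATEST e. b ^ e \<le> m"] assms(1) by linarith

termination change
proof (relation "Wellfounded.measure (\<lambda>(u, b, c, m). m)", goal_cases)
  case 1
  show ?case by simp
next
  case (2 u b c m e a r)
  then show ?case using greatest_exponent_less[of b m] by simp
next
  case (3 u b c m e a r)
  then have "b ^ e \<le> m" "0 < b ^ e" using greatest_exponent(1)[of b m] by simp_all
  then have "m mod b ^ e < m" using mod_less_divisor[of "b ^ e" m] by linarith
  with 3 show ?case by simp
qed

declare change.simps [simp del]

lemma change_cong [fundef_cong]:
  assumes "\<And>k. k < b' \<Longrightarrow> u k = u' k" "b = b'" "c = c'" "m = m'"
  shows "change u b c m = change u' b' c' m'"
proof -
  have "change u b c m = change u' b c m" using assms(1,2)
  proof (induction u b c m rule: change.induct)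
    case (1 u b c m)
    show ?case
    proof (cases "m < b \<or> b < 2")
      case True
      then show ?thesis using 1(3,4) by (auto simp: change.simps)
    next
      case False
      define e where "e = (GREATEST e. b ^ e \<le> m)"
      have "m < b ^ Suc e" using greatest_exponent(2)[of b m] False by (simp add: e_def)
      then have "m div b ^ e < b" using False by (simp add: less_mult_imp_div_less)
      then have h1: "u (m div b ^ e) = u' (m div b ^ e)" using 1(3,4) by simp
      have h2: "change u b c e = change u' b c e"
        "change u b c (m mod b ^ e) = change u' b c (m mod b ^ e)"
        using 1 False e_def by blast+
      show ?thesis
        unfolding change.simps[of u b c m] change.simps[of u' b c m] Let_def e_def[symmetric] h1 h2
        using False by simp
    qed
  qed
  then show ?thesis using assms by simp
qed

text \<open>The upgrade function \<open>\<up>\<^sub>B\<^sup>C\<close>.\<close>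

function upgrade :: "nat set \<Rightarrow> nat set \<Rightarrow> nat \<Rightarrow> enat" where
  "upgrade B C n =
    (if B = {} \<or> n = 0 \<or> n < Inf B then enat n
     else let b = base_of B n;
              P = (\<lambda>c. c \<in> C \<and> upgrade B C (n - 1) < change (upgrade B C) b c n \<and>
                       change (upgrade B C) b c n < succ_base C c)
          in if \<exists>c. P c then change (upgrade B C) b (LEAST c. P c) n else \<infinity>)"
  by pat_completeness auto

lemma base_of_le: "B \<noteq> {} \<Longrightarrow> Inf B \<le> n \<Longrightarrow> base_of B n \<le> n"
proof -
  assume a: "B \<noteq> {}" "Inf B \<le> n"
  then have "Inf B \<in> {b\<in>B. b \<le> n}" using Inf_nat_def1 by blast
  moreover have "finite {b\<in>B. b \<le> n}" by simp
  ultimately have "Max {b\<in>B. b \<le> n} \<in> {b\<in>B. b \<le> n}" by (intro Max_in) auto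
  then show ?thesis using a by (simp add: base_of_def)
qed

termination upgrade
proof (relation "Wellfounded.measure (\<lambda>(B, C, n). n)", goal_cases)
  case 1
  show ?case by simp
next
  case (2 B C n)
  then show ?case by simp
next
  case (3 B C n b c k)
  then show ?case using base_of_le[of B n] by simp
next
  case (4 B C n b c k)
  then show ?case using base_of_le[of B n] by simp
next
  case (5 B C n b c k)
  then show ?case using base_of_le[of B n] by simp
qed

declare upgrade.simps [simp del]

primrec iter :: "(nat \<Rightarrow> enat) \<Rightarrow> nat \<Rightarrow> nat \<Rightarrow> enat" where
  "iter f c 0 = enat c"
| "iter f c (Suc j) = (case iter f c j of enat d \<Rightarrow> f d | \<infinity> \<Rightarrow> \<infinity>)"

text \<open>The stage \<open>B\<^sup>n\<^sub>+\<^sub>i\<close> of the Ouroboros successor \<open>B\<^sub>+\<^sub>i\<close>.\<close>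

primrec stage :: "nat set \<Rightarrow> nat \<Rightarrow> nat \<Rightarrow> nat set" where
  "stage B i 0 = {Inf B + 1}"
| "stage B i (Suc n) =
    (let C = stage B i n; c = Max C in
     if Suc n \<le> Inf B then {Inf B + 1}
     else if Suc n \<in> B then
       C \<union> {c * a | a. change (upgrade B C) (base_of B n) c n < enat (c * a) \<and>
                        (\<forall>a'<a. \<not> change (upgrade B C) (base_of B n) c n < enat (c * a'))}
     else if base_of B (Suc n) dvd Suc n then
       C \<union> {d. \<exists>j. 1 \<le> j \<and> j \<le> i \<and>
                 iter (\<lambda>d. change (upgrade B C) (base_of B (Suc n)) d (Suc n)) c j = enat d}
     else C)"

definition ouroboros :: "nat set \<Rightarrow> nat \<Rightarrow> nat set" where
  "ouroboros B i = (\<Union>n. stage B i n)"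

primrec base_seq :: "nat set \<Rightarrow> nat \<Rightarrow> nat set" where
  "base_seq B 0 = B"
| "base_seq B (Suc i) = ouroboros (base_seq B i) (Suc i)"

primrec goodstein :: "nat set \<Rightarrow> nat \<Rightarrow> nat \<Rightarrow> enat" where
  "goodstein B n 0 = enat n"
| "goodstein B n (Suc i) =
    (case goodstein B n i of
       enat w \<Rightarrow> (if 0 < w then upgrade (base_seq B i) (base_seq B (Suc i)) w - 1 else 0)
     | \<infinity> \<Rightarrow> \<infinity>)"


section \<open>Second-order arithmetic\<close>

subsection \<open>Syntax and deduction\<close>

text \<open>
  The two-sorted language of second-order arithmetic, with one family of de Bruijn indices for
  number variables (bound by \<open>AllN\<close>) and another one for set variables (bound by \<open>AllS\<close>).
\<close>

datatype trm = Var nat | Zero | One | Add trm trm | Mul trm trm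

datatype fm =
    Eq trm trm
  | Lt trm trm
  | Mem trm nat
  | Bot
  | Imp fm fm
  | AllN fm
  | AllS fm

definition Neg :: "fm \<Rightarrow> fm" where "Neg p = Imp p Bot"
definition Or :: "fm \<Rightarrow> fm \<Rightarrow> fm" where "Or p q = Imp (Neg p) q"
definition And :: "fm \<Rightarrow> fm \<Rightarrow> fm" where "And p q = Neg (Imp p (Neg q))"
definition Iff :: "fm \<Rightarrow> fm \<Rightarrow> fm" where "Iff p q = And (Imp p q) (Imp q p)"
definition ExN :: "fm \<Rightarrow> fm" where "ExN p = Neg (AllN (Neg p))"
definition ExS :: "fm \<Rightarrow> fm" where "ExS p = Neg (AllS (Neg p))"

text \<open>Simultaneous substitution of terms for number variables and of set variables for set
  variables.\<close>

primrec subt :: "(nat \<Rightarrow> trm) \<Rightarrow> trm \<Rightarrow> trm" where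
  "subt \<sigma> (Var n) = \<sigma> n"
| "subt \<sigma> Zero = Zero"
| "subt \<sigma> One = One"
| "subt \<sigma> (Add s t) = Add (subt \<sigma> s) (subt \<sigma> t)"
| "subt \<sigma> (Mul s t) = Mul (subt \<sigma> s) (subt \<sigma> t)"

definition lift_trm :: "trm \<Rightarrow> trm" where
  "lift_trm = subt (\<lambda>n. Var (Suc n))"

primrec sub :: "(nat \<Rightarrow> trm) \<Rightarrow> (nat \<Rightarrow> nat) \<Rightarrow> fm \<Rightarrow> fm" where
  "sub \<sigma> \<rho> (Eq s t) = Eq (subt \<sigma> s) (subt \<sigma> t)"
| "sub \<sigma> \<rho> (Lt s t) = Lt (subt \<sigma> s) (subt \<sigma> t)"
| "sub \<sigma> \<rho> (Mem t X) = Mem (subt \<sigma> t) (\<rho> X)"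
| "sub \<sigma> \<rho> Bot = Bot"
| "sub \<sigma> \<rho> (Imp p q) = Imp (sub \<sigma> \<rho> p) (sub \<sigma> \<rho> q)"
| "sub \<sigma> \<rho> (AllN p) = AllN (sub (case_nat (Var 0) (\<lambda>n. lift_trm (\<sigma> n))) \<rho> p)"
| "sub \<sigma> \<rho> (AllS p) = AllS (sub \<sigma> (case_nat 0 (\<lambda>n. Suc (\<rho> n))) p)"

definition liftN :: "fm \<Rightarrow> fm" where "liftN = sub (\<lambda>n. Var (Suc n)) (\<lambda>n. n)"
definition liftS :: "fm \<Rightarrow> fm" where "liftS = sub Var Suc"
definition instN :: "fm \<Rightarrow> trm \<Rightarrow> fm" where "instN p t = sub (case_nat t Var) (\<lambda>n. n) p"
definition instS :: "fm \<Rightarrow> nat \<Rightarrow> fm" where "instS p X = sub Var (case_nat X (\<lambda>n. n)) p"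

text \<open>Classical natural deduction with equality for numbers.\<close>

inductive proves :: "fm set \<Rightarrow> fm \<Rightarrow> bool" (infix "\<turnstile>" 40) where
  ax:    "p \<in> \<Gamma> \<Longrightarrow> \<Gamma> \<turnstile> p"
| impI:  "insert p \<Gamma> \<turnstile> q \<Longrightarrow> \<Gamma> \<turnstile> Imp p q"
| impE:  "\<Gamma> \<turnstile> Imp p q \<Longrightarrow> \<Gamma> \<turnstile> p \<Longrightarrow> \<Gamma> \<turnstile> q"
| raa:   "insert (Neg p) \<Gamma> \<turnstile> Bot \<Longrightarrow> \<Gamma> \<turnstile> p"
| allNI: "liftN ` \<Gamma> \<turnstile> p \<Longrightarrow> \<Gamma> \<turnstile> AllN p"
| allNE: "\<Gamma> \<turnstile> AllN p \<Longrightarrow> \<Gamma> \<turnstile> instN p t"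
| allSI: "liftS ` \<Gamma> \<turnstile> p \<Longrightarrow> \<Gamma> \<turnstile> AllS p"
| allSE: "\<Gamma> \<turnstile> AllS p \<Longrightarrow> \<Gamma> \<turnstile> instS p X"
| eqI:   "\<Gamma> \<turnstile> Eq t t"
| eqE:   "\<Gamma> \<turnstile> Eq s t \<Longrightarrow> \<Gamma> \<turnstile> instN p s \<Longrightarrow> \<Gamma> \<turnstile> instN p t"

text \<open>All free number variables are below \<open>k\<close> and all free set variables are below \<open>l\<close>.\<close>

primrec fvt_below :: "nat \<Rightarrow> trm \<Rightarrow> bool" where
  "fvt_below k (Var n) = (n < k)"
| "fvt_below k Zero = True"
| "fvt_below k One = True"
| "fvt_below k (Add s t) = (fvt_below k s \<and> fvt_below k t)"
| "fvt_below k (Mul s t) = (fvt_below k s \<and> fvt_below k t)"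

primrec fv_below :: "nat \<Rightarrow> nat \<Rightarrow> fm \<Rightarrow> bool" where
  "fv_below k l (Eq s t) = (fvt_below k s \<and> fvt_below k t)"
| "fv_below k l (Lt s t) = (fvt_below k s \<and> fvt_below k t)"
| "fv_below k l (Mem t X) = (fvt_below k t \<and> X < l)"
| "fv_below k l Bot = True"
| "fv_below k l (Imp p q) = (fv_below k l p \<and> fv_below k l q)"
| "fv_below k l (AllN p) = fv_below (Suc k) l p"
| "fv_below k l (AllS p) = fv_below k (Suc l) p"

text \<open>Truth in the standard model, whose set variables range over all sets of natural numbers.\<close>

primrec evt :: "(nat \<Rightarrow> nat) \<Rightarrow> trm \<Rightarrow> nat" where
  "evt v (Var n) = v n"
| "evt v Zero = 0"
| "evt v One = 1"
| "evt v (Add s t) = evt v s + evt v t"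
| "evt v (Mul s t) = evt v s * evt v t"

primrec sat :: "(nat \<Rightarrow> nat) \<Rightarrow> (nat \<Rightarrow> nat set) \<Rightarrow> fm \<Rightarrow> bool" where
  "sat v V (Eq s t) = (evt v s = evt v t)"
| "sat v V (Lt s t) = (evt v s < evt v t)"
| "sat v V (Mem t X) = (evt v t \<in> V X)"
| "sat v V Bot = False"
| "sat v V (Imp p q) = (sat v V p \<longrightarrow> sat v V q)"
| "sat v V (AllN p) = (\<forall>x. sat (case_nat x v) V p)"
| "sat v V (AllS p) = (\<forall>X. sat v (case_nat X V) p)"


subsection \<open>\<open>RCA\<^sub>0\<close> and induction for \<open>\<Sigma>\<^sup>0\<^sub>2\<close> formulas\<close>

text \<open>Bounded formulas may contain free set variables, but no set quantifiers.\<close>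

inductive bounded :: "fm \<Rightarrow> bool" where
  "bounded (Eq s t)"
| "bounded (Lt s t)"
| "bounded (Mem t X)"
| "bounded Bot"
| "bounded p \<Longrightarrow> bounded q \<Longrightarrow> bounded (Imp p q)"
| "bounded p \<Longrightarrow> bounded (AllN (Imp (Lt (Var 0) (lift_trm t)) p))"

fun Sigma0 :: "nat \<Rightarrow> fm \<Rightarrow> bool" and Pi0 :: "nat \<Rightarrow> fm \<Rightarrow> bool" where
  "Sigma0 0 p = bounded p"
| "Sigma0 (Suc n) p = (\<exists>q. p = ExN q \<and> Pi0 n q)"
| "Pi0 0 p = bounded p"
| "Pi0 (Suc n) p = (\<exists>q. p = AllN q \<and> Sigma0 n q)"

definition closures :: "fm \<Rightarrow> fm set" where
  "closures p = {(AllN ^^ k) ((AllS ^^ l) p) | k l. fv_below k l p}"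

text \<open>Induction on variable \<open>0\<close> of \<open>p\<close>; the other free variables are parameters.\<close>

definition ind_ax :: "fm \<Rightarrow> fm" where
  "ind_ax p =
     Imp (And (instN p Zero)
              (AllN (Imp p (sub (case_nat (Add (Var 0) One) (\<lambda>n. Var (Suc n))) (\<lambda>n. n) p))))
         (AllN p)"

text \<open>\<open>\<forall>n (p n \<longleftrightarrow> q n) \<longrightarrow> \<exists>X \<forall>n (n \<in> X \<longleftrightarrow> p n)\<close>, where \<open>n\<close> is variable \<open>0\<close> of \<open>p\<close> and \<open>q\<close>.\<close>

definition comp_ax :: "fm \<Rightarrow> fm \<Rightarrow> fm" where
  "comp_ax p q = Imp (AllN (Iff p q)) (ExS (AllN (Iff (Mem (Var 0) 0) (liftS p))))"

definition basic_axioms :: "fm set" where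
  "basic_axioms = (let m = Var 0; n = Var 1 in (\<lambda>p. AllN (AllN p)) `
    {Neg (Eq (Add n One) Zero),
     Imp (Eq (Add m One) (Add n One)) (Eq m n),
     Eq (Add m Zero) m,
     Eq (Add m (Add n One)) (Add (Add m n) One),
     Eq (Mul m Zero) Zero,
     Eq (Mul m (Add n One)) (Add (Mul m n) m),
     Neg (Lt m Zero),
     Iff (Lt m (Add n One)) (Or (Lt m n) (Eq m n))})"

definition Sigma0_IND :: "nat \<Rightarrow> fm set" where
  "Sigma0_IND n = (\<Union>p \<in> Collect (Sigma0 n). closures (ind_ax p))"

definition Delta01_CA :: "fm set" where
  "Delta01_CA = (\<Union>p \<in> Collect (Sigma0 1). \<Union>q \<in> Collect (Pi0 1). closures (comp_ax p q))"

definition RCA0 :: "fm set" where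
  "RCA0 = basic_axioms \<union> Sigma0_IND 1 \<union> Delta01_CA"


subsection \<open>Notation for writing formulas\<close>

text \<open>
  To write formulas of the object language with variable names instead of indices, terms, set
  variables and formulas are represented as functions of the numbers of number and set quantifiers
  in whose scope they are placed. A variable bound at depth \<open>k\<close> has, at depth \<open>k'\<close>,
  the index \<open>k' - Suc k\<close>. Bold symbols belong to the object language.
\<close>

type_synonym tm = "nat \<Rightarrow> trm"
type_synonym sv = "nat \<Rightarrow> nat"
type_synonym pr = "nat \<Rightarrow> nat \<Rightarrow> fm"

definition zeroT :: tm ("\<^bold>0") where "\<^bold>0 = (\<lambda>k. Zero)"
definition oneT :: tm ("\<^bold>1") where "\<^bold>1 = (\<lambda>k. One)"
definition addT :: "tm \<Rightarrow> tm \<Rightarrow> tm" (infixl "\<^bold>+" 65) where "s \<^bold>+ t = (\<lambda>k. Add (s k) (t k))"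
definition mulT :: "tm \<Rightarrow> tm \<Rightarrow> tm" (infixl "\<^bold>*" 70) where "s \<^bold>* t = (\<lambda>k. Mul (s k) (t k))"

definition eqP :: "tm \<Rightarrow> tm \<Rightarrow> pr" (infix "\<^bold>=" 50) where "s \<^bold>= t = (\<lambda>k l. Eq (s k) (t k))"
definition ltP :: "tm \<Rightarrow> tm \<Rightarrow> pr" (infix "\<^bold><" 50) where "s \<^bold>< t = (\<lambda>k l. Lt (s k) (t k))"
definition memP :: "tm \<Rightarrow> sv \<Rightarrow> pr" (infix "\<^bold>\<in>" 50) where "t \<^bold>\<in> X = (\<lambda>k l. Mem (t k) (X l))"
definition notP :: "pr \<Rightarrow> pr" ("\<^bold>\<not> _" [40] 40) where "(\<^bold>\<not> P) = (\<lambda>k l. Neg (P k l))"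
definition andP :: "pr \<Rightarrow> pr \<Rightarrow> pr" (infixr "\<^bold>\<and>" 35) where
  "(P \<^bold>\<and> Q) = (\<lambda>k l. And (P k l) (Q k l))"
definition orP :: "pr \<Rightarrow> pr \<Rightarrow> pr" (infixr "\<^bold>\<or>" 30) where
  "(P \<^bold>\<or> Q) = (\<lambda>k l. Or (P k l) (Q k l))"
definition impP :: "pr \<Rightarrow> pr \<Rightarrow> pr" (infixr "\<^bold>\<longrightarrow>" 25) where
  "(P \<^bold>\<longrightarrow> Q) = (\<lambda>k l. Imp (P k l) (Q k l))"
definition iffP :: "pr \<Rightarrow> pr \<Rightarrow> pr" (infixr "\<^bold>\<longleftrightarrow>" 25) where
  "(P \<^bold>\<longleftrightarrow> Q) = (\<lambda>k l. Iff (P k l) (Q k l))"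
definition allP :: "(tm \<Rightarrow> pr) \<Rightarrow> pr" (binder "\<^bold>\<forall>" 10) where
  "allP F = (\<lambda>k l. AllN (F (\<lambda>k'. Var (k' - Suc k)) (Suc k) l))"
definition exP :: "(tm \<Rightarrow> pr) \<Rightarrow> pr" (binder "\<^bold>\<exists>" 10) where
  "exP F = (\<lambda>k l. ExN (F (\<lambda>k'. Var (k' - Suc k)) (Suc k) l))"
definition allSP :: "(sv \<Rightarrow> pr) \<Rightarrow> pr" (binder "\<^bold>\<forall>\<^sub>S" 10) where
  "allSP F = (\<lambda>k l. AllS (F (\<lambda>l'. l' - Suc l) k (Suc l)))"

definition leP :: "tm \<Rightarrow> tm \<Rightarrow> pr" (infix "\<^bold>\<le>" 50) where "s \<^bold>\<le> t = (s \<^bold>< t \<^bold>\<or> s \<^bold>= t)"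

text \<open>The usual injective pairing function \<open>(x, y) \<mapsto> (x + y)\<^sup>2 + x\<close>.\<close>

definition pairT :: "tm \<Rightarrow> tm \<Rightarrow> tm" (infixr "\<^bold>," 60) where
  "s \<^bold>, t = (s \<^bold>+ t) \<^bold>* (s \<^bold>+ t) \<^bold>+ s"


section \<open>The Goodstein process in second-order arithmetic\<close>

text \<open>
  Below, \<open>B\<close> and \<open>C\<close> are classes given by formulas, and functions are given by their graphs.
  The value \<open>\<infinity>\<close> is represented by the absence of a value.
\<close>

definition is_min :: "(tm \<Rightarrow> pr) \<Rightarrow> tm \<Rightarrow> pr" where
  "is_min B m = (B m \<^bold>\<and> (\<^bold>\<forall>x. B x \<^bold>\<longrightarrow> m \<^bold>\<le> x))"

definition is_max :: "(tm \<Rightarrow> pr) \<Rightarrow> tm \<Rightarrow> pr" where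
  "is_max B m = (B m \<^bold>\<and> (\<^bold>\<forall>x. B x \<^bold>\<longrightarrow> x \<^bold>\<le> m))"

text \<open>\<open>b = base\<^sub>B n\<close>\<close>

definition is_base :: "(tm \<Rightarrow> pr) \<Rightarrow> tm \<Rightarrow> tm \<Rightarrow> pr" where
  "is_base B n b = (is_max (\<lambda>x. B x \<^bold>\<and> x \<^bold>\<le> n) b \<^bold>\<or> (is_min B b \<^bold>\<and> n \<^bold>< b))"

text \<open>\<open>v < S\<^sub>B c\<close>\<close>

definition below_succ :: "(tm \<Rightarrow> pr) \<Rightarrow> tm \<Rightarrow> tm \<Rightarrow> pr" where
  "below_succ B v c = (\<^bold>\<forall>x. B x \<^bold>\<and> c \<^bold>< x \<^bold>\<longrightarrow> v \<^bold>< x)"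

text \<open>\<open>E\<close> is the graph of exponentiation, consisting of the triples \<open>(c, e, c\<^sup>e)\<close>.\<close>

definition is_exp :: "sv \<Rightarrow> pr" where
  "is_exp E = (\<^bold>\<forall>c. \<^bold>\<forall>e. \<^bold>\<forall>v. (c \<^bold>, e \<^bold>, v) \<^bold>\<in> E \<^bold>\<longleftrightarrow>
     (e \<^bold>= \<^bold>0 \<^bold>\<and> v \<^bold>= \<^bold>1) \<^bold>\<or>
     (\<^bold>\<exists>e'. \<^bold>\<exists>w. e \<^bold>= e' \<^bold>+ \<^bold>1 \<^bold>\<and> (c \<^bold>, e' \<^bold>, w) \<^bold>\<in> E \<^bold>\<and> v \<^bold>= w \<^bold>* c))"

text \<open>\<open>m = b\<^sup>e * a + r\<close> is the \<open>b\<close>-decomposition of \<open>m\<close>.\<close>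

definition is_decomp :: "sv \<Rightarrow> tm \<Rightarrow> tm \<Rightarrow> tm \<Rightarrow> tm \<Rightarrow> tm \<Rightarrow> pr" where
  "is_decomp E b m e a r = (\<^bold>\<exists>p. \<^bold>\<exists>q. (b \<^bold>, e \<^bold>, p) \<^bold>\<in> E \<^bold>\<and> (b \<^bold>, e \<^bold>+ \<^bold>1 \<^bold>, q) \<^bold>\<in> E \<^bold>\<and>
     m \<^bold>= p \<^bold>* a \<^bold>+ r \<^bold>\<and> p \<^bold>\<le> m \<^bold>\<and> m \<^bold>< q \<^bold>\<and> \<^bold>0 \<^bold>< a \<^bold>\<and> a \<^bold>< b \<^bold>\<and> r \<^bold>< p)"

text \<open>\<open>K b c\<close> is the graph of \<open>\<langle>b \<rightarrow> c\<rangle>\<close> with respect to the upgrade function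
  with graph \<open>U\<close>.\<close>

definition is_change ::
    "sv \<Rightarrow> (tm \<Rightarrow> tm \<Rightarrow> pr) \<Rightarrow> (tm \<Rightarrow> tm \<Rightarrow> tm \<Rightarrow> tm \<Rightarrow> pr) \<Rightarrow> pr" where
  "is_change E U K = (\<^bold>\<forall>b. \<^bold>\<forall>c. \<^bold>\<forall>m. \<^bold>\<forall>v. K b c m v \<^bold>\<longleftrightarrow>
     (m \<^bold>< b \<^bold>\<and> U m v) \<^bold>\<or>
     (b \<^bold>\<le> m \<^bold>\<and> (\<^bold>\<exists>e. \<^bold>\<exists>a. \<^bold>\<exists>r. is_decomp E b m e a r \<^bold>\<and>
        (\<^bold>\<exists>e'. \<^bold>\<exists>p. \<^bold>\<exists>a'. \<^bold>\<exists>r'. K b c e e' \<^bold>\<and> (c \<^bold>, e' \<^bold>, p) \<^bold>\<in> E \<^bold>\<and> U a a' \<^bold>\<and> K b c r r' \<^bold>\<and>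
           v \<^bold>= p \<^bold>* a' \<^bold>+ r'))))"

text \<open>\<open>c \<in> C\<close>, \<open>v = \<langle>b \<rightarrow> c\<rangle> n\<close> and \<open>\<up>(n - 1) < v < S\<^sub>C c\<close>\<close>

definition admissible ::
    "(tm \<Rightarrow> pr) \<Rightarrow> (tm \<Rightarrow> tm \<Rightarrow> pr) \<Rightarrow> (tm \<Rightarrow> tm \<Rightarrow> tm \<Rightarrow> tm \<Rightarrow> pr) \<Rightarrow> tm \<Rightarrow> tm \<Rightarrow> tm \<Rightarrow> tm \<Rightarrow> pr" where
  "admissible C U K n b c v = (C c \<^bold>\<and> K b c n v \<^bold>\<and>
     (\<^bold>\<exists>n'. \<^bold>\<exists>w. n \<^bold>= n' \<^bold>+ \<^bold>1 \<^bold>\<and> U n' w \<^bold>\<and> w \<^bold>< v) \<^bold>\<and> below_succ C v c)"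

text \<open>\<open>U\<close> is the graph of \<open>\<up>\<^sub>B\<^sup>C\<close>.\<close>

definition is_upgrade :: "sv \<Rightarrow> (tm \<Rightarrow> pr) \<Rightarrow> (tm \<Rightarrow> pr) \<Rightarrow>
    (tm \<Rightarrow> tm \<Rightarrow> pr) \<Rightarrow> (tm \<Rightarrow> tm \<Rightarrow> tm \<Rightarrow> tm \<Rightarrow> pr) \<Rightarrow> pr" where
  "is_upgrade E B C U K = (is_change E U K \<^bold>\<and> (\<^bold>\<forall>n. \<^bold>\<forall>v. U n v \<^bold>\<longleftrightarrow>
     (\<^bold>\<exists>\<mu>. is_min B \<mu> \<^bold>\<and>
        ((n \<^bold>< \<mu> \<^bold>\<and> v \<^bold>= n) \<^bold>\<or>
         (\<mu> \<^bold>\<le> n \<^bold>\<and> (\<^bold>\<exists>b. \<^bold>\<exists>c. is_base B n b \<^bold>\<and> admissible C U K n b c v \<^bold>\<and>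
            (\<^bold>\<forall>c'. c' \<^bold>< c \<^bold>\<longrightarrow> \<^bold>\<not> (\<^bold>\<exists>v'. admissible C U K n b c' v'))))))))"

text \<open>
  \<open>St n\<close> is the stage \<open>B\<^sup>n\<^sub>+\<^sub>i\<close> of the Ouroboros successor. For each \<open>n\<close>, \<open>U n\<close> and \<open>K n\<close> are
  the graphs of \<open>\<up>\<close> from \<open>B\<close> to \<open>St n\<close> and of the corresponding \<open>\<langle>b \<rightarrow> c\<rangle>\<close>. When \<open>n\<close> is handled
  by the third case of the definition, \<open>D n j d\<close> says that \<open>d = d\<^sub>j\<close>.
\<close>

definition is_stages :: "sv \<Rightarrow> (tm \<Rightarrow> pr) \<Rightarrow> tm \<Rightarrow> (tm \<Rightarrow> tm \<Rightarrow> pr) \<Rightarrow> (tm \<Rightarrow> tm \<Rightarrow> tm \<Rightarrow> pr) \<Rightarrow>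
    (tm \<Rightarrow> tm \<Rightarrow> tm \<Rightarrow> tm \<Rightarrow> tm \<Rightarrow> pr) \<Rightarrow> (tm \<Rightarrow> tm \<Rightarrow> tm \<Rightarrow> pr) \<Rightarrow> pr" where
  "is_stages E B i St U K D = (
     (\<^bold>\<forall>n. is_upgrade E B (St n) (U n) (K n)) \<^bold>\<and>
     (\<^bold>\<forall>n. \<^bold>\<forall>j. \<^bold>\<forall>d. D n j d \<^bold>\<longleftrightarrow> (\<^bold>\<exists>n'. n \<^bold>= n' \<^bold>+ \<^bold>1 \<^bold>\<and>
        ((j \<^bold>= \<^bold>0 \<^bold>\<and> is_max (St n') d) \<^bold>\<or>
         (\<^bold>\<exists>j'. \<^bold>\<exists>d'. \<^bold>\<exists>b. j \<^bold>= j' \<^bold>+ \<^bold>1 \<^bold>\<and> D n j' d' \<^bold>\<and> is_base B n b \<^bold>\<and> K n' b d' n d)))) \<^bold>\<and>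
     (\<^bold>\<forall>n. \<^bold>\<forall>x. St n x \<^bold>\<longleftrightarrow> (\<^bold>\<exists>\<mu>. is_min B \<mu> \<^bold>\<and>
        ((n \<^bold>\<le> \<mu> \<^bold>\<and> x \<^bold>= \<mu> \<^bold>+ \<^bold>1) \<^bold>\<or>
         (\<mu> \<^bold>< n \<^bold>\<and> (\<^bold>\<exists>n'. n \<^bold>= n' \<^bold>+ \<^bold>1 \<^bold>\<and>
            (St n' x \<^bold>\<or>
             (B n \<^bold>\<and> (\<^bold>\<exists>b. \<^bold>\<exists>c. \<^bold>\<exists>v. \<^bold>\<exists>a. is_base B n' b \<^bold>\<and> is_max (St n') c \<^bold>\<and> K n' b c n' v \<^bold>\<and>
                x \<^bold>= c \<^bold>* a \<^bold>\<and> v \<^bold>< c \<^bold>* a \<^bold>\<and> (\<^bold>\<forall>a'. a' \<^bold>< a \<^bold>\<longrightarrow> \<^bold>\<not> v \<^bold>< c \<^bold>* a'))) \<^bold>\<or>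
             (\<^bold>\<not> B n \<^bold>\<and> (\<^bold>\<exists>b. \<^bold>\<exists>q. \<^bold>\<exists>j. is_base B n b \<^bold>\<and> n \<^bold>= b \<^bold>* q \<^bold>\<and>
                \<^bold>1 \<^bold>\<le> j \<^bold>\<and> j \<^bold>\<le> i \<^bold>\<and> D n j x)))))))))"

text \<open>
  The assertion, about the set variable \<open>X\<close>, that the Goodstein process with \<open>B\<^sub>0 = X\<close> always
  terminates. The set \<open>M\<close> codes the sequence \<open>\<B>\<close> through \<open>x \<in> B\<^sub>i \<longleftrightarrow> (i, x) \<in> M\<close>; the triple
  \<open>(n, i, v)\<close> is in \<open>G\<close> iff \<open>v\<close> is term number \<open>i\<close> of the Goodstein sequence of \<open>n\<close>; the other
  sets are auxiliary graphs. For a base hierarchy \<open>X\<close>, all these sets are uniquely determined up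
  to elements that are not tuples of the right length.
\<close>

definition goodstein_graphs :: "sv \<Rightarrow> sv \<Rightarrow> sv \<Rightarrow> sv \<Rightarrow> sv \<Rightarrow> sv \<Rightarrow> sv \<Rightarrow> sv \<Rightarrow> sv \<Rightarrow> sv \<Rightarrow> pr" where
  "goodstein_graphs X E M W V H D U K G = (
     is_exp E \<^bold>\<and>
     (\<^bold>\<forall>x. (\<^bold>0 \<^bold>, x) \<^bold>\<in> M \<^bold>\<longleftrightarrow> x \<^bold>\<in> X) \<^bold>\<and>
     (\<^bold>\<forall>i. \<^bold>\<forall>x. (i \<^bold>+ \<^bold>1 \<^bold>, x) \<^bold>\<in> M \<^bold>\<longleftrightarrow> (\<^bold>\<exists>n. (i \<^bold>, n \<^bold>, x) \<^bold>\<in> W)) \<^bold>\<and>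
     (\<^bold>\<forall>i. is_stages E (\<lambda>x. (i \<^bold>, x) \<^bold>\<in> M) (i \<^bold>+ \<^bold>1)
        (\<lambda>n x. (i \<^bold>, n \<^bold>, x) \<^bold>\<in> W)
        (\<lambda>n m v. (i \<^bold>, n \<^bold>, m \<^bold>, v) \<^bold>\<in> V)
        (\<lambda>n b c m v. (i \<^bold>, n \<^bold>, b \<^bold>, c \<^bold>, m \<^bold>, v) \<^bold>\<in> H)
        (\<lambda>n j d. (i \<^bold>, n \<^bold>, j \<^bold>, d) \<^bold>\<in> D)) \<^bold>\<and>
     (\<^bold>\<forall>i. is_upgrade E (\<lambda>x. (i \<^bold>, x) \<^bold>\<in> M) (\<lambda>x. (i \<^bold>+ \<^bold>1 \<^bold>, x) \<^bold>\<in> M)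
        (\<lambda>m v. (i \<^bold>, m \<^bold>, v) \<^bold>\<in> U)
        (\<lambda>b c m v. (i \<^bold>, b \<^bold>, c \<^bold>, m \<^bold>, v) \<^bold>\<in> K)) \<^bold>\<and>
     (\<^bold>\<forall>n. \<^bold>\<forall>i. \<^bold>\<forall>v. (n \<^bold>, i \<^bold>, v) \<^bold>\<in> G \<^bold>\<longleftrightarrow>
        (i \<^bold>= \<^bold>0 \<^bold>\<and> v \<^bold>= n) \<^bold>\<or>
        (\<^bold>\<exists>i'. \<^bold>\<exists>w. i \<^bold>= i' \<^bold>+ \<^bold>1 \<^bold>\<and> (n \<^bold>, i' \<^bold>, w) \<^bold>\<in> G \<^bold>\<and>
           ((w \<^bold>= \<^bold>0 \<^bold>\<and> v \<^bold>= \<^bold>0) \<^bold>\<or> (\<^bold>0 \<^bold>< w \<^bold>\<and> (i' \<^bold>, w \<^bold>, v \<^bold>+ \<^bold>1) \<^bold>\<in> U)))))"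

definition goodstein_terminates :: "sv \<Rightarrow> pr" where
  "goodstein_terminates X =
     (\<^bold>\<forall>\<^sub>SE. \<^bold>\<forall>\<^sub>SM. \<^bold>\<forall>\<^sub>SW. \<^bold>\<forall>\<^sub>SV. \<^bold>\<forall>\<^sub>SH. \<^bold>\<forall>\<^sub>SD. \<^bold>\<forall>\<^sub>SU. \<^bold>\<forall>\<^sub>SK. \<^bold>\<forall>\<^sub>SG.
        goodstein_graphs X E M W V H D U K G \<^bold>\<longrightarrow> (\<^bold>\<forall>n. \<^bold>\<exists>i. (n \<^bold>, i \<^bold>, \<^bold>0) \<^bold>\<in> G))"

text \<open>
  The formula \<open>d\<close>, with the set variable \<open>0\<close> as its only free variable, describes \<open>B\<^sub>0\<close> to the
  theory in which \<open>goodstein_sentence d\<close> is to be proved; for example \<open>\<forall>x (x \<in> X \<longleftrightarrow> p x)\<close> for a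
  bounded definition \<open>p\<close> of \<open>B\<^sub>0\<close>, or a finite part of the diagram of an arbitrary \<open>B\<^sub>0\<close>. At depth
  \<open>(0, 1)\<close> the set variable with index \<open>0\<close> is \<open>\<lambda>l. l - 1\<close>.
\<close>

definition goodstein_sentence :: "fm \<Rightarrow> fm" where
  "goodstein_sentence d = AllS (Imp d (goodstein_terminates (\<lambda>l. l - 1) 0 1))"


section \<open>Correctness of the formula in the standard model\<close>

text \<open>
  Nothing below is needed to state results about \<^const>\<open>goodstein_sentence\<close>. In the standard
  model the formula \<^const>\<open>goodstein_terminates\<close> expresses the termination of the sequences
  \<^const>\<open>goodstein\<close>.
\<close>

lemmas conn = Neg_def Or_def And_def Iff_def ExN_def ExS_def
lemma sat_conn[simp]:
  "sat v V (Neg p) = (\<not> sat v V p)" "sat v V (Or p q) = (sat v V p \<or> sat v V q)"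
  "sat v V (And p q) = (sat v V p \<and> sat v V q)" "sat v V (Iff p q) = (sat v V p \<longleftrightarrow> sat v V q)"
  "sat v V (ExN p) = (\<exists>x. sat (case_nat x v) V p)"
  by (auto simp: conn)

definition pr2 :: "nat \<Rightarrow> nat \<Rightarrow> nat" (infixr "\<rhd>" 60) where "x \<rhd> y = (x+y)*(x+y)+x"

lemma evt_pair[simp]: "evt v ((s \<^bold>, t) k) = evt v (s k) \<rhd> evt v (t k)"
  by (simp add: pairT_def addT_def mulT_def pr2_def)
lemma evt_simps[simp]: "evt v (\<^bold>0 k) = 0" "evt v (\<^bold>1 k) = 1"
  "evt v ((s \<^bold>+ t) k) = evt v (s k) + evt v (t k)" "evt v ((s \<^bold>* t) k) = evt v (s k) * evt v (t k)"
  by (simp_all add: zeroT_def oneT_def addT_def mulT_def)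

lemma sat_P[simp]:
  "sat v V ((s \<^bold>= t) k l) = (evt v (s k) = evt v (t k))"
  "sat v V ((s \<^bold>< t) k l) = (evt v (s k) < evt v (t k))"
  "sat v V ((s \<^bold>\<le> t) k l) = (evt v (s k) \<le> evt v (t k))"
  "sat v V ((t \<^bold>\<in> X) k l) = (evt v (t k) \<in> V (X l))"
  "sat v V ((\<^bold>\<not> P) k l) = (\<not> sat v V (P k l))"
  "sat v V ((P \<^bold>\<and> Q) k l) = (sat v V (P k l) \<and> sat v V (Q k l))"
  "sat v V ((P \<^bold>\<or> Q) k l) = (sat v V (P k l) \<or> sat v V (Q k l))"
  "sat v V ((P \<^bold>\<longrightarrow> Q) k l) = (sat v V (P k l) \<longrightarrow> sat v V (Q k l))"
  "sat v V ((P \<^bold>\<longleftrightarrow> Q) k l) = (sat v V (P k l) \<longleftrightarrow> sat v V (Q k l))"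
  "sat v V (allP F k l) = (\<forall>x. sat (case_nat x v) V (F (\<lambda>k'. Var (k' - Suc k)) (Suc k) l))"
  "sat v V (exP F k l) = (\<exists>x. sat (case_nat x v) V (F (\<lambda>k'. Var (k' - Suc k)) (Suc k) l))"
  "sat v V (allSP F' k l) = (\<forall>X. sat v (case_nat X V) (F' (\<lambda>l'. l' - Suc l) k (Suc l)))"
  by (auto simp: eqP_def ltP_def leP_def memP_def notP_def andP_def orP_def impP_def iffP_def
    allP_def exP_def allSP_def)

text \<open>Semantic counterparts, on relations between natural numbers, of the formulas above.\<close>

definition "rmin B m = (B m \<and> (\<forall>x. B x \<longrightarrow> (m::nat) \<le> x))"
definition "rmax B m = (B m \<and> (\<forall>x. B x \<longrightarrow> x \<le> (m::nat)))"
definition "rbase B n b = (rmax (\<lambda>x. B x \<and> x \<le> n) b \<or> (rmin B b \<and> n < b))"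
definition "rbelow B v c = (\<forall>x. B x \<and> c < x \<longrightarrow> (v::nat) < (x::nat))"
definition "rexp E = (\<forall>c e v. E c e v \<longleftrightarrow> (e = (0::nat) \<and> v = (1::nat)) \<or>
   (\<exists>e' w. e = e' + 1 \<and> E c e' w \<and> v = w * c))"
definition "rdecomp E b m e a r = (\<exists>p q. E b e p \<and> E b (e+(1::nat)) q \<and>
   m = p * a + r \<and> p \<le> m \<and> m < q \<and> 0 < a \<and> a < b \<and> (r::nat) < p)"
definition "rchange E U K = (\<forall>b c m v. K b c m v \<longleftrightarrow>
     (m < b \<and> U m v) \<or>
     (b \<le> m \<and> (\<exists>e a r. rdecomp E b m e a r \<and>
        (\<exists>e' p a' r'. K b c e e' \<and> E c e' p \<and> U a a' \<and> K b c r r' \<and> v = p * a' + r'))))"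
definition "radm C U K n b c v = (C c \<and> K b c n v \<and> (\<exists>n' w. n = n'+(1::nat) \<and> U n' w \<and> w < v) \<and> rbelow C v c)"
definition "rup E B C U K = (rchange E U K \<and> (\<forall>n v. U n v \<longleftrightarrow> (\<exists>\<mu>. rmin B \<mu> \<and>
   ((n < \<mu> \<and> v = n) \<or> (\<mu> \<le> n \<and> (\<exists>b c. rbase B n b \<and> radm C U K n b c v \<and>
     (\<forall>c'. c' < c \<longrightarrow> \<not>(\<exists>v'. radm C U K n b c' v'))))))))"
definition "rstage E B i St U K D = (
     (\<forall>n. rup E B (St n) (U n) (K n)) \<and>
     (\<forall>n j d. D n j d \<longleftrightarrow> (\<exists>n'. n = n' + 1 \<and>
        ((j = (0::nat) \<and> rmax (St n') d) \<or>
         (\<exists>j' d' b. j = j' + 1 \<and> D n j' d' \<and> rbase B n b \<and> K n' b d' n d)))) \<and>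
     (\<forall>n x. St n x \<longleftrightarrow> (\<exists>\<mu>. rmin B \<mu> \<and>
        ((n \<le> \<mu> \<and> x = \<mu> + 1) \<or>
         (\<mu> < n \<and> (\<exists>n'. n = n' + 1 \<and>
            (St n' x \<or>
             (B n \<and> (\<exists>b c v a. rbase B n' b \<and> rmax (St n') c \<and> K n' b c n' v \<and>
                x = c * a \<and> v < c * a \<and> (\<forall>a'. a' < a \<longrightarrow> \<not> v < c * a'))) \<or>
             (\<not> B n \<and> (\<exists>b q j. rbase B n b \<and> n = b * q \<and> 1 \<le> j \<and> j \<le> i \<and> D n j x)))))))))"
definition "rgood X E M W V H D U K G = (
     rexp E \<and> (\<forall>x. M (0::nat) x \<longleftrightarrow> X x) \<and>
     (\<forall>i x. M (i+1) x \<longleftrightarrow> (\<exists>n. W i n x)) \<and>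
     (\<forall>i. rstage E (M i) (i+1) (W i) (V i) (H i) (D i)) \<and>
     (\<forall>i. rup E (M i) (M (i+1)) (U i) (K i)) \<and>
     (\<forall>n i v. G n i v \<longleftrightarrow>
        (i = 0 \<and> v = n) \<or>
        (\<exists>i' w. i = i' + 1 \<and> G n i' w \<and> ((w = 0 \<and> v = 0) \<or> (0 < w \<and> U i' w (v + 1))))))"

lemmas ddefs = is_min_def is_max_def is_base_def below_succ_def is_exp_def is_decomp_def is_change_def
  admissible_def is_upgrade_def is_stages_def goodstein_graphs_def goodstein_terminates_def
lemmas rdefs = rmin_def rmax_def rbase_def rbelow_def rexp_def
  rdecomp_def rchange_def radm_def rup_def rstage_def rgood_def

lemma sat_goodstein_terminates: "sat v V (goodstein_terminates (\<lambda>l. l - 1) 0 1) \<longleftrightarrow>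
  (\<forall>E M W T H D U K G. rgood (\<lambda>x. x \<in> V 0) (\<lambda>c e v. (c \<rhd> e \<rhd> v) \<in> E) (\<lambda>i x. (i \<rhd> x) \<in> M)
     (\<lambda>i n x. (i \<rhd> n \<rhd> x) \<in> W) (\<lambda>i n m v. (i \<rhd> n \<rhd> m \<rhd> v) \<in> T) (\<lambda>i n b c m v. (i \<rhd> n \<rhd> b \<rhd> c \<rhd> m \<rhd> v) \<in> H)
     (\<lambda>i n j d. (i \<rhd> n \<rhd> j \<rhd> d) \<in> D) (\<lambda>i m v. (i \<rhd> m \<rhd> v) \<in> U) (\<lambda>i b c m v. (i \<rhd> b \<rhd> c \<rhd> m \<rhd> v) \<in> K)
     (\<lambda>n i v. (n \<rhd> i \<rhd> v) \<in> G) \<longrightarrow> (\<forall>n. \<exists>i. (n \<rhd> i \<rhd> 0) \<in> G))"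
  unfolding ddefs rdefs
  by (simp only: sat_P evt_simps evt_pair evt.simps diff_Suc_Suc diff_0_eq_0 minus_nat.diff_0
    One_nat_def numeral_2_eq_2 nat.case)

lemma rdecomp_iff:
  "rdecomp (\<lambda>c e v. v = c ^ e) b m e a r \<longleftrightarrow>
   2 \<le> b \<and> 0 < m \<and> e = (GREATEST e. b ^ e \<le> m) \<and> a = m div b ^ e \<and> r = m mod b ^ e"
proof
  assume "rdecomp (\<lambda>c e v. v = c ^ e) b m e a r"
  then have h: "m = b^e * a + r" "b^e \<le> m" "m < b^(e+1)" "0 < a" "a < b" "r < b^e"
    by (auto simp: rdecomp_def)
  have b: "2 \<le> b" using h by linarith
  have p: "0 < b ^ e" using b by simp
  have m: "0 < m" using h p by linarith
  let ?g = "GREATEST e. b ^ e \<le> m"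
  have g: "b ^ ?g \<le> m" "m < b ^ Suc ?g" using greatest_exponent[OF b m] by auto
  have "b ^ e < b ^ Suc ?g" "b ^ ?g < b ^ (e+1)" using g h by linarith+
  then have "e < Suc ?g" "?g < e + 1" using b by (simp_all add: power_strict_increasing_iff del: power_Suc)
  then have "e = ?g" by simp
  moreover have "a = m div b ^ e" "r = m mod b ^ e" using h p by auto
  ultimately show "2 \<le> b \<and> 0 < m \<and> e = ?g \<and> a = m div b ^ e \<and> r = m mod b ^ e" using b m by simp
next
  assume h: "2 \<le> b \<and> 0 < m \<and> e = (GREATEST e. b ^ e \<le> m) \<and> a = m div b ^ e \<and> r = m mod b ^ e"
  then have g: "b ^ e \<le> m" "m < b ^ Suc e" using greatest_exponent[of b m] by auto
  have p: "0 < b ^ e" using h by simp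
  have "a < b" using g h by (simp add: less_mult_imp_div_less)
  moreover have "0 < a" using g p h by (simp add: div_greater_zero_iff)
  ultimately show "rdecomp (\<lambda>c e v. v = c ^ e) b m e a r"
    using h g p unfolding rdecomp_def by simp
qed

lemma change_iff:
  assumes "0 < m \<or> 0 < b"
  shows "change u b c m = enat v \<longleftrightarrow>
     (m < b \<and> u m = enat v) \<or>
     (b \<le> m \<and> (\<exists>e a r. rdecomp (\<lambda>c e v. v = c ^ e) b m e a r \<and>
        (\<exists>e' p a' r'. change u b c e = enat e' \<and> p = c ^ e' \<and> u a = enat a' \<and>
            change u b c r = enat r' \<and> v = p * a' + r')))"
  unfolding rdecomp_iff
  by (subst change.simps) (use assms in \<open>auto simp: Let_def split: enat.splits\<close>)

lemma change_iff_all: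
  "change u b c m = enat v \<longleftrightarrow>
     (m < b \<and> u m = enat v) \<or>
     (b \<le> m \<and> (\<exists>e a r. rdecomp (\<lambda>c e v. v = c ^ e) b m e a r \<and>
        (\<exists>e' p a' r'. change u b c e = enat e' \<and> p = c ^ e' \<and> u a = enat a' \<and>
            change u b c r = enat r' \<and> v = p * a' + r')))"
proof (cases "0 < m \<or> 0 < b")
  case True then show ?thesis by (rule change_iff)
next
  case False
  then show ?thesis unfolding rdecomp_iff by (subst change.simps) auto
qed

lemma rchange_ex: "rchange (\<lambda>c e v. v = c ^ e) (\<lambda>n v. u n = enat v) (\<lambda>b c m v. change u b c m = enat v)"
  unfolding rchange_def by (intro allI change_iff_all)

lemma rchange_uniq:
  assumes "rchange (\<lambda>c e v. v = c ^ e) U K" and "\<And>k v. k < b \<Longrightarrow> U k v \<longleftrightarrow> u k = enat v"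
  shows "K b c m v \<longleftrightarrow> change u b c m = enat v"
proof (induction m arbitrary: v rule: less_induct)
  case (less m)
  have *: "e < m \<and> a < b \<and> r < m" if "rdecomp (\<lambda>c e v. v = c ^ e) b m e a r" for e a r
  proof -
    have b: "2 \<le> b" "0 < m" and e: "e = (GREATEST e. b ^ e \<le> m)" and r: "r = m mod b ^ e"
      using that unfolding rdecomp_iff by auto
    have "a < b" "b ^ e \<le> m" using that by (auto simp: rdecomp_def)
    moreover have "r < b ^ e" using b r by simp
    ultimately show ?thesis using greatest_exponent_less[OF b] e by simp
  qed
  have "K b c m v \<longleftrightarrow> (m < b \<and> U m v) \<or>
     (b \<le> m \<and> (\<exists>e a r. rdecomp (\<lambda>c e v. v = c ^ e) b m e a r \<and>
        (\<exists>e' p a' r'. K b c e e' \<and> p = c ^ e' \<and> U a a' \<and> K b c r r' \<and> v = p * a' + r')))"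
    by (rule assms(1)[unfolded rchange_def, THEN spec, THEN spec, THEN spec, THEN spec])
  also have "\<dots> \<longleftrightarrow> change u b c m = enat v"
  proof -
    have k: "(\<exists>e' p a' r'. K b c e e' \<and> p = c ^ e' \<and> U a a' \<and> K b c r r' \<and> v = p * a' + r') \<longleftrightarrow>
      (\<exists>e' p a' r'. change u b c e = enat e' \<and> p = c ^ e' \<and> u a = enat a' \<and>
            change u b c r = enat r' \<and> v = p * a' + r')" if "rdecomp (\<lambda>c e v. v = c ^ e) b m e a r" for e a r
      using *[OF that] less.IH[of e] less.IH[of r] assms(2)[of a] by simp
    show ?thesis unfolding change_iff_all[of u b c m v]
      by (intro arg_cong2[where f="(\<or>)"] conj_cong ex_cong1 refl k assms(2))
  qed
  finally show ?case .
qed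

lemma rmin_iff: "Bs \<noteq> {} \<Longrightarrow> rmin (\<lambda>x. x \<in> Bs) m \<longleftrightarrow> m = Inf Bs"
  unfolding rmin_def by (metis Inf_nat_def1 cInf_lower bdd_below_bot dual_order.antisym)

lemma rmax_iff: "finite Bs \<Longrightarrow> Bs \<noteq> {} \<Longrightarrow> rmax (\<lambda>x. x \<in> Bs) m \<longleftrightarrow> m = Max Bs"
  unfolding rmax_def by (metis Max_eqI Max_ge Max_in)

lemma rbase_iff: assumes "Bs \<noteq> {}" shows "rbase (\<lambda>x. x \<in> Bs) n b \<longleftrightarrow> b = base_of Bs n"
proof -
  have ne: "{x\<in>Bs. x \<le> n} \<noteq> {} \<longleftrightarrow> Inf Bs \<le> n"
    using assms by (metis (mono_tags, lifting) Inf_nat_def1 bdd_below_bot cInf_lower empty_Collect_eq le_trans)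
  have m: "rmax (\<lambda>x. x \<in> Bs \<and> x \<le> n) b \<longleftrightarrow> Inf Bs \<le> n \<and> b = Max {x\<in>Bs. x \<le> n}"
  proof (cases "Inf Bs \<le> n")
    case True
    then show ?thesis using rmax_iff[of "{x\<in>Bs. x \<le> n}" b] ne by simp
  next
    case False
    then show ?thesis using ne unfolding rmax_def by blast
  qed
  show ?thesis unfolding rbase_def m rmin_iff[OF assms] base_of_def by auto
qed

lemma rbelow_iff: "rbelow (\<lambda>x. x \<in> C) v c \<longleftrightarrow> enat v < succ_base C c"
proof (cases "\<exists>b\<in>C. c < b")
  case True
  define l where "l = (LEAST b. b \<in> C \<and> c < b)"
  have l: "l \<in> C" "c < l" using LeastI_ex[of "\<lambda>b. b \<in> C \<and> c < b"] True unfolding l_def by auto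
  have l2: "l \<le> x" if "x \<in> C" "c < x" for x using that unfolding l_def by (auto intro: Least_le)
  have "succ_base C c = enat l" using True by (simp add: succ_base_def l_def)
  then show ?thesis using l l2 unfolding rbelow_def by (auto intro: less_le_trans)
next
  case False
  then show ?thesis by (auto simp: succ_base_def rbelow_def)
qed

lemma upgrade_iff:
  assumes B: "Bs \<noteq> {}" "0 \<notin> Bs"
  shows "upgrade Bs Cs n = enat v \<longleftrightarrow> (\<exists>\<mu>. rmin (\<lambda>x. x \<in> Bs) \<mu> \<and>
   ((n < \<mu> \<and> v = n) \<or> (\<mu> \<le> n \<and> (\<exists>b c. rbase (\<lambda>x. x \<in> Bs) n b \<and>
     radm (\<lambda>x. x \<in> Cs) (\<lambda>n v. upgrade Bs Cs n = enat v) (\<lambda>b c m v. change (upgrade Bs Cs) b c m = enat v) n b c v \<and>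
     (\<forall>c'. c' < c \<longrightarrow> \<not>(\<exists>v'. radm (\<lambda>x. x \<in> Cs) (\<lambda>n v. upgrade Bs Cs n = enat v) (\<lambda>b c m v. change (upgrade Bs Cs) b c m = enat v) n b c' v'))))))"
proof -
  let ?u = "upgrade Bs Cs"
  have I: "Inf Bs > 0" using B Inf_nat_def1 by (metis neq0_conv)
  let ?b = "base_of Bs n"
  define P where "P = (\<lambda>c. c \<in> Cs \<and> ?u (n - 1) < change ?u ?b c n \<and> change ?u ?b c n < succ_base Cs c)"
  show ?thesis
  proof (cases "n < Inf Bs")
    case True
    then show ?thesis using I B by (subst upgrade.simps) (auto simp: rmin_iff)
  next
    case False
    then have n: "n > 0" using I by simp
    have adm: "radm (\<lambda>x. x \<in> Cs) (\<lambda>n v. ?u n = enat v) (\<lambda>b c m v. change ?u b c m = enat v) n ?b c v \<longleftrightarrow>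
       P c \<and> change ?u ?b c n = enat v" for c v
    proof -
      have "(\<exists>n' w. n = n'+(1::nat) \<and> ?u n' = enat w \<and> w < v) \<longleftrightarrow> ?u (n - 1) < enat v"
        using n by (cases n; cases "?u (n-1)") auto
      then show ?thesis unfolding radm_def rbelow_iff P_def by auto
    qed
    have fin: "P c \<Longrightarrow> \<exists>v. change ?u ?b c n = enat v" for c
      unfolding P_def by (metis less_infinityE order_less_le_trans enat_ord_simps(3) not_infinity_eq order.strict_implies_order less_irrefl)
    have c: "\<not> (Bs = {} \<or> n = 0 \<or> n < Inf Bs)" using False n B by simp
    have "?u n = (if \<exists>c. P c then change ?u ?b (LEAST c. P c) n else \<infinity>)"
      using upgrade.simps[of Bs Cs n] unfolding if_not_P[OF c] P_def Let_def .
    moreover have "(\<exists>c. (P c \<and> change ?u ?b c n = enat v) \<and> (\<forall>c'<c. \<not>(\<exists>v'. P c' \<and> change ?u ?b c' n = enat v')))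
       \<longleftrightarrow> (\<exists>c. P c) \<and> change ?u ?b (LEAST c. P c) n = enat v"
    proof -
      have "(\<forall>c'<c. \<not>(\<exists>v'. P c' \<and> change ?u ?b c' n = enat v')) \<longleftrightarrow> (\<forall>c'<c. \<not> P c')" for c
        using fin by blast
      moreover have "P c \<and> (\<forall>c'<c. \<not> P c') \<longleftrightarrow> P c \<and> c = (LEAST c. P c)" for c
        by (metis LeastI Least_le not_less_Least order_neq_le_trans leI)
      ultimately show ?thesis by (metis LeastI)
    qed
    ultimately show ?thesis using False by (auto simp: rmin_iff[OF B(1)] rbase_iff[OF B(1)] adm)
  qed
qed

abbreviation "ug B C \<equiv> (\<lambda>n v. upgrade B C n = enat v)"
abbreviation "cg B C \<equiv> (\<lambda>b c m v. change (upgrade B C) b c m = enat v)"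

lemma rup_ex:
  assumes "Bs \<noteq> {}" "0 \<notin> Bs"
  shows "rup (\<lambda>c e v. v = c ^ e) (\<lambda>x. x \<in> Bs) (\<lambda>x. x \<in> Cs) (ug Bs Cs) (cg Bs Cs)"
  unfolding rup_def by (intro conjI rchange_ex allI upgrade_iff assms)

lemma rup_uniq:
  assumes B: "Bs \<noteq> {}" "0 \<notin> Bs" and r: "rup (\<lambda>c e v. v = c ^ e) (\<lambda>x. x \<in> Bs) (\<lambda>x. x \<in> Cs) U K"
  shows "U = ug Bs Cs" "K = cg Bs Cs"
proof -
  have ch: "rchange (\<lambda>c e v. v = c ^ e) U K" using r by (simp add: rup_def)
  have U: "U n v \<longleftrightarrow> upgrade Bs Cs n = enat v" for n v
  proof (induction n arbitrary: v rule: less_induct)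
    case (less n)
    have ra: "radm (\<lambda>x. x \<in> Cs) U K n b c v \<longleftrightarrow> radm (\<lambda>x. x \<in> Cs) (ug Bs Cs) (cg Bs Cs) n b c v"
      if "Inf Bs \<le> n" "rbase (\<lambda>x. x \<in> Bs) n b" for b c v
    proof -
      have "b \<le> n" using that base_of_le B by (simp add: rbase_iff)
      then have "K b c n v \<longleftrightarrow> cg Bs Cs b c n v" for v
        using rchange_uniq[OF ch, of b] less.IH by simp
      then show ?thesis using less.IH unfolding radm_def by (metis less_add_one)
    qed
    have "U n v \<longleftrightarrow> (\<exists>\<mu>. rmin (\<lambda>x. x \<in> Bs) \<mu> \<and>
   ((n < \<mu> \<and> v = n) \<or> (\<mu> \<le> n \<and> (\<exists>b c. rbase (\<lambda>x. x \<in> Bs) n b \<and> radm (\<lambda>x. x \<in> Cs) U K n b c v \<and>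
     (\<forall>c'. c' < c \<longrightarrow> \<not>(\<exists>v'. radm (\<lambda>x. x \<in> Cs) U K n b c' v'))))))"
      by (rule r[unfolded rup_def, THEN conjunct2, THEN spec, THEN spec])
    also have "\<dots> \<longleftrightarrow> upgrade Bs Cs n = enat v"
      unfolding upgrade_iff[OF B, of Cs n v] rmin_iff[OF B(1)] using ra by (simp cong: conj_cong)
    finally show ?case .
  qed
  then show "U = ug Bs Cs" by blast
  show "K = cg Bs Cs" using rchange_uniq[OF ch] U by blast
qed

lemma upgrade_pos: assumes "0 < n" shows "0 < upgrade B C n"
proof (cases "B = {} \<or> n = 0 \<or> n < Inf B")
  case True
  then have "upgrade B C n = enat n" by (subst upgrade.simps) simp
  then show ?thesis using assms by (simp add: zero_enat_def)
next
  case False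
  let ?P = "\<lambda>c. c \<in> C \<and> upgrade B C (n - 1) < change (upgrade B C) (base_of B n) c n \<and> change (upgrade B C) (base_of B n) c n < succ_base C c"
  have e: "upgrade B C n = (if \<exists>c. ?P c then change (upgrade B C) (base_of B n) (LEAST c. ?P c) n else \<infinity>)"
    using upgrade.simps[of B C n] unfolding if_not_P[OF False] Let_def .
  show ?thesis
  proof (cases "\<exists>c. ?P c")
    case True
    then have "?P (LEAST c. ?P c)" by (rule LeastI_ex)
    then have "upgrade B C (n - 1) < change (upgrade B C) (base_of B n) (LEAST c. ?P c) n" by blast
    then show ?thesis unfolding e if_P[OF True] by (rule order_le_less_trans[OF i0_lb])
  next
    case False
    show ?thesis unfolding e if_not_P[OF False] by simp
  qed
qed

lemma change_pos:
  assumes "\<And>k. 0 < k \<Longrightarrow> 0 < u k" "0 < c" "0 < m"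
  shows "0 < change u b c m"
proof (cases "m < b \<or> b < 2")
  case True then show ?thesis using assms by (subst change.simps) (auto split: enat.splits)
next
  case False
  then have "b ^ (GREATEST e. b ^ e \<le> m) \<le> m" using greatest_exponent(1)[of b m] assms by simp
  then have "0 < u (m div b ^ (GREATEST e. b ^ e \<le> m))" using assms(1) False by (simp add: div_greater_zero_iff)
  then show ?thesis using assms(2) False by (subst change.simps) (auto simp: Let_def zero_enat_def split: enat.splits)
qed

abbreviation "it B i n \<equiv> iter (\<lambda>d. change (upgrade B (stage B i (n-1))) (base_of B n) d n) (Max (stage B i (n-1)))"

lemma finite_iterates: "finite {d. \<exists>j. 1 \<le> j \<and> j \<le> (i::nat) \<and> f j = enat d}"
proof -
  have "{d. \<exists>j. 1 \<le> j \<and> j \<le> i \<and> f j = enat d} \<subseteq> (\<lambda>j. the_enat (f j)) ` {1..i}" by (auto simp: image_iff) (metis atLeastAtMost_iff the_enat.simps One_nat_def)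
  then show ?thesis by (rule finite_subset) simp
qed

lemma finite_least: "finite {c * a | a. P a \<and> (\<forall>a'<a. \<not> P a')}" for P :: "nat \<Rightarrow> bool" and c :: nat
proof (rule finite_subset)
  show "{c * a | a. P a \<and> (\<forall>a'<a. \<not> P a')} \<subseteq> {c * (LEAST a. P a)}"
    by (auto intro: Least_equality[symmetric] simp: not_less[symmetric] cong: ) (metis Least_equality not_less)
qed simp

lemma stage_fin0: "finite (stage B i n) \<and> stage B i n \<noteq> {} \<and> 0 \<notin> stage B i n"
proof (induction n)
  case (Suc n)
  have c: "0 < Max (stage B i n)" using Suc by (metis Max_in neq0_conv)
  have pos: "0 < iter (\<lambda>d. change (upgrade B (stage B i n)) (base_of B (Suc n)) d (Suc n)) (Max (stage B i n)) j" for j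
  proof (induction j)
    case 0 then show ?case using c by (simp add: zero_enat_def)
  next
    case (Suc j)
    show ?case
    proof (cases "iter (\<lambda>d. change (upgrade B (stage B i n)) (base_of B (Suc n)) d (Suc n)) (Max (stage B i n)) j")
      case (enat d)
      then have "0 < d" using Suc by (simp add: zero_enat_def)
      then have "0 < change (upgrade B (stage B i n)) (base_of B (Suc n)) d (Suc n)"
        by (intro change_pos upgrade_pos) auto
      then show ?thesis using enat by simp
    qed simp
  qed
  have "iter (\<lambda>d. change (upgrade B (stage B i n)) (base_of B (Suc n)) d (Suc n)) (Max (stage B i n)) j \<noteq> enat 0" for j
    using pos[of j] by (auto simp: zero_enat_def)
  moreover have "\<not> (y::enat) < enat 0" for y
    by (simp flip: zero_enat_def)
  ultimately show ?case using Suc finite_iterates finite_least c by (auto simp: Let_def simp del: Max_less_iff Max_gr_iff intro!: gr0I)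
qed auto

lemmas stage_fin = stage_fin0[THEN conjunct1] stage_fin0[THEN conjunct2, THEN conjunct1] stage_fin0[THEN conjunct2, THEN conjunct2]

lemma it_iff:
  assumes B: "B \<noteq> {}"
  shows "(\<exists>n'. n = n' + 1 \<and> it B i n j = enat d) \<longleftrightarrow> (\<exists>n'. n = n' + 1 \<and>
        ((j = (0::nat) \<and> rmax (\<lambda>x. x \<in> stage B i n') d) \<or>
         (\<exists>j' d' b. j = j' + 1 \<and> (\<exists>n'. n = n' + 1 \<and> it B i n j' = enat d') \<and> rbase (\<lambda>x. x \<in> B) n b \<and> cg B (stage B i n') b d' n d)))"
  unfolding rmax_iff[OF stage_fin(1,2)] rbase_iff[OF B]
  by (cases j; cases n) (auto split: enat.splits)

definition "Dg B i n j d \<longleftrightarrow> (\<exists>n'. n = n' + 1 \<and> it B i n j = enat d)"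

lemma stage_iff:
  assumes B: "B \<noteq> {}"
  shows "x \<in> stage B i n \<longleftrightarrow> (\<exists>\<mu>. rmin (\<lambda>x. x \<in> B) \<mu> \<and>
        ((n \<le> \<mu> \<and> x = \<mu> + 1) \<or>
         (\<mu> < n \<and> (\<exists>n'. n = n' + 1 \<and>
            (x \<in> stage B i n' \<or>
             (n \<in> B \<and> (\<exists>b c v a. rbase (\<lambda>x. x \<in> B) n' b \<and> rmax (\<lambda>x. x \<in> stage B i n') c \<and> cg B (stage B i n') b c n' v \<and>
                x = c * a \<and> v < c * a \<and> (\<forall>a'. a' < a \<longrightarrow> \<not> v < c * a'))) \<or>
             (n \<notin> B \<and> (\<exists>b q j. rbase (\<lambda>x. x \<in> B) n b \<and> n = b * q \<and> 1 \<le> j \<and> j \<le> i \<and> Dg B i n j x)))))))"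
proof (cases n)
  case 0
  then show ?thesis by (simp add: rmin_iff[OF B])
next
  case (Suc m)
  let ?C = "stage B i m"
  have "(\<exists>v a. cg B ?C b c m v \<and> x = c * a \<and> v < c * a \<and> (\<forall>a'<a. \<not> v < c * a')) \<longleftrightarrow>
    x \<in> {c * a | a. change (upgrade B ?C) b c m < enat (c * a) \<and>
                        (\<forall>a'<a. \<not> change (upgrade B ?C) b c m < enat (c * a'))}" for b c
    by (cases "change (upgrade B ?C) b c m") auto
  note e = this
  show ?thesis
    unfolding rmin_iff[OF B] rbase_iff[OF B] rmax_iff[OF stage_fin(1,2)] Dg_def Suc
    using e[of "base_of B m" "Max ?C"]
    by (auto simp: Let_def dvd_def)
qed

lemma rstage_ex:
  assumes B: "B \<noteq> {}" "0 \<notin> B"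
  shows "rstage (\<lambda>c e v. v = c ^ e) (\<lambda>x. x \<in> B) i (\<lambda>n x. x \<in> stage B i n)
    (\<lambda>n. ug B (stage B i n)) (\<lambda>n. cg B (stage B i n)) (Dg B i)"
  unfolding rstage_def
  by (intro conjI allI rup_ex B stage_iff it_iff[folded Dg_def])

lemma rstage_uniq:
  assumes B: "B \<noteq> {}" "0 \<notin> B"
    and r: "rstage (\<lambda>c e v. v = c ^ e) (\<lambda>x. x \<in> B) i St U K D"
  shows "St n x \<longleftrightarrow> x \<in> stage B i n"
proof (induction n arbitrary: x)
  case 0
  have "St 0 x \<longleftrightarrow> (\<exists>\<mu>. rmin (\<lambda>x. x \<in> B) \<mu> \<and> x = \<mu> + 1)"
    using r[unfolded rstage_def, THEN conjunct2, THEN conjunct2, THEN spec, THEN spec, of 0 x] by simp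
  then show ?case by (simp add: rmin_iff[OF B(1)])
next
  case (Suc m)
  have St: "St m = (\<lambda>x. x \<in> stage B i m)" using Suc by blast
  have "rup (\<lambda>c e v. v = c ^ e) (\<lambda>x. x \<in> B) (\<lambda>x. x \<in> stage B i m) (U m) (K m)"
    by (rule r[unfolded rstage_def, THEN conjunct1, THEN spec, of m, unfolded St])
  then have K: "K m = cg B (stage B i m)" using rup_uniq(2)[OF B] by blast
  have rD: "D (Suc m) j d \<longleftrightarrow> (\<exists>n'. Suc m = n' + 1 \<and>
        ((j = (0::nat) \<and> rmax (St n') d) \<or>
         (\<exists>j' d' b. j = j' + 1 \<and> D (Suc m) j' d' \<and> rbase (\<lambda>x. x \<in> B) (Suc m) b \<and> K n' b d' (Suc m) d)))" for j d
    by (rule r[unfolded rstage_def, THEN conjunct2, THEN conjunct1, THEN spec, THEN spec, THEN spec])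
  have D: "D (Suc m) j d \<longleftrightarrow> Dg B i (Suc m) j d" for j d
  proof (induction j arbitrary: d)
    case 0
    show ?case unfolding rD[of 0] Dg_def by (auto simp: St rmax_iff[OF stage_fin(1,2)])
  next
    case (Suc j)
    show ?case unfolding rD[of "Suc j"]
      by (auto simp: Suc K Dg_def rbase_iff[OF B(1)] split: enat.splits)
  qed
  have "St (Suc m) x \<longleftrightarrow> (\<exists>\<mu>. rmin (\<lambda>x. x \<in> B) \<mu> \<and>
        ((Suc m \<le> \<mu> \<and> x = \<mu> + 1) \<or>
         (\<mu> < Suc m \<and> (\<exists>n'. Suc m = n' + 1 \<and>
            (St n' x \<or>
             (Suc m \<in> B \<and> (\<exists>b c v a. rbase (\<lambda>x. x \<in> B) n' b \<and> rmax (St n') c \<and> K n' b c n' v \<and>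
                x = c * a \<and> v < c * a \<and> (\<forall>a'. a' < a \<longrightarrow> \<not> v < c * a'))) \<or>
             (\<not> Suc m \<in> B \<and> (\<exists>b q j. rbase (\<lambda>x. x \<in> B) (Suc m) b \<and> Suc m = b * q \<and> 1 \<le> j \<and> j \<le> i \<and> D (Suc m) j x)))))))"
    by (rule r[unfolded rstage_def, THEN conjunct2, THEN conjunct2, THEN spec, THEN spec])
  then show ?case unfolding stage_iff[OF B(1), of x i "Suc m"] D by (simp add: St K)
qed

lemma base_seq_ok:
  assumes "B \<noteq> {}" "0 \<notin> B"
  shows "base_seq B i \<noteq> {}" "0 \<notin> base_seq B i"
  using assms stage_fin(2,3) by (induction i) (auto simp: ouroboros_def)

lemma goodstein_iff:
  "goodstein B n i = enat v \<longleftrightarrow> (i = 0 \<and> v = n) \<or>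
        (\<exists>i' w. i = i' + 1 \<and> goodstein B n i' = enat w \<and> ((w = 0 \<and> v = 0) \<or>
             (0 < w \<and> upgrade (base_seq B i') (base_seq B (i'+1)) w = enat (v + 1))))"
proof (cases i)
  case (Suc k)
  show ?thesis
  proof (cases "goodstein B n k")
    case (enat w)
    show ?thesis
    proof (cases "0 < w")
      case True
      then have "0 < upgrade (base_seq B k) (base_seq B (Suc k)) w" by (rule upgrade_pos)
      then show ?thesis using Suc enat True
        by (cases "upgrade (base_seq B k) (base_seq B (Suc k)) w") (auto simp: one_enat_def zero_enat_def)
    next
      case False
      then show ?thesis using Suc enat by (auto simp: zero_enat_def)
    qed
  qed (use Suc in auto)
qed auto

lemma pr2_inj[simp]: "x \<rhd> y = x' \<rhd> y' \<longleftrightarrow> x = x' \<and> y = y'"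
proof
  assume h: "x \<rhd> y = x' \<rhd> y'"
  have *: False if "a \<rhd> b = a' \<rhd> b'" "a + b < a' + b'" for a b a' b'
  proof -
    have "(a+b+1)*(a+b+1) \<le> (a'+b')*(a'+b')" using that by (intro mult_mono) auto
    moreover have "(a+b+1)*(a+b+1) = (a+b)*(a+b) + 2*(a+b) + 1" by algebra
    moreover have "False" if "x + 2*s + 1 \<le> y" "x + p = y + q" "p \<le> s" for x y s p q :: nat
      using that by linarith
    ultimately show False using that(1) unfolding pr2_def by (metis le_add1)
  qed
  have "x + y = x' + y'" using *[OF h] *[OF h[symmetric]] by (cases rule: linorder_cases) auto
  then show "x = x' \<and> y = y'" using h by (simp add: pr2_def)
qed simp

lemma rexp_uniq: assumes "rexp E" shows "E = (\<lambda>c e v. v = c ^ e)"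
proof (intro ext)
  fix c e v show "E c e v = (v = c ^ e)"
  proof (induction e arbitrary: v)
    case 0 then show ?case using assms unfolding rexp_def by (metis Suc_eq_plus1 nat.distinct(1) power_0)
  next
    case (Suc e)
    have "E c (Suc e) v \<longleftrightarrow> (\<exists>w. E c e w \<and> v = w * c)" using assms unfolding rexp_def
      by (metis Suc_eq_plus1 add_right_cancel nat.distinct(1))
    then show ?case by (simp add: Suc mult.commute)
  qed
qed

lemma rexp_ex: "rexp (\<lambda>c e v. v = c ^ e)"
  unfolding rexp_def
proof (intro allI)
  fix c e v :: nat show "(v = c ^ e) = (e = 0 \<and> v = 1 \<or> (\<exists>e' w. e = e' + 1 \<and> w = c ^ e' \<and> v = w * c))"
    by (cases e) auto
qed

lemma rgood_uniq:
  assumes B: "B \<noteq> {}" "0 \<notin> B" and r: "rgood (\<lambda>x. x \<in> B) E M W V H D U K G"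
  shows "G n i v \<longleftrightarrow> goodstein B n i = enat v"
proof -
  have E: "E = (\<lambda>c e v. v = c ^ e)" by (rule rexp_uniq[OF r[unfolded rgood_def, THEN conjunct1]])
  have M: "M i = (\<lambda>x. x \<in> base_seq B i)" for i
  proof (induction i)
    case 0 show ?case using r[unfolded rgood_def, THEN conjunct2, THEN conjunct1] by auto
  next
    case (Suc i)
    have "rstage (\<lambda>c e v. v = c ^ e) (\<lambda>x. x \<in> base_seq B i) (i+1) (W i) (V i) (H i) (D i)"
      using r[unfolded rgood_def E, THEN conjunct2, THEN conjunct2, THEN conjunct2, THEN conjunct1, THEN spec, of i, unfolded Suc] .
    then have "W i n x \<longleftrightarrow> x \<in> stage (base_seq B i) (i+1) n" for n x
      using rstage_uniq[OF base_seq_ok[OF B]] by blast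
    then show ?case using r[unfolded rgood_def, THEN conjunct2, THEN conjunct2, THEN conjunct1] by (auto simp: ouroboros_def)
  qed
  have U: "U i = ug (base_seq B i) (base_seq B (i+1))" for i
    by (rule rup_uniq(1)[OF base_seq_ok[OF B] r[unfolded rgood_def E M, THEN conjunct2, THEN conjunct2, THEN conjunct2, THEN conjunct2, THEN conjunct1, THEN spec, of i]])
  show ?thesis
  proof (induction i arbitrary: v)
    case 0
    show ?case using r[unfolded rgood_def, THEN conjunct2, THEN conjunct2, THEN conjunct2, THEN conjunct2, THEN conjunct2, THEN spec, THEN spec, THEN spec, of n 0 v] by auto
  next
    case (Suc i)
    have "G n (Suc i) v \<longleftrightarrow> (Suc i = 0 \<and> v = n) \<or>
        (\<exists>i' w. Suc i = i' + 1 \<and> G n i' w \<and> ((w = 0 \<and> v = 0) \<or> (0 < w \<and> U i' w (v + 1))))"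
      by (rule r[unfolded rgood_def, THEN conjunct2, THEN conjunct2, THEN conjunct2, THEN conjunct2, THEN conjunct2, THEN spec, THEN spec, THEN spec])
    then show ?case unfolding goodstein_iff[of B n "Suc i"] using Suc U by auto
  qed
qed

lemma rgood_ex:
  assumes B: "B \<noteq> {}" "0 \<notin> B"
  shows "rgood (\<lambda>x. x \<in> B) (\<lambda>c e v. v = c ^ e) (\<lambda>i x. x \<in> base_seq B i)
    (\<lambda>i n x. x \<in> stage (base_seq B i) (i+1) n)
    (\<lambda>i n. ug (base_seq B i) (stage (base_seq B i) (i+1) n))
    (\<lambda>i n. cg (base_seq B i) (stage (base_seq B i) (i+1) n))
    (\<lambda>i. Dg (base_seq B i) (i+1))
    (\<lambda>i. ug (base_seq B i) (base_seq B (i+1))) (\<lambda>i. cg (base_seq B i) (base_seq B (i+1)))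
    (\<lambda>n i v. goodstein B n i = enat v)"
  unfolding rgood_def
  by (intro conjI allI rexp_ex rstage_ex rup_ex base_seq_ok[OF B] goodstein_iff) (auto simp: ouroboros_def)

theorem goodstein_terminates_correct:
  assumes B: "base_hierarchy (V 0)"
  shows "sat v V (goodstein_terminates (\<lambda>l. l - 1) 0 1) \<longleftrightarrow> (\<forall>n. \<exists>i. goodstein (V 0) n i = 0)"
proof -
  have B: "V 0 \<noteq> {}" "0 \<notin> V 0" using B by (auto simp: base_hierarchy_def)
  show ?thesis
  proof
    assume h: "\<forall>n. \<exists>i. goodstein (V 0) n i = 0"
    show "sat v V (goodstein_terminates (\<lambda>l. l - 1) 0 1)"
      unfolding sat_goodstein_terminates
      using rgood_uniq[OF B] h[unfolded zero_enat_def] by fastforce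
  next
    assume h: "sat v V (goodstein_terminates (\<lambda>l. l - 1) 0 1)"
    let ?B = "V 0"
    define E where "E = {c \<rhd> e \<rhd> v | c e v. v = c ^ e}"
    define M where "M = {i \<rhd> x | i x. x \<in> base_seq ?B i}"
    define W where "W = {i \<rhd> n \<rhd> x | i n x. x \<in> stage (base_seq ?B i) (i+1) n}"
    define T where "T = {i \<rhd> n \<rhd> m \<rhd> v | i n m v. ug (base_seq ?B i) (stage (base_seq ?B i) (i+1) n) m v}"
    define H where "H = {i \<rhd> n \<rhd> b \<rhd> c \<rhd> m \<rhd> v | i n b c m v. cg (base_seq ?B i) (stage (base_seq ?B i) (i+1) n) b c m v}"
    define D where "D = {i \<rhd> n \<rhd> j \<rhd> d | i n j d. Dg (base_seq ?B i) (i+1) n j d}"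
    define U where "U = {i \<rhd> m \<rhd> v | i m v. ug (base_seq ?B i) (base_seq ?B (i+1)) m v}"
    define K where "K = {i \<rhd> b \<rhd> c \<rhd> m \<rhd> v | i b c m v. cg (base_seq ?B i) (base_seq ?B (i+1)) b c m v}"
    define G where "G = {n \<rhd> i \<rhd> v | n i v. goodstein ?B n i = enat v}"
    have e: "(\<lambda>c e v. c \<rhd> e \<rhd> v \<in> E) = (\<lambda>c e v. v = c ^ e)"
      "(\<lambda>i x. i \<rhd> x \<in> M) = (\<lambda>i x. x \<in> base_seq ?B i)"
      "(\<lambda>i n x. i \<rhd> n \<rhd> x \<in> W) = (\<lambda>i n x. x \<in> stage (base_seq ?B i) (i+1) n)"
      "(\<lambda>i n m v. i \<rhd> n \<rhd> m \<rhd> v \<in> T) = (\<lambda>i n. ug (base_seq ?B i) (stage (base_seq ?B i) (i+1) n))"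
      "(\<lambda>i n b c m v. i \<rhd> n \<rhd> b \<rhd> c \<rhd> m \<rhd> v \<in> H) = (\<lambda>i n. cg (base_seq ?B i) (stage (base_seq ?B i) (i+1) n))"
      "(\<lambda>i n j d. i \<rhd> n \<rhd> j \<rhd> d \<in> D) = (\<lambda>i. Dg (base_seq ?B i) (i+1))"
      "(\<lambda>i m v. i \<rhd> m \<rhd> v \<in> U) = (\<lambda>i. ug (base_seq ?B i) (base_seq ?B (i+1)))"
      "(\<lambda>i b c m v. i \<rhd> b \<rhd> c \<rhd> m \<rhd> v \<in> K) = (\<lambda>i. cg (base_seq ?B i) (base_seq ?B (i+1)))"
      "(\<lambda>n i v. n \<rhd> i \<rhd> v \<in> G) = (\<lambda>n i v. goodstein ?B n i = enat v)"
      unfolding E_def M_def W_def T_def H_def D_def U_def K_def G_def by auto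
    have "rgood (\<lambda>x. x \<in> V 0) (\<lambda>c e v. (c \<rhd> e \<rhd> v) \<in> E) (\<lambda>i x. (i \<rhd> x) \<in> M)
     (\<lambda>i n x. (i \<rhd> n \<rhd> x) \<in> W) (\<lambda>i n m v. (i \<rhd> n \<rhd> m \<rhd> v) \<in> T) (\<lambda>i n b c m v. (i \<rhd> n \<rhd> b \<rhd> c \<rhd> m \<rhd> v) \<in> H)
     (\<lambda>i n j d. (i \<rhd> n \<rhd> j \<rhd> d) \<in> D) (\<lambda>i m v. (i \<rhd> m \<rhd> v) \<in> U) (\<lambda>i b c m v. (i \<rhd> b \<rhd> c \<rhd> m \<rhd> v) \<in> K)
     (\<lambda>n i v. (n \<rhd> i \<rhd> v) \<in> G)" unfolding e by (rule rgood_ex[OF B])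
    then have "\<forall>n. \<exists>i. n \<rhd> i \<rhd> 0 \<in> G" using h unfolding sat_goodstein_terminates by blast
    then show "\<forall>n. \<exists>i. goodstein (V 0) n i = 0" unfolding G_def by (simp add: zero_enat_def) 
  qed
qed

end

theory Submission
  imports Defs
begin

text \<open>
  Suppose that the theory proves the sentence. We force a proper initial segment of an ultrapower of
  the natural numbers, with the traces of the internal sets as second-order part. A condition
  consists of an interval \<open>[l, u)\<close>, a function \<open>f\<close> under which the segment is going to be closed, and
  a level \<open>m\<close> such that \<open>Phi m f l < u\<close>, where \<open>Phi\<close> iterates functionals:
  \<open>Phi (m + 1) f x\<close> is the value at \<open>x\<close> of the \<open>(x + 2)\<close>-fold iterate of \<open>Phi m\<close> applied to \<open>f\<close>.
  As long as the levels are nonstandard, there is room for deciding which is the first one of at most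
  \<open>l\<close> many \<open>\<Pi>\<^sub>2\<close> statements to fail in the segment, and so \<open>\<Sigma>\<^sub>2\<close> induction is forced. Forcing only
  involves negative formulas, so that it is a Kripke semantics with stable atoms.

  Now let \<open>\<mu> = min B\<^sub>0\<close> and \<open>S b > b \<mu>\<close>. If \<open>b \<in> B\<^sub>i\<close> satisfies \<open>S b > b (m + 3)\<close>, then one step takes
  \<open>b (m + 3)\<close> at time \<open>i\<close> above \<open>d (m + 2)\<close>, where \<open>d\<close> is at the top of a chain of \<open>i + 2\<close> bases
  with ratio \<open>m + 3\<close>, the lowest of which is at least the upgrade of \<open>b\<close>. By induction on \<open>m\<close>, if the
  process from \<open>b\<close> lasts until \<open>f i\<close>, the one from \<open>b (m + 2)\<close> lasts until \<open>Phi m f i\<close>. The upgrades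
  of \<open>b \<mu>\<close> have a leading digit that grows with the minimum of the hierarchy, so that the process from
  \<open>b \<mu> + k\<close>, which follows them for \<open>k\<close> steps, lasts until \<open>Phi k Suc k\<close>. For nonstandard \<open>k\<close> there is
  a condition with \<open>l = b \<mu> + k\<close>, \<open>u = Phi k Suc k\<close> and a function \<open>f\<close> that bounds all the witnesses
  required by the definition of the process.
\<close>

section \<open>Iteration of functionals\<close>

text \<open>The number \<open>x + 2\<close> of iterations in \<open>Phi\<close> meets two demands at
  once. For the process, the successor with index \<open>i + 1\<close> yields the chain
  \<open>d 0\<close>, ..., \<open>d (i + 1)\<close>, and each of these \<open>i + 2\<close> bases
  contributes one application of \<open>Phi m\<close>. For induction, at most \<open>l + 1\<close>
  statements have to be settled, at one application each, and one more application keeps the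
  remaining level. A further obstacle is that the sentence quantifies over sets coding the whole
  process. The true graphs have to satisfy their defining formula in the segment as well, where
  fewer numbers are available as witnesses. They do because suitable witnesses are bounded in terms
  of the parameters by a function of primitive recursive growth, which lies below
  \<open>Phi q Suc\<close> for a fixed standard \<open>q\<close>. Closing the segment under it costs
  only standardly many of the nonstandard levels. The bounds depend on \<open>B0\<close> only
  through its minimum, and the sets of the segment come from arbitrary sequences of sets, so
  \<open>B0\<close> need not be definable.\<close>

definition infl :: "(nat \<Rightarrow> nat) \<Rightarrow> bool" where
  "infl f \<longleftrightarrow> mono f \<and> (\<forall>x. x \<le> f x)"

primrec Phi :: "nat \<Rightarrow> (nat \<Rightarrow> nat) \<Rightarrow> nat \<Rightarrow> nat" where
  "Phi 0 f = f \<circ> f"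
| "Phi (Suc m) f = (\<lambda>x. (Phi m ^^ (x + 2)) f x)"

lemma infl_monoD: "infl f \<Longrightarrow> x \<le> y \<Longrightarrow> f x \<le> f y"
  by (simp add: infl_def monoD)

lemma infl_le: "infl f \<Longrightarrow> x \<le> f x"
  by (simp add: infl_def)

lemma inflI: "(\<And>x y. x \<le> y \<Longrightarrow> f x \<le> f y) \<Longrightarrow> (\<And>x. x \<le> f x) \<Longrightarrow> infl f"
  by (simp add: infl_def mono_def)

lemma infl_Suc: "infl Suc"
  by (simp add: infl_def mono_def)

lemma infl_comp: "infl f \<Longrightarrow> infl g \<Longrightarrow> infl (f \<circ> g)"
  by (intro inflI) (auto intro: infl_monoD infl_le order_trans)

lemma infl_funpow: "infl f \<Longrightarrow> infl (f ^^ n)"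
  by (induction n) (auto intro: infl_comp, simp add: infl_def mono_def)

lemma funpow_infl_mono:
  assumes "infl f" "m \<le> n" "x \<le> y" shows "(f ^^ m) x \<le> (f ^^ n) y"
proof -
  have "(f ^^ n) y = (f ^^ (n - m)) ((f ^^ m) y)"
    using assms(2) funpow_add[of "n - m" m f] by simp
  then show ?thesis
    using infl_le[OF infl_funpow[OF assms(1)], of "(f ^^ m) y" "n - m"]
      infl_monoD[OF infl_funpow[OF assms(1)] assms(3), of m] by linarith
qed

lemma funpow_le_funpow:
  assumes "infl g" "\<And>x. f x \<le> g x" shows "(f ^^ n) x \<le> (g ^^ n) x"
proof (induction n)
  case (Suc n)
  then show ?case using assms(2)[of "(f ^^ n) x"] infl_monoD[OF assms(1) Suc] by simp
qed simp

text \<open>All the monotonicity properties of \<^term>\<open>Phi m\<close> have to be proved simultaneously.\<close>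

lemma Phi_props:
  "(\<forall>f. infl f \<longrightarrow> infl (Phi m f) \<and> (\<forall>x. f (f x) \<le> Phi m f x)) \<and>
   (\<forall>f g. infl f \<longrightarrow> infl g \<longrightarrow> (\<forall>x. f x \<le> g x) \<longrightarrow> (\<forall>x. Phi m f x \<le> Phi m g x))"
proof (induction m)
  case 0
  show ?case
  proof (intro conjI allI HOL.impI)
    fix f :: "nat \<Rightarrow> nat" assume "infl f"
    then show "infl (Phi 0 f)" unfolding Phi.simps by (intro infl_comp)
  next
    fix f g :: "nat \<Rightarrow> nat" and x assume h: "infl f" "infl g" "\<forall>x. f x \<le> g x"
    show "Phi 0 f x \<le> Phi 0 g x"
      using h(3)[rule_format, of "f x"] infl_monoD[OF h(2) h(3)[rule_format, of x]] by simp
  qed simp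
next
  case (Suc m)
  have P: "infl (Phi m f)" "f (f x) \<le> Phi m f x" "f x \<le> Phi m f x" if "infl f" for f x
  proof -
    show p: "infl (Phi m f)" "f (f x) \<le> Phi m f x" using Suc that by simp_all
    show "f x \<le> Phi m f x" using infl_le[OF that, of "f x"] p(2) by simp
  qed
  have I: "infl ((Phi m ^^ n) f)" if "infl f" for f n
    by (induction n) (use P that in auto)
  have up: "(Phi m ^^ n) f x \<le> (Phi m ^^ (n + k)) f x" if "infl f" for f n k x
  proof (induction k)
    case (Suc k)
    then show ?case using P(3)[OF I[OF that, of "n + k"], of x] by simp
  qed simp
  have "infl (Phi (Suc m) f)" if f: "infl f" for f
  proof (intro inflI)
    fix x y :: nat assume "x \<le> y"
    then have "(Phi m ^^ (x + 2)) f x \<le> (Phi m ^^ (x + 2 + (y - x))) f x" by (intro up f)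
    also have "\<dots> \<le> (Phi m ^^ (y + 2)) f y"
      using \<open>x \<le> y\<close> infl_monoD[OF I[OF f, of "y + 2"]] by (simp del: funpow.simps)
    finally show "Phi (Suc m) f x \<le> Phi (Suc m) f y" by simp
  next
    fix x show "x \<le> Phi (Suc m) f x" using infl_le[OF I[OF f]] by (simp del: funpow.simps)
  qed
  moreover have "f (f x) \<le> Phi (Suc m) f x" if f: "infl f" for f x
  proof -
    have "f (f x) \<le> (Phi m ^^ 1) f x" using P(2)[OF f] by simp
    also have "\<dots> \<le> (Phi m ^^ (1 + (x + 1))) f x" by (rule up[OF f])
    finally show ?thesis by simp
  qed
  moreover have "Phi (Suc m) f x \<le> Phi (Suc m) g x" if "infl f" "infl g" "\<forall>x. f x \<le> g x" for f g x
  proof -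
    have "\<forall>x. (Phi m ^^ n) f x \<le> (Phi m ^^ n) g x" for n
      by (induction n) (use that I Suc in auto)
    then show ?thesis by (simp del: funpow.simps)
  qed
  ultimately show ?case by blast
qed

lemma infl_Phi: "infl f \<Longrightarrow> infl (Phi m f)"
  and Phi_ge2: "infl f \<Longrightarrow> f (f x) \<le> Phi m f x"
  and Phi_le_Phi: "infl f \<Longrightarrow> infl g \<Longrightarrow> (\<And>x. f x \<le> g x) \<Longrightarrow> Phi m f x \<le> Phi m g x"
  using Phi_props[of m] by blast+

lemma Phi_ge: "infl f \<Longrightarrow> f x \<le> Phi m f x"
  using Phi_ge2[of f x m] infl_le[of f "f x"] by simp

lemma infl_Phi_funpow: "infl f \<Longrightarrow> infl ((Phi m ^^ n) f)"
  by (induction n) (auto intro: infl_Phi)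

lemma Phi_funpow_mono:
  assumes f: "infl f" and "n \<le> k" shows "(Phi m ^^ n) f x \<le> (Phi m ^^ k) f x"
  using assms(2)
proof (induction k rule: dec_induct)
  case (step k)
  then show ?case using Phi_ge[OF infl_Phi_funpow[OF f], of k m x m] by simp
qed simp

lemma Phi_Suc_ge: "infl f \<Longrightarrow> n \<le> x + 2 \<Longrightarrow> (Phi m ^^ n) f x \<le> Phi (Suc m) f x"
  using Phi_funpow_mono[of f n "x + 2" m x] by (simp del: funpow.simps)

lemma Phi_Suc_ge_Phi: "infl f \<Longrightarrow> Phi m f x \<le> Phi (Suc m) f x"
  using Phi_Suc_ge[of f 1 x m] by simp

lemma Phi_Suc_ge_Phi_Phi: "infl f \<Longrightarrow> Phi m (Phi m f) x \<le> Phi (Suc m) f x"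
  using Phi_Suc_ge[of f 2 x m] by (simp add: numeral_2_eq_2)

lemma Phi_index_mono:
  assumes "infl f" "m \<le> n" shows "Phi m f x \<le> Phi n f x"
  using assms(2) by (induction n rule: dec_induct) (auto intro: order_trans Phi_Suc_ge_Phi[OF assms(1)] simp del: Phi.simps)

text \<open>One application of \<open>f\<close> to the argument costs one level. This is how a
  number gets moved below the lower end of an interval.\<close>

lemma Phi_absorb:
  assumes "infl f" shows "Phi m f (f x) \<le> Phi (Suc m) f x"
proof -
  have "Phi m f (f x) \<le> Phi m f (Phi m f x)"
    by (intro infl_monoD[OF infl_Phi] assms Phi_ge)
  also have "\<dots> \<le> Phi m (Phi m f) x" by (intro Phi_ge2 infl_Phi assms)
  also have "\<dots> \<le> Phi (Suc m) f x" by (rule Phi_Suc_ge_Phi_Phi[OF assms])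
  finally show ?thesis .
qed

lemma Phi_absorb_funpow:
  assumes "infl f" "k \<le> m" shows "Phi (m - k) f ((f ^^ k) x) \<le> Phi m f x"
  using assms(2)
proof (induction k)
  case (Suc k)
  then have "Suc (m - Suc k) = m - k" by simp
  then have "Phi (m - Suc k) f (f ((f ^^ k) x)) \<le> Phi (m - k) f ((f ^^ k) x)"
    using Phi_absorb[OF assms(1), of "m - Suc k" "(f ^^ k) x"] by simp
  then show ?case using Suc by simp
qed simp

text \<open>For a sequence of at most \<open>a + 1\<close> statements \<open>\<forall>x. \<exists>y. R k x y\<close>, this decides which is
  the first one to fail in a segment between \<open>a\<close> and \<open>b\<close>; the recursion in \<^const>\<open>Phi\<close> is made for it.\<close>

lemma dichotomy:
  fixes R :: "nat \<Rightarrow> nat \<Rightarrow> nat \<Rightarrow> bool"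
  assumes f: "infl f" and lt: "Phi (Suc m) f a < b" and K: "K \<le> a"
  obtains a' b' f' k where "a \<le> a'" "b' \<le> b" "infl f'" "\<And>x. f x \<le> f' x" "Phi m f' a' < b'" "k \<le> K + 1"
    "\<And>j x. j < k \<Longrightarrow> f' (max a x) < b' \<Longrightarrow> \<exists>y \<le> f' (max a x). R j x y"
    "k \<le> K \<Longrightarrow> \<exists>x\<le>a'. \<forall>y<b'. \<not> R k x y"
proof -
  define g where "g j = (Phi m ^^ j) f" for j
  have g: "infl (g j)" for j unfolding g_def by (rule infl_Phi_funpow[OF f])
  have gS: "g (Suc j) = Phi m (g j)" for j by (simp add: g_def)
  have g_mono: "g j x \<le> g k x" if "j \<le> k" for j k x unfolding g_def using Phi_funpow_mono[OF f that] .
  \<comment> \<open>\<open>Q j\<close> says that statement \<open>j\<close> can be made to fail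
    while level \<open>m\<close> still fits above \<open>a'\<close> with the function
    \<open>g j\<close>. Otherwise \<open>Phi m (g j)\<close>, which is \<open>g (Suc j)\<close>,
    bounds the witnesses of statement \<open>j\<close>. So the function takes one more iteration for
    each statement found to hold.\<close>
  define Q where "Q j \<longleftrightarrow> (\<exists>a'\<ge>a. Phi m (g j) a' < b \<and> (\<exists>x\<le>a'. \<forall>y < Phi m (g j) a' + 1. \<not> R j x y))" for j
  have dom: "\<exists>y \<le> g k (max a x). R j x y" if "\<not> Q j" "j < k" "g k (max a x) < b" for j k x
  proof -
    have l: "Phi m (g j) (max a x) \<le> g k (max a x)" using g_mono[of "Suc j" k "max a x"] that(2) gS by simp
    then have "Phi m (g j) (max a x) < b" using that(3) by simp
    then have "\<exists>y < Phi m (g j) (max a x) + 1. R j x y"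
      using that(1) unfolding Q_def by (meson max.cobounded1 max.cobounded2)
    then show ?thesis using l by (metis Suc_eq_plus1 less_Suc_eq_le order_trans)
  qed
  show thesis
  proof (cases "\<exists>j\<le>K. Q j")
    case True
    define k where "k = (LEAST j. Q j)"
    have k: "Q k" "k \<le> K" unfolding k_def using True by (auto intro: LeastI Least_le order_trans)
    have nq: "\<not> Q j" if "j < k" for j using not_less_Least that unfolding k_def by blast
    obtain a' where a': "a \<le> a'" "Phi m (g k) a' < b" "\<exists>x\<le>a'. \<forall>y < Phi m (g k) a' + 1. \<not> R k x y"
      using k(1) unfolding Q_def by blast
    show thesis
    \<comment> \<open>The upper end is lowered as far as level \<open>m\<close> permits; the
      counterexample has no witness below it.\<close>
    proof (rule that[of a' "Phi m (g k) a' + 1" "g k" k])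
      show "f x \<le> g k x" for x using g_mono[of 0 k x] by (simp add: g_def)
      show "\<exists>y\<le>g k (max a x). R j x y" if "j < k" "g k (max a x) < Phi m (g k) a' + 1" for j x
        using dom[OF nq[OF that(1)] that(1), of x] that(2) a'(2) by simp
    qed (use a' k g in auto)
  next
    case False
    show thesis
    \<comment> \<open>All \<open>K + 1\<close> statements hold under \<open>g (K + 1)\<close>. Since
      \<open>K + 2 \<le> a + 2\<close>, one application of \<open>Phi m\<close> is left for the new
      condition.\<close>
    proof (rule that[of a b "g (K + 1)" "K + 1"])
      show "f x \<le> g (K + 1) x" for x using g_mono[of 0 "K + 1" x] by (simp add: g_def)
      show "\<exists>y\<le>g (K + 1) (max a x). R j x y" if "j < K + 1" "g (K + 1) (max a x) < b" for j x
        using dom[of j "K + 1" x] False that by auto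
      have "Phi m (g (K + 1)) a = (Phi m ^^ (K + 2)) f a" by (simp add: g_def)
      also have "\<dots> \<le> Phi (Suc m) f a" by (rule Phi_Suc_ge[OF f]) (use K in simp)
      finally show "Phi m (g (K + 1)) a < b" using lt by simp
    qed (use g in auto)
  qed
qed

subsection \<open>Functions of primitive recursive growth\<close>

definition tame_growth :: "(nat \<Rightarrow> nat) \<Rightarrow> bool" where
  "tame_growth g \<longleftrightarrow> (\<exists>q. \<forall>x. g x \<le> Phi q Suc x)"

lemma tame_growthI: "(\<And>x. g x \<le> Phi q Suc x) \<Longrightarrow> tame_growth g"
  by (auto simp: tame_growth_def)

lemma tame_growth_mono: "tame_growth g \<Longrightarrow> (\<And>x. f x \<le> g x) \<Longrightarrow> tame_growth f"
  unfolding tame_growth_def by (meson order_trans)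

lemma tame_growth_Suc: "tame_growth Suc"
  by (rule tame_growthI[of _ 0]) simp

lemma tame_growth_comp:
  assumes "tame_growth f" "tame_growth g" shows "tame_growth (\<lambda>x. f (g x))"
proof -
  obtain p q where p: "\<And>x. f x \<le> Phi p Suc x" and q: "\<And>x. g x \<le> Phi q Suc x"
    using assms unfolding tame_growth_def by blast
  define r where "r = max p q"
  note I = infl_Phi[OF infl_Suc]
  have "f (g x) \<le> Phi (Suc r) Suc x" for x
  proof -
    have "f (g x) \<le> Phi p Suc (g x)" by (rule p)
    also have "\<dots> \<le> Phi r Suc (g x)" by (rule Phi_index_mono[OF infl_Suc]) (simp add: r_def)
    also have "\<dots> \<le> Phi r Suc (Phi r Suc x)"
      using q[of x] Phi_index_mono[OF infl_Suc, of q r x]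
      by (intro infl_monoD[OF I]) (simp add: r_def)
    also have "\<dots> \<le> Phi r (Phi r Suc) x" by (rule Phi_ge2[OF I])
    also have "\<dots> \<le> Phi (Suc r) Suc x" by (rule Phi_Suc_ge_Phi_Phi[OF infl_Suc])
    finally show ?thesis .
  qed
  then show ?thesis by (rule tame_growthI)
qed

lemma Phi_0_funpow: "(Phi 0 ^^ n) f = f ^^ (2 ^ n)"
  by (induction n) (simp_all add: funpow_add mult_2)

lemma Phi_1: "Phi 1 f x = (f ^^ (2 ^ (x + 2))) x"
  unfolding One_nat_def Phi.simps(2) Phi_0_funpow by simp

text \<open>Level \<open>1\<close> of \<open>Phi\<close> already iterates its argument exponentially
  often, so a function at level \<open>p\<close> has its iteration at level
  \<open>p + 2\<close>.\<close>

lemma tame_growth_iterate: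
  assumes "tame_growth f" shows "tame_growth (\<lambda>x. (f ^^ x) x)"
proof -
  obtain p where p: "\<And>x. f x \<le> Phi p Suc x" using assms unfolding tame_growth_def by blast
  note I = infl_Phi[OF infl_Suc]
  \<comment> \<open>Positive, so that \<open>Phi 1\<close> lies below \<open>Phi r\<close>.\<close>
  define r where "r = Suc p"
  have "(f ^^ x) x \<le> Phi (Suc r) Suc x" for x
  proof -
    have "(f ^^ x) x \<le> (Phi r Suc ^^ x) x"
      by (intro funpow_le_funpow I)
        (use p Phi_Suc_ge_Phi[OF infl_Suc, of p] order_trans in \<open>fastforce simp: r_def simp del: Phi.simps\<close>)
    also have "\<dots> \<le> (Phi r Suc ^^ (2 ^ (x + 2))) x"
      using less_exp[of "x + 2"] by (intro funpow_infl_mono I) linarith+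
    also have "\<dots> = Phi 1 (Phi r Suc) x" by (rule Phi_1[symmetric])
    also have "\<dots> \<le> Phi r (Phi r Suc) x" by (intro Phi_index_mono I) (simp add: r_def)
    also have "\<dots> \<le> Phi (Suc r) Suc x" by (rule Phi_Suc_ge_Phi_Phi[OF infl_Suc])
    finally show ?thesis .
  qed
  then show ?thesis by (rule tame_growthI)
qed

lemma Phi_1_Suc: "Phi 1 Suc x = x + 2 ^ (x + 2)"
proof -
  have "(Suc ^^ n) x = n + x" for n x by (induction n) auto
  then show ?thesis unfolding Phi_1 by simp
qed

lemma tame_growth_exp: "tame_growth (\<lambda>x. x + 2 ^ (x + 2))"
  by (intro tame_growthI[of _ 1]) (simp only: Phi_1_Suc order_refl)

lemma tame_growth_sq: "tame_growth (\<lambda>x. (x + 1) * (x + 1))"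
proof (rule tame_growth_mono[OF tame_growth_exp])
  fix x :: nat show "(x + 1) * (x + 1) \<le> x + 2 ^ (x + 2)"
  proof (induction x)
    case (Suc x)
    have "2 * x + 3 \<le> 1 + 2 ^ (x + 2)" using less_exp[of "Suc x"] by simp
    then show ?case using Suc by (simp add: algebra_simps)
  qed simp
qed

lemma tame_growth_add:
  assumes "tame_growth f" "tame_growth g" shows "tame_growth (\<lambda>x. f x + g x)"
proof -
  obtain p q where p: "\<And>x. f x \<le> Phi p Suc x" and q: "\<And>x. g x \<le> Phi q Suc x"
    using assms unfolding tame_growth_def by blast
  have "f x + g x \<le> (Phi (max p q) Suc x + 1) * (Phi (max p q) Suc x + 1)" for x
    using p[of x] q[of x] Phi_index_mono[OF infl_Suc, of p "max p q" x]
      Phi_index_mono[OF infl_Suc, of q "max p q" x] by simp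
  moreover have "tame_growth (\<lambda>x. (Phi (max p q) Suc x + 1) * (Phi (max p q) Suc x + 1))"
    by (rule tame_growth_comp[OF tame_growth_sq]) (auto intro: tame_growthI)
  ultimately show ?thesis by (rule tame_growth_mono[rotated])
qed

lemma tame_growth_mult:
  assumes "tame_growth f" "tame_growth g" shows "tame_growth (\<lambda>x. f x * g x)"
proof (rule tame_growth_mono)
  show "tame_growth (\<lambda>x. (f x + g x + 1) * (f x + g x + 1))"
    by (rule tame_growth_comp[OF tame_growth_sq]) (rule tame_growth_add[OF assms])
qed (simp add: algebra_simps)

lemma tame_growth_const: "tame_growth (\<lambda>x. c)"
proof (induction c)
  case 0 show ?case by (rule tame_growth_mono[OF tame_growth_Suc]) simp
next
  case (Suc c) show ?case by (rule tame_growth_comp[OF tame_growth_Suc Suc])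
qed

lemma tame_growth_id: "tame_growth (\<lambda>x. x)"
  by (rule tame_growth_mono[OF tame_growth_Suc]) simp

lemma tame_growth_power:
  assumes "tame_growth f" "tame_growth g" shows "tame_growth (\<lambda>x. f x ^ g x)"
proof (rule tame_growth_mono)
  show "tame_growth (\<lambda>x. f x * g x + 2 ^ (f x * g x + 2))"
    using tame_growth_comp[OF tame_growth_exp tame_growth_mult[OF assms]] .
  fix x
  have "f x ^ g x \<le> (2 ^ f x) ^ g x" using less_exp[of "f x"] by (intro power_mono) auto
  also have "\<dots> = 2 ^ (f x * g x)" by (simp add: power_mult)
  also have "\<dots> \<le> 2 ^ (f x * g x + 2)" by (rule power_increasing) auto
  finally show "f x ^ g x \<le> f x * g x + 2 ^ (f x * g x + 2)" by simp
qed

lemma tame_growth_funpow: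
  assumes "tame_growth T" "infl T" "tame_growth f" "tame_growth g"
  shows "tame_growth (\<lambda>x. (T ^^ f x) (g x))"
proof (rule tame_growth_mono)
  show "tame_growth (\<lambda>x. (T ^^ (f x + g x)) (f x + g x))"
    using tame_growth_comp[OF tame_growth_iterate[OF assms(1)] tame_growth_add[OF assms(3,4)]] .
qed (intro funpow_infl_mono assms, auto)

lemmas tame_growth_intros = tame_growth_add tame_growth_mult tame_growth_power tame_growth_const tame_growth_id
  tame_growth_funpow

section \<open>Diagonalization over functions of primitive recursive growth\<close>

lemma strict_mono_Phi: "strict_mono f \<Longrightarrow> strict_mono (Phi m f)"
proof (induction m arbitrary: f)
  case 0 then show ?case by (simp add: strict_mono_def)
next
  case (Suc m)
  have s: "strict_mono ((Phi m ^^ k) f)" for k by (induction k) (auto intro: Suc)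
  have inf: "infl f" using Suc.prems
    by (auto simp: infl_def strict_mono_imp_increasing intro: strict_mono_mono)
  show ?case
  proof (rule strict_monoI)
    fix x y :: nat assume "x < y"
    then have "(Phi m ^^ (x + 2)) f x < (Phi m ^^ (x + 2)) f y" using s strict_monoD by blast
    also have "\<dots> \<le> (Phi m ^^ (y + 2)) f y" using \<open>x < y\<close> by (intro Phi_funpow_mono[OF inf]) simp
    finally show "Phi (Suc m) f x < Phi (Suc m) f y" by (simp del: funpow.simps)
  qed
qed

text \<open>Provides the initial condition: with lower end \<open>c + x\<close> and a closure
  function of tame growth, all but a fixed number of the levels up to \<open>x\<close> fit below
  \<open>Phi x Suc x\<close>.\<close>

lemma Phi_Suc_dominates:
  assumes "infl g" "tame_growth g"
  obtains q where "\<And>x. c + q \<le> x \<Longrightarrow> Phi (x - q) g (c + x) < Phi x Suc x"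
proof -
  obtain p where p: "\<And>x. g x \<le> Phi p Suc x" using assms unfolding tame_growth_def by blast
  \<comment> \<open>Makes \<open>n = x - 3\<close> at least \<open>p + 1\<close> and at least
    \<open>x - q\<close>. The levels from \<open>n\<close> to \<open>x\<close> then absorb the shift
    of the argument and the replacement of \<open>?u\<close> by \<open>Suc\<close>.\<close>
  define q where "q = p + 5"
  note I = infl_Phi[OF infl_Suc]
  have "Phi (x - q) g (c + x) < Phi x Suc x" if x: "c + q \<le> x" for x
  proof -
    define n where "n = x - 3"
    let ?u = "Phi (Suc p) Suc"
    have n: "x = Suc (Suc (Suc n))" "Suc p \<le> n" "x - q \<le> n" using x by (auto simp: n_def q_def)
    have "Phi (x - q) g (c + x) \<le> Phi n g (c + x)" by (rule Phi_index_mono[OF assms(1) n(3)])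
    also have "\<dots> \<le> Phi n ?u (c + x)"
      using p Phi_Suc_ge_Phi[OF infl_Suc, of p] by (intro Phi_le_Phi assms I) (meson order_trans)
    \<comment> \<open>Strictness is bought by raising the argument by \<open>1\<close>; the result
      is still below \<open>?u x\<close>, which is at least exponential in \<open>x\<close>.\<close>
    also have "\<dots> < Phi n ?u (Suc (c + x))"
    proof -
      have "strict_mono Suc" by (simp add: strict_mono_def)
      then have "strict_mono (Phi n ?u)" by (intro strict_mono_Phi)
      then show ?thesis by (rule strict_monoD) simp
    qed
    also have "\<dots> \<le> Phi n ?u (?u x)"
    proof (rule infl_monoD[OF infl_Phi[OF I]])
      have "Suc (c + x) \<le> x + 2 ^ (x + 2)" using x less_exp[of "x + 2"] by (simp add: q_def)
      also have "\<dots> = Phi 1 Suc x"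
        by (rule Phi_1_Suc[symmetric])
      also have "\<dots> \<le> ?u x" by (rule Phi_index_mono[OF infl_Suc]) simp
      finally show "Suc (c + x) \<le> ?u x" .
    qed
    also have "\<dots> \<le> Phi (Suc n) ?u x" by (rule Phi_absorb[OF I])
    also have "\<dots> \<le> Phi (Suc n) (Phi (Suc n) Suc) x"
      using n(2) by (intro Phi_le_Phi I Phi_index_mono infl_Suc) simp
    also have "\<dots> \<le> Phi (Suc (Suc n)) Suc x" by (rule Phi_Suc_ge_Phi_Phi[OF infl_Suc])
    also have "\<dots> \<le> Phi x Suc x" by (rule Phi_index_mono[OF infl_Suc]) (simp add: n(1))
    finally show ?thesis .
  qed
  then show thesis by (rule that)
qed

section \<open>Forcing with intervals\<close>

text \<open>
  A condition describes an initial segment of an ultrapower of the natural numbers: the segment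
  contains \<open>lo\<close>, is closed under \<open>fn\<close> and lies below \<open>hi\<close>, and the level \<open>lv\<close> measures the
  room between \<open>lo\<close> and \<open>hi\<close>. The filter \<open>flt\<close> approximates the ultrafilter. Numbers are named by
  sequences of numbers, and sets by arbitrary sequences of sets.
\<close>

datatype cond = Cond (flt: "nat filter") (lo: "nat \<Rightarrow> nat") (fn: "nat \<Rightarrow> nat \<Rightarrow> nat") (hi: "nat \<Rightarrow> nat") (lv: "nat \<Rightarrow> nat")

text \<open>Closure under the square of \<open>x + 1\<close> gives closure under addition and
  multiplication.\<close>

definition good :: "(nat \<Rightarrow> nat) \<Rightarrow> bool" where
  "good f \<longleftrightarrow> infl f \<and> (\<forall>x. (x + 1) * (x + 1) \<le> f x)"

text \<open>Levels that tend to infinity along the filter are nonstandard in every ultrapower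
  refining it.\<close>

definition ok :: "cond \<Rightarrow> bool" where
  "ok p \<longleftrightarrow> flt p \<noteq> bot \<and> filterlim (lv p) at_top (flt p) \<and>
     (\<forall>\<^sub>F i in flt p. good (fn p i) \<and> Phi (lv p i) (fn p i) (lo p i) < hi p i)"

text \<open>The levels are not compared. They may drop by any amount that keeps them nonstandard,
  and this pays for larger \<open>lo\<close> and \<open>fn\<close> and for smaller
  \<open>hi\<close>.\<close>

definition ext :: "cond \<Rightarrow> cond \<Rightarrow> bool" (infix "\<preceq>" 50) where
  "q \<preceq> p \<longleftrightarrow> ok q \<and> flt q \<le> flt p \<and>
     (\<forall>\<^sub>F i in flt q. lo p i \<le> lo q i \<and> hi q i \<le> hi p i \<and> (\<forall>x. fn p i x \<le> fn q i x))"

text \<open>The number \<open>k\<close> is standard and independent of \<open>i\<close>: these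
  sequences lie in every segment that contains \<open>lo\<close> and is closed under
  \<open>fn\<close>.\<close>

definition dom :: "cond \<Rightarrow> (nat \<Rightarrow> nat) \<Rightarrow> bool" where
  "dom p x \<longleftrightarrow> (\<exists>k. \<forall>\<^sub>F i in flt p. x i \<le> (fn p i ^^ k) (lo p i))"

text \<open>Extensions can put more numbers into the segment, so \<open>AllN\<close> has to look at
  them. Sets are named by the same sequences in all conditions, so \<open>AllS\<close> does
  not.\<close>

primrec forces :: "fm \<Rightarrow> cond \<Rightarrow> (nat \<Rightarrow> nat \<Rightarrow> nat) \<Rightarrow> (nat \<Rightarrow> nat \<Rightarrow> nat set) \<Rightarrow> bool" where
  "forces (Eq s t) p v V = (\<forall>\<^sub>F i in flt p. evt (\<lambda>k. v k i) s = evt (\<lambda>k. v k i) t)"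
| "forces (Lt s t) p v V = (\<forall>\<^sub>F i in flt p. evt (\<lambda>k. v k i) s < evt (\<lambda>k. v k i) t)"
| "forces (Mem t X) p v V = (\<forall>\<^sub>F i in flt p. evt (\<lambda>k. v k i) t \<in> V X i)"
| "forces Bot p v V = False"
| "forces (Imp A B) p v V = (\<forall>q. q \<preceq> p \<longrightarrow> forces A q v V \<longrightarrow> forces B q v V)"
| "forces (AllN A) p v V = (\<forall>q x. q \<preceq> p \<longrightarrow> dom q x \<longrightarrow> forces A q (case_nat x v) V)"
| "forces (AllS A) p v V = (\<forall>X. forces A p v (case_nat X V))"

lemma ext_ok: "q \<preceq> p \<Longrightarrow> ok q" by (simp add: ext_def)
lemma ext_flt: "q \<preceq> p \<Longrightarrow> flt q \<le> flt p" by (simp add: ext_def)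
lemma ext_refl: "ok p \<Longrightarrow> p \<preceq> p" by (simp add: ext_def)

lemma ext_eventually: "q \<preceq> p \<Longrightarrow> eventually P (flt p) \<Longrightarrow> eventually P (flt q)"
  using ext_flt filter_leD by blast

lemma ext_trans:
  assumes "r \<preceq> q" "q \<preceq> p" shows "r \<preceq> p"
proof -
  have "\<forall>\<^sub>F i in flt r. lo p i \<le> lo q i \<and> hi q i \<le> hi p i \<and> (\<forall>x. fn p i x \<le> fn q i x)"
    using assms(2) by (intro ext_eventually[OF assms(1)]) (simp add: ext_def)
  moreover have "\<forall>\<^sub>F i in flt r. lo q i \<le> lo r i \<and> hi r i \<le> hi q i \<and> (\<forall>x. fn q i x \<le> fn r i x)"
    using assms(1) by (simp add: ext_def)
  ultimately have "\<forall>\<^sub>F i in flt r. lo p i \<le> lo r i \<and> hi r i \<le> hi p i \<and> (\<forall>x. fn p i x \<le> fn r i x)"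
    by eventually_elim (meson order_trans)
  then show ?thesis using assms unfolding ext_def by auto
qed

lemma ok_good: "ok p \<Longrightarrow> \<forall>\<^sub>F i in flt p. good (fn p i)"
  unfolding ok_def by (auto elim: eventually_mono)

lemma good_infl: "good f \<Longrightarrow> infl f" by (simp add: good_def)

text \<open>Used when \<open>S\<close> is frequent, so that the refined filter is still proper. The
  interval does not change.\<close>

definition restr :: "cond \<Rightarrow> (nat \<Rightarrow> bool) \<Rightarrow> cond" where
  "restr p S = Cond (inf (flt p) (principal {i. S i})) (lo p) (fn p) (hi p) (lv p)"

lemma restr_sel[simp]: "flt (restr p S) = inf (flt p) (principal {i. S i})"
  "lo (restr p S) = lo p" "fn (restr p S) = fn p" "hi (restr p S) = hi p" "lv (restr p S) = lv p"
  by (simp_all add: restr_def)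

lemma restr_ext:
  assumes "ok p" "frequently S (flt p)" shows "restr p S \<preceq> p" "eventually S (flt (restr p S))"
proof -
  have "flt (restr p S) \<noteq> bot"
    using assms(2) by (simp add: frequently_def trivial_limit_def eventually_inf_principal)
  moreover have l: "flt (restr p S) \<le> flt p" by simp
  ultimately show "restr p S \<preceq> p" using assms(1) unfolding ext_def ok_def restr_sel
    using filterlim_mono[OF _ order_refl l] filter_leD[OF l] by auto
  show "eventually S (flt (restr p S))" by (simp add: eventually_inf_principal)
qed

lemma not_eventually_False: "ok p \<Longrightarrow> \<not> (\<forall>\<^sub>F i in flt p. False)"
  by (simp add: ok_def trivial_limit_def)

text \<open>If \<open>S\<close> is not eventually true, its negation is frequent, and the filter can
  be restricted to it.\<close>

lemma eventually_by_ext: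
  assumes "ok p" "\<And>q. q \<preceq> p \<Longrightarrow> eventually (\<lambda>i. \<not> S i) (flt q) \<Longrightarrow> False"
  shows "eventually S (flt p)"
proof (rule ccontr)
  assume "\<not> eventually S (flt p)"
  then have "frequently (\<lambda>i. \<not> S i) (flt p)" by (simp add: not_eventually)
  then show False using restr_ext[OF assms(1)] assms(2) by blast
qed

subsection \<open>The generic initial segment\<close>

lemma dom_ext: assumes "dom p x" "q \<preceq> p" shows "dom q x"
proof -
  obtain k where k: "\<forall>\<^sub>F i in flt p. x i \<le> (fn p i ^^ k) (lo p i)" using assms(1) by (auto simp: dom_def)
  have "\<forall>\<^sub>F i in flt q. x i \<le> (fn q i ^^ k) (lo q i)"
    using ext_eventually[OF assms(2) k] ok_good[OF ext_ok[OF assms(2)]] assms(2)[unfolded ext_def, THEN conjunct2, THEN conjunct2]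
  proof eventually_elim
    case (elim i)
    have "x i \<le> (fn p i ^^ k) (lo p i)" using elim by simp
    also have "\<dots> \<le> (fn q i ^^ k) (lo p i)" using elim by (intro funpow_le_funpow good_infl) auto
    also have "\<dots> \<le> (fn q i ^^ k) (lo q i)" using elim by (intro funpow_infl_mono good_infl) auto
    finally show ?case .
  qed
  then show ?thesis by (auto simp: dom_def)
qed

lemma dom_mono: assumes "dom p y" "\<forall>\<^sub>F i in flt p. x i \<le> y i" shows "dom p x"
proof -
  obtain k where "\<forall>\<^sub>F i in flt p. y i \<le> (fn p i ^^ k) (lo p i)" using assms(1) by (auto simp: dom_def)
  then have "\<forall>\<^sub>F i in flt p. x i \<le> (fn p i ^^ k) (lo p i)" using assms(2) by eventually_elim simp
  then show ?thesis by (auto simp: dom_def)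
qed

lemma dom_funpow: assumes "ok p" "dom p x" shows "dom p (\<lambda>i. (fn p i ^^ j) (x i))"
proof -
  obtain k where k: "\<forall>\<^sub>F i in flt p. x i \<le> (fn p i ^^ k) (lo p i)" using assms(2) by (auto simp: dom_def)
  have "\<forall>\<^sub>F i in flt p. (fn p i ^^ j) (x i) \<le> (fn p i ^^ (j + k)) (lo p i)"
    using k ok_good[OF assms(1)]
    by eventually_elim (simp add: funpow_add funpow_infl_mono good_infl)
  then show ?thesis by (auto simp: dom_def)
qed

lemma dom_max: assumes "ok p" "dom p x" "dom p y" shows "dom p (\<lambda>i. max (x i) (y i))"
proof -
  obtain j k where k: "\<forall>\<^sub>F i in flt p. x i \<le> (fn p i ^^ j) (lo p i)"
    "\<forall>\<^sub>F i in flt p. y i \<le> (fn p i ^^ k) (lo p i)" using assms(2,3) by (auto simp: dom_def)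
  have "\<forall>\<^sub>F i in flt p. max (x i) (y i) \<le> (fn p i ^^ (max j k)) (lo p i)"
    using k ok_good[OF assms(1)]
  proof eventually_elim
    case (elim i)
    have "(fn p i ^^ j) (lo p i) \<le> (fn p i ^^ (max j k)) (lo p i)" "(fn p i ^^ k) (lo p i) \<le> (fn p i ^^ (max j k)) (lo p i)"
      using elim by (auto intro!: funpow_infl_mono good_infl)
    then show ?case using elim by simp
  qed
  then show ?thesis by (auto simp: dom_def)
qed

lemma dom_const: "dom p (\<lambda>i. 0)" by (auto simp: dom_def)

lemma dom_bound:
  fixes k :: nat
  assumes "ok p" "\<forall>j<k. dom p (x j)"
  obtains y where "dom p y" "\<And>i j. j < k \<Longrightarrow> x j i \<le> y i"
proof -
  have "\<exists>y. dom p y \<and> (\<forall>i j. j < k \<longrightarrow> x j i \<le> y i)" using assms(2)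
  proof (induction k)
    case 0 show ?case using dom_const by blast
  next
    case (Suc k)
    then obtain y where "dom p y" "\<forall>i j. j < k \<longrightarrow> x j i \<le> y i" by auto
    then show ?case using dom_max[OF assms(1), of y "x k"] Suc
      by (intro exI[of _ "\<lambda>i. max (y i) (x k i)"]) (auto simp: less_Suc_eq le_max_iff_disj)
  qed
  then show thesis using that by blast
qed

lemma dom_op:
  assumes "ok p" "dom p x" "dom p y" "\<And>i. z i \<le> (max (x i) (y i) + 1) * (max (x i) (y i) + 1)"
  shows "dom p z"
proof (rule dom_mono[OF dom_funpow[OF assms(1) dom_max[OF assms(1-3)], of 1]])
  show "\<forall>\<^sub>F i in flt p. z i \<le> (fn p i ^^ 1) (max (x i) (y i))"
    using ok_good[OF assms(1)] by eventually_elim (use assms(4) order_trans in \<open>fastforce simp: good_def\<close>)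
qed

lemma dom_evt:
  assumes "ok p" "\<forall>k. dom p (v k)" shows "dom p (\<lambda>i. evt (\<lambda>k. v k i) t)"
proof (induction t)
  case One
  show ?case by (rule dom_op[OF assms(1) dom_const[of p] dom_const[of p]]) simp
next
  case (Add s t)
  show ?case by (rule dom_op[OF assms(1) Add]) (simp add: max_def algebra_simps)
next
  case (Mul s t)
  show ?case
  proof (rule dom_op[OF assms(1) Mul])
    fix i
    show "evt (\<lambda>k. v k i) (Mul s t) \<le> (max (evt (\<lambda>k. v k i) s) (evt (\<lambda>k. v k i) t) + 1) *
        (max (evt (\<lambda>k. v k i) s) (evt (\<lambda>k. v k i) t) + 1)"
      unfolding evt.simps by (rule mult_mono) auto
  qed
qed (use assms dom_const in auto)

text \<open>Since the levels tend to infinity, finitely many applications of \<open>fn\<close> can be moved into \<open>lo\<close>.\<close>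

lemma dom_below_lo:
  assumes "ok p" "dom p x"
  obtains q where "q \<preceq> p" "flt q = flt p" "\<forall>\<^sub>F i in flt q. x i \<le> lo q i"
proof -
  obtain k where k: "\<forall>\<^sub>F i in flt p. x i \<le> (fn p i ^^ k) (lo p i)" using assms(2) by (auto simp: dom_def)
  define q where "q = Cond (flt p) (\<lambda>i. (fn p i ^^ k) (lo p i)) (fn p) (hi p) (\<lambda>i. lv p i - k)"
  have "filterlim (\<lambda>i. lv p i - k) at_top (flt p)"
  proof (rule filterlim_at_top[THEN iffD2, rule_format])
    fix Z
    have "\<forall>\<^sub>F i in flt p. Z + k \<le> lv p i" using assms(1) filterlim_at_top unfolding ok_def by blast
    then show "\<forall>\<^sub>F i in flt p. Z \<le> lv p i - k" by eventually_elim simp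
  qed
  moreover have "\<forall>\<^sub>F i in flt p. good (fn p i) \<and> Phi (lv p i - k) (fn p i) ((fn p i ^^ k) (lo p i)) < hi p i"
  proof -
    have "\<forall>\<^sub>F i in flt p. k \<le> lv p i" using assms(1) filterlim_at_top unfolding ok_def by blast
    moreover have "\<forall>\<^sub>F i in flt p. good (fn p i) \<and> Phi (lv p i) (fn p i) (lo p i) < hi p i"
      using assms(1) unfolding ok_def by blast
    ultimately show ?thesis
    proof eventually_elim
      case (elim i)
      then show ?case using Phi_absorb_funpow[OF good_infl, of "fn p i" k "lv p i" "lo p i"] by simp
    qed
  qed
  ultimately have "ok q" using assms(1) by (simp add: ok_def q_def)
  moreover have "\<forall>\<^sub>F i in flt p. lo p i \<le> (fn p i ^^ k) (lo p i)"
    using ok_good[OF assms(1)] by eventually_elim (metis good_infl infl_funpow infl_le)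
  ultimately have "q \<preceq> p" by (simp add: ext_def q_def)
  then show thesis using that k by (simp add: q_def)
qed

text \<open>In an extension where the number is below \<open>lo\<close>, the chain
  \<open>lo \<le> Phi m f lo < hi\<close> bounds it. So the segment is proper.\<close>

lemma dom_less_hi: assumes "ok p" "dom p x" shows "\<forall>\<^sub>F i in flt p. x i < hi p i"
proof -
  obtain q where q: "q \<preceq> p" "flt q = flt p" "\<forall>\<^sub>F i in flt q. x i \<le> lo q i" using dom_below_lo[OF assms] by blast
  have "\<forall>\<^sub>F i in flt q. good (fn q i) \<and> Phi (lv q i) (fn q i) (lo q i) < hi q i"
    using ext_ok[OF q(1)] by (simp add: ok_def)
  moreover have "\<forall>\<^sub>F i in flt q. hi q i \<le> hi p i" using q(1) unfolding ext_def by (auto elim: eventually_mono)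
  ultimately have "\<forall>\<^sub>F i in flt q. x i < hi p i" using q(3)
  proof eventually_elim
    case (elim i)
    then have "lo q i \<le> Phi (lv q i) (fn q i) (lo q i)" by (meson good_infl infl_Phi infl_le)
    then show ?case using elim by linarith
  qed
  then show ?thesis by (simp add: q(2))
qed

subsection \<open>Soundness\<close>

lemma forces_ext: "forces A p v V \<Longrightarrow> q \<preceq> p \<Longrightarrow> forces A q v V"
proof (induction A arbitrary: p v V)
  case (Imp A B) then show ?case by (meson forces.simps(5) ext_trans)
next
  case (AllN A) then show ?case by (meson forces.simps(6) ext_trans)
qed (auto intro: ext_eventually)

lemma eventually_stable:
  assumes "ok p" "\<And>q. q \<preceq> p \<Longrightarrow> \<exists>r. r \<preceq> q \<and> eventually S (flt r)" shows "eventually S (flt p)"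
proof (rule eventually_by_ext[OF assms(1)])
  fix q assume q: "q \<preceq> p" "\<forall>\<^sub>F i in flt q. \<not> S i"
  then obtain r where r: "r \<preceq> q" "eventually S (flt r)" using assms(2) by blast
  have "\<forall>\<^sub>F i in flt r. False" using ext_eventually[OF r(1) q(2)] r(2) by eventually_elim simp
  then show False using not_eventually_False ext_ok r by blast
qed

text \<open>The atoms are stable because filters can be restricted, and the connectives preserve
  stability. This justifies reductio ad absurdum.\<close>

lemma forces_stable:
  assumes "ok p" "\<And>q. q \<preceq> p \<Longrightarrow> \<exists>r. r \<preceq> q \<and> forces A r v V" shows "forces A p v V"
  using assms
proof (induction A arbitrary: p v V)
  case (Eq s t)
  then show ?case unfolding forces.simps by (rule eventually_stable)
next
  case (Lt s t)
  then show ?case unfolding forces.simps by (rule eventually_stable)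
next
  case (Mem t X)
  then show ?case unfolding forces.simps by (rule eventually_stable)
next
  case Bot
  then show ?case using ext_refl by (metis forces.simps(4))
next
  case (Imp A B)
  show ?case unfolding forces.simps
  proof (intro allI HOL.impI)
    fix q assume q: "q \<preceq> p" "forces A q v V"
    show "forces B q v V"
    proof (rule Imp(2)[OF ext_ok[OF q(1)]])
      fix q' assume q': "q' \<preceq> q"
      then obtain r where r: "r \<preceq> q'" "forces (Imp A B) r v V" using Imp(4) ext_trans q(1) by blast
      then have "forces B r v V" using forces_ext[OF q(2)] ext_trans[OF r(1) q'] ext_refl[OF ext_ok] by simp
      then show "\<exists>r. r \<preceq> q' \<and> forces B r v V" using r by blast
    qed
  qed
next
  case (AllN A)
  show ?case unfolding forces.simps
  proof (intro allI HOL.impI)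
    fix q x assume q: "q \<preceq> p" "dom q x"
    show "forces A q (case_nat x v) V"
    proof (rule AllN(1)[OF ext_ok[OF q(1)]])
      fix q' assume q': "q' \<preceq> q"
      then obtain r where r: "r \<preceq> q'" "forces (AllN A) r v V" using AllN(3) ext_trans q(1) by blast
      then have "forces A r (case_nat x v) V" using dom_ext[OF q(2)] ext_trans[OF r(1) q'] ext_refl[OF ext_ok] by simp
      then show "\<exists>r. r \<preceq> q' \<and> forces A r (case_nat x v) V" using r by blast
    qed
  qed
next
  case (AllS A)
  then show ?case unfolding forces.simps by metis
qed

lemma forces_Neg: "forces (Neg A) p v V \<longleftrightarrow> (\<forall>q. q \<preceq> p \<longrightarrow> \<not> forces A q v V)"
  by (simp add: Neg_def)

lemma forces_raa:
  assumes "ok p" "\<And>q. q \<preceq> p \<Longrightarrow> forces (Neg A) q v V \<Longrightarrow> False" shows "forces A p v V"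
  using assms(2) unfolding forces_Neg by (intro forces_stable[OF assms(1)]) blast

lemma evt_subt: "evt v (subt \<sigma> t) = evt (\<lambda>n. evt v (\<sigma> n)) t"
  by (induction t) auto

lemma evt_lift_trm: "evt (case_nat x v) (lift_trm t) = evt v t"
  by (simp add: lift_trm_def evt_subt)

lemma case_nat_eta: "(\<lambda>n. (case n of 0 \<Rightarrow> a | Suc n \<Rightarrow> f n) i) = case_nat (a i) (\<lambda>n. f n i)"
  by (rule ext) (simp split: nat.split)

lemma forces_sub:
  "forces (sub \<sigma> \<rho> A) p v V = forces A p (\<lambda>n i. evt (\<lambda>k. v k i) (\<sigma> n)) (\<lambda>n. V (\<rho> n))"
proof (induction A arbitrary: p v V \<sigma> \<rho>)
  case (AllN A)
  have e: "(\<lambda>n i. evt (\<lambda>k. case_nat x v k i) (case_nat (Var 0) (\<lambda>n. lift_trm (\<sigma> n)) n)) =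
     case_nat x (\<lambda>n i. evt (\<lambda>k. v k i) (\<sigma> n))" for x
    by (intro ext) (simp add: case_nat_eta evt_lift_trm split: nat.split)
  show ?case by (simp add: AllN e)
next
  case (AllS A)
  have e: "(\<lambda>n. case_nat X V (case_nat 0 (\<lambda>n. Suc (\<rho> n)) n)) = case_nat X (\<lambda>n. V (\<rho> n))" for X
    by (rule ext) (simp split: nat.split)
  show ?case by (simp add: AllS e)
qed (simp_all add: evt_subt)

lemma forces_liftN: "forces (liftN A) p (case_nat x v) V = forces A p v V"
  by (simp add: liftN_def forces_sub)

lemma forces_liftS: "forces (liftS A) p v (case_nat X V) = forces A p v V"
  by (simp add: liftS_def forces_sub)

lemma forces_instN: "forces (instN A t) p v V = forces A p (case_nat (\<lambda>i. evt (\<lambda>k. v k i) t) v) V"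
proof -
  have "(\<lambda>n i. evt (\<lambda>k. v k i) (case_nat t Var n)) = case_nat (\<lambda>i. evt (\<lambda>k. v k i) t) v"
    by (intro ext) (simp split: nat.split)
  then show ?thesis by (simp add: instN_def forces_sub)
qed

lemma forces_instS: "forces (instS A X) p v V = forces A p v (case_nat (V X) V)"
proof -
  have "(\<lambda>n. V (case_nat X (\<lambda>n. n) n)) = case_nat (V X) V" by (rule ext) (simp split: nat.split)
  then show ?thesis by (simp add: instS_def forces_sub)
qed

lemma evt_cong_eventually:
  assumes "\<And>k. \<forall>\<^sub>F i in F. v k i = w k i" shows "\<forall>\<^sub>F i in F. evt (\<lambda>k. v k i) t = evt (\<lambda>k. w k i) t"
proof (induction t)
  case (Add s t) then show ?case by eventually_elim simp
next
  case (Mul s t) then show ?case by eventually_elim simp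
qed (use assms in auto)

text \<open>Names count only up to equality in the ultrapower, which is what the equality rule
  \<open>eqE\<close> expresses.\<close>

lemma forces_cong:
  assumes "\<And>k. \<forall>\<^sub>F i in flt p. v k i = w k i" shows "forces A p v V \<longleftrightarrow> forces A p w V"
  using assms
proof (induction A arbitrary: p v w V)
  case (Eq s t)
  have "\<forall>\<^sub>F i in flt p. (evt (\<lambda>k. v k i) s = evt (\<lambda>k. v k i) t) = (evt (\<lambda>k. w k i) s = evt (\<lambda>k. w k i) t)"
    using evt_cong_eventually[where v=v and w=w and t=s, OF Eq] evt_cong_eventually[where v=v and w=w and t=t, OF Eq]
    by eventually_elim simp
  then show ?case unfolding forces.simps by (rule eventually_cong) simp
next
  case (Lt s t)
  have "\<forall>\<^sub>F i in flt p. (evt (\<lambda>k. v k i) s < evt (\<lambda>k. v k i) t) = (evt (\<lambda>k. w k i) s < evt (\<lambda>k. w k i) t)"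
    using evt_cong_eventually[where v=v and w=w and t=s, OF Lt] evt_cong_eventually[where v=v and w=w and t=t, OF Lt]
    by eventually_elim simp
  then show ?case unfolding forces.simps by (rule eventually_cong) simp
next
  case (Mem t X)
  have "\<forall>\<^sub>F i in flt p. (evt (\<lambda>k. v k i) t \<in> V X i) = (evt (\<lambda>k. w k i) t \<in> V X i)"
    using evt_cong_eventually[where v=v and w=w and t=t, OF Mem]
    by eventually_elim simp
  then show ?case unfolding forces.simps by (rule eventually_cong) simp
next
  case (Imp A B)
  have "forces A q v V = forces A q w V" "forces B q v V = forces B q w V" if "q \<preceq> p" for q
    using Imp(1,2) ext_eventually[OF that Imp(3)] by blast+
  then show ?case unfolding forces.simps by blast
next
  case (AllN A)
  have "forces A q (case_nat x v) V = forces A q (case_nat x w) V" if "q \<preceq> p" for q x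
    by (rule AllN(1)) (use ext_eventually[OF that AllN(2)] in \<open>simp split: nat.split\<close>)
  then show ?case unfolding forces.simps by blast
next
  case (AllS A)
  have "forces A p v (case_nat X V) = forces A p w (case_nat X V)" for X by (intro AllS)
  then show ?case unfolding forces.simps by blast
qed simp

text \<open>The names of the variables have to lie in the segment: \<open>AllN\<close> only speaks
  about members of \<open>dom\<close>, and its elimination rule instantiates with terms built from
  these variables.\<close>

theorem soundness:
  assumes "\<Gamma> \<turnstile> A" "ok p" "\<forall>k. dom p (v k)" "\<forall>B\<in>\<Gamma>. forces B p v V"
  shows "forces A p v V"
  using assms
proof (induction arbitrary: p v V rule: proves.induct)
  case (impI A \<Gamma> B)
  show ?case unfolding forces.simps
  proof (intro allI HOL.impI)
    fix q assume q: "q \<preceq> p" "forces A q v V"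
    show "forces B q v V"
      using impI(2)[OF ext_ok[OF q(1)]] impI(4,5) q dom_ext[OF _ q(1)] forces_ext[OF _ q(1)] by blast
  qed
next
  case (impE \<Gamma> A B)
  then have "forces (Imp A B) p v V" "forces A p v V" by blast+
  then show ?case using ext_refl[OF impE(5)] by simp
next
  case (raa A \<Gamma>)
  show ?case
  proof (rule forces_raa[OF raa(3)])
    fix q assume q: "q \<preceq> p" "forces (Neg A) q v V"
    have "forces Bot q v V"
      using raa(2)[OF ext_ok[OF q(1)]] raa(4,5) q dom_ext[OF _ q(1)] forces_ext[OF _ q(1)] by blast
    then show False by simp
  qed
next
  case (allNI \<Gamma> A)
  show ?case unfolding forces.simps
  proof (intro allI HOL.impI)
    fix q x assume q: "q \<preceq> p" "dom q x"
    have "\<forall>k. dom q (case_nat x v k)" using q dom_ext[OF _ q(1)] allNI(4) by (simp split: nat.split)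
    then show "forces A q (case_nat x v) V"
      using allNI(2)[OF ext_ok[OF q(1)]] forces_ext[OF _ q(1)] allNI(5) by (simp add: forces_liftN)
  qed
next
  case (allNE \<Gamma> A t)
  have "forces (AllN A) p v V" using allNE by blast
  then show ?case using dom_evt[OF allNE(3,4), of t] ext_refl[OF allNE(3)] by (simp add: forces_instN)
next
  case (allSI \<Gamma> A)
  show ?case unfolding forces.simps using allSI(2)[OF allSI(3,4)] allSI(5) by (simp add: forces_liftS)
next
  case (allSE \<Gamma> A X)
  have "forces (AllS A) p v V" using allSE by blast
  then show ?case by (simp add: forces_instS)
next
  case (eqE \<Gamma> s t A)
  have "forces (Eq s t) p v V" "forces (instN A s) p v V" using eqE by blast+
  then have e: "\<forall>\<^sub>F i in flt p. evt (\<lambda>k. v k i) s = evt (\<lambda>k. v k i) t"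
    "forces A p (case_nat (\<lambda>i. evt (\<lambda>k. v k i) s) v) V" by (simp_all add: forces_instN)
  have "forces A p (case_nat (\<lambda>i. evt (\<lambda>k. v k i) s) v) V = forces A p (case_nat (\<lambda>i. evt (\<lambda>k. v k i) t) v) V"
    by (rule forces_cong) (use e(1) in \<open>simp split: nat.split\<close>)
  then show ?case using e(2) by (simp add: forces_instN)
qed auto

subsection \<open>Forcing and truth\<close>

lemma ok_ev: "ok p \<Longrightarrow> \<forall>\<^sub>F i in flt p. good (fn p i) \<and> Phi (lv p i) (fn p i) (lo p i) < hi p i"
  by (simp add: ok_def)

lemma forces_Imp_mp: "forces (Imp A B) p v V \<Longrightarrow> forces A p v V \<Longrightarrow> ok p \<Longrightarrow> forces B p v V"
  using ext_refl by auto

lemma forces_And: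
  assumes "ok p" shows "forces (And A B) p v V \<longleftrightarrow> forces A p v V \<and> forces B p v V"
proof
  assume h: "forces (And A B) p v V"
  have "\<exists>r. r \<preceq> q \<and> forces A r v V \<and> forces B r v V" if q: "q \<preceq> p" for q
  proof -
    have "\<not> forces (Imp A (Neg B)) q v V" using h q unfolding And_def forces_Neg by blast
    then obtain r where r: "r \<preceq> q" "forces A r v V" "\<not> forces (Neg B) r v V" by auto
    then obtain s where "s \<preceq> r" "forces B s v V" unfolding forces_Neg by blast
    then show ?thesis using r forces_ext ext_trans by blast
  qed
  then show "forces A p v V \<and> forces B p v V" using forces_stable[OF assms] by meson
next
  assume h: "forces A p v V \<and> forces B p v V"
  show "forces (And A B) p v V" unfolding And_def forces_Neg
  proof (intro allI HOL.impI HOL.notI)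
    fix q assume q: "q \<preceq> p" "forces (Imp A (Neg B)) q v V"
    then have "forces (Neg B) q v V" using h forces_ext forces_Imp_mp ext_ok by blast
    then show False using h forces_ext q(1) ext_refl[OF ext_ok[OF q(1)]] unfolding forces_Neg by blast
  qed
qed

lemma forces_Iff_D:
  assumes "ok p" "forces (Iff A B) p v V" shows "forces A p v V \<longleftrightarrow> forces B p v V"
  using assms(2) forces_Imp_mp[OF _ _ assms(1)] unfolding Iff_def forces_And[OF assms(1)] by blast

lemma forces_ExN:
  "forces (ExN A) p v V \<longleftrightarrow> (\<forall>q. q \<preceq> p \<longrightarrow> (\<exists>r x. r \<preceq> q \<and> dom r x \<and> forces A r (case_nat x v) V))"
proof
  assume h: "forces (ExN A) p v V"
  show "\<forall>q. q \<preceq> p \<longrightarrow> (\<exists>r x. r \<preceq> q \<and> dom r x \<and> forces A r (case_nat x v) V)"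
  proof (intro allI HOL.impI)
    fix q assume "q \<preceq> p"
    then have "\<not> forces (AllN (Neg A)) q v V" using h unfolding ExN_def forces_Neg by blast
    then obtain r x where r: "r \<preceq> q" "dom r x" "\<not> forces (Neg A) r (case_nat x v) V" by auto
    then obtain s where "s \<preceq> r" "forces A s (case_nat x v) V" unfolding forces_Neg by blast
    then show "\<exists>r x. r \<preceq> q \<and> dom r x \<and> forces A r (case_nat x v) V" using r ext_trans dom_ext by blast
  qed
next
  assume h: "\<forall>q. q \<preceq> p \<longrightarrow> (\<exists>r x. r \<preceq> q \<and> dom r x \<and> forces A r (case_nat x v) V)"
  show "forces (ExN A) p v V" unfolding ExN_def forces_Neg
  proof (intro allI HOL.impI HOL.notI)
    fix q assume q: "q \<preceq> p" "forces (AllN (Neg A)) q v V"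
    then obtain r x where r: "r \<preceq> q" "dom r x" "forces A r (case_nat x v) V" using h by blast
    then have "forces (Neg A) r (case_nat x v) V" using q(2) by simp
    then show False using r ext_refl[OF ext_ok[OF r(1)]] unfolding forces_Neg by blast
  qed
qed

lemma forces_ExN_I:
  "dom p x \<Longrightarrow> forces A p (case_nat x v) V \<Longrightarrow> forces (ExN A) p v V"
  unfolding forces_ExN using forces_ext dom_ext ext_refl ext_ok by meson

text \<open>The truth of such a formula is reflected by the initial segments that are closed under \<open>P\<close>.\<close>

primrec tame :: "(nat \<Rightarrow> nat) \<Rightarrow> (nat \<Rightarrow> nat set) \<Rightarrow> nat \<Rightarrow> fm \<Rightarrow> bool" where
  "tame P V k (Eq s t) = True"
| "tame P V k (Lt s t) = True"
| "tame P V k (Mem t X) = True"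
| "tame P V k Bot = True"
| "tame P V k (Imp A B) = (tame P V k A \<and> tame P V k B)"
| "tame P V k (AllN A) = (tame P V (Suc k) A \<and>
     (\<forall>v y. (\<forall>j<k. v j \<le> y) \<longrightarrow> (\<exists>x. \<not> sat (case_nat x v) V A) \<longrightarrow> (\<exists>x\<le>P y. \<not> sat (case_nat x v) V A)))"
| "tame P V k (AllS A) = False"

lemma tame_mono: "tame P V k A \<Longrightarrow> (\<And>y. P y \<le> Q y) \<Longrightarrow> tame Q V k A"
proof (induction A arbitrary: k)
  case (AllN A)
  then show ?case unfolding tame.simps by (meson order_trans)
qed auto

text \<open>If a universal formula fails throughout an extension, tameness gives a counterexample
  below \<open>P\<close> of the parameters. It is in the segment, since \<open>P\<close> is
  dominated by a standard number of applications of \<open>fn\<close>.\<close>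

lemma forces_iff_sat:
  assumes "ok p" "\<forall>k. dom p (v k)" "\<forall>\<^sub>F i in flt p. tame (P i) (\<lambda>X. V X i) k A"
    "\<forall>\<^sub>F i in flt p. \<forall>y. P i y \<le> (fn p i ^^ n) y"
  shows "forces A p v V \<longleftrightarrow> (\<forall>\<^sub>F i in flt p. sat (\<lambda>k. v k i) (\<lambda>X. V X i) A)"
  using assms
proof (induction A arbitrary: p v k)
  case (Imp A B)
  let ?S = "\<lambda>i A. sat (\<lambda>k. v k i) (\<lambda>X. V X i) A"
  have dm: "\<forall>\<^sub>F i in flt q. \<forall>y. P i y \<le> (fn q i ^^ n) y" if "q \<preceq> p" for q
    using ext_eventually[OF that Imp(6)] ok_good[OF ext_ok[OF that]] that[unfolded ext_def, THEN conjunct2, THEN conjunct2]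
    by eventually_elim (meson funpow_le_funpow good_infl order_trans)
  have tm: "\<forall>\<^sub>F i in flt p. tame (P i) (\<lambda>X. V X i) k A" "\<forall>\<^sub>F i in flt p. tame (P i) (\<lambda>X. V X i) k B"
    using Imp(5) by (auto elim: eventually_mono)
  have A: "forces A q v V \<longleftrightarrow> eventually (\<lambda>i. ?S i A) (flt q)" if "q \<preceq> p" for q
    by (rule Imp(1)[OF ext_ok[OF that] _ ext_eventually[OF that tm(1)] dm[OF that]]) (use Imp(4) dom_ext that in blast)
  have B: "forces B q v V \<longleftrightarrow> eventually (\<lambda>i. ?S i B) (flt q)" if "q \<preceq> p" for q
    by (rule Imp(2)[OF ext_ok[OF that] _ ext_eventually[OF that tm(2)] dm[OF that]]) (use Imp(4) dom_ext that in blast)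
  show ?case
  proof
    assume h: "forces (Imp A B) p v V"
    show "\<forall>\<^sub>F i in flt p. ?S i (Imp A B)"
    proof (rule eventually_by_ext[OF Imp(3)])
      fix q assume q: "q \<preceq> p" "\<forall>\<^sub>F i in flt q. \<not> ?S i (Imp A B)"
      have "forces A q v V" unfolding A[OF q(1)] using q(2) by eventually_elim simp
      then have "\<forall>\<^sub>F i in flt q. ?S i B" using B[OF q(1)] h q(1) by simp
      then have "\<forall>\<^sub>F i in flt q. False" using q(2) by eventually_elim simp
      then show False using not_eventually_False ext_ok q by blast
    qed
  next
    assume h: "\<forall>\<^sub>F i in flt p. ?S i (Imp A B)"
    show "forces (Imp A B) p v V" unfolding forces.simps
    proof (intro allI HOL.impI)
      fix q assume q: "q \<preceq> p" "forces A q v V"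
      have "\<forall>\<^sub>F i in flt q. ?S i B" using q(2)[unfolded A[OF q(1)]] ext_eventually[OF q(1) h]
        by eventually_elim simp
      then show "forces B q v V" by (simp add: B[OF q(1)])
    qed
  qed
next
  case (AllN A)
  let ?S = "\<lambda>i x. sat (case_nat x (\<lambda>k. v k i)) (\<lambda>X. V X i) A"
  have dm: "\<forall>\<^sub>F i in flt q. \<forall>y. P i y \<le> (fn q i ^^ n) y" if "q \<preceq> p" for q
    using ext_eventually[OF that AllN(5)] ok_good[OF ext_ok[OF that]] that[unfolded ext_def, THEN conjunct2, THEN conjunct2]
    by eventually_elim (meson funpow_le_funpow good_infl order_trans)
  have tm: "\<forall>\<^sub>F i in flt p. tame (P i) (\<lambda>X. V X i) (Suc k) A"
    using AllN(4) by (auto elim: eventually_mono)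
  have A: "forces A q (case_nat x v) V \<longleftrightarrow> eventually (\<lambda>i. ?S i (x i)) (flt q)" if "q \<preceq> p" "dom q x" for q x
  proof -
    have "\<forall>k. dom q (case_nat x v k)" using that(2) dom_ext[OF _ that(1)] AllN(3) by (simp split: nat.split)
    from AllN(1)[OF ext_ok[OF that(1)] this ext_eventually[OF that(1) tm] dm[OF that(1)]]
    show ?thesis by (simp add: case_nat_eta)
  qed
  show ?case
  proof
    assume h: "forces (AllN A) p v V"
    show "\<forall>\<^sub>F i in flt p. sat (\<lambda>k. v k i) (\<lambda>X. V X i) (AllN A)"
    proof (rule eventually_by_ext[OF AllN(2)])
      fix q assume q: "q \<preceq> p" "\<forall>\<^sub>F i in flt q. \<not> sat (\<lambda>k. v k i) (\<lambda>X. V X i) (AllN A)"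
      obtain y where y: "dom p y" "\<And>i j. j < k \<Longrightarrow> v j i \<le> y i" using dom_bound[OF AllN(2), of k v] AllN(3) by blast
      define x where "x i = (SOME x. x \<le> P i (y i) \<and> \<not> ?S i x)" for i
      have x: "\<forall>\<^sub>F i in flt q. x i \<le> P i (y i) \<and> \<not> ?S i (x i)"
        using q(2) ext_eventually[OF q(1) AllN(4)]
      proof eventually_elim
        case (elim i)
        then have "\<exists>x\<le>P i (y i). \<not> ?S i x" using y(2) by simp
        then show ?case unfolding x_def by (rule someI_ex)
      qed
      have "dom q (\<lambda>i. (fn q i ^^ n) (y i))" using dom_funpow[OF ext_ok[OF q(1)] dom_ext[OF y(1) q(1)]] .
      moreover have "\<forall>\<^sub>F i in flt q. x i \<le> (fn q i ^^ n) (y i)" using x dm[OF q(1)]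
        by eventually_elim (meson order_trans)
      ultimately have "dom q x" by (rule dom_mono)
      then have "\<forall>\<^sub>F i in flt q. ?S i (x i)" using A[OF q(1)] h q(1) by simp
      then have "\<forall>\<^sub>F i in flt q. False" using x by eventually_elim simp
      then show False using not_eventually_False ext_ok q by blast
    qed
  next
    assume h: "\<forall>\<^sub>F i in flt p. sat (\<lambda>k. v k i) (\<lambda>X. V X i) (AllN A)"
    show "forces (AllN A) p v V" unfolding forces.simps
    proof (intro allI HOL.impI)
      fix q x assume q: "q \<preceq> p" "dom q x"
      have "\<forall>\<^sub>F i in flt q. ?S i (x i)" using ext_eventually[OF q(1) h] by eventually_elim simp
      then show "forces A q (case_nat x v) V" by (simp add: A[OF q])
    qed
  qed
next
  case Bot
  then show ?case using not_eventually_False by simp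
next
  case (AllS A)
  then show ?case using not_eventually_False by simp
qed auto

lemma fvt_below_mono: "fvt_below k t \<Longrightarrow> k \<le> k' \<Longrightarrow> fvt_below k' t"
  by (induction t) auto

lemma fvt_below_ex: "\<exists>k. fvt_below k t"
proof (induction t)
  case (Add s t)
  then obtain j k where "fvt_below j s" "fvt_below k t" by blast
  then have "fvt_below (max j k) s" "fvt_below (max j k) t" by (auto intro: fvt_below_mono)
  then show ?case by auto
next
  case (Mul s t)
  then obtain j k where "fvt_below j s" "fvt_below k t" by blast
  then have "fvt_below (max j k) s" "fvt_below (max j k) t" by (auto intro: fvt_below_mono)
  then show ?case by auto
qed auto

lemma evt_bounded:
  assumes "fvt_below k t" shows "\<exists>n. \<forall>f v y. good f \<longrightarrow> (\<forall>j<k. v j \<le> y) \<longrightarrow> evt v t \<le> (f ^^ n) y"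
proof -
  have op: "z \<le> (f ^^ Suc (max m n)) y"
    if f: "good f" and le: "x1 \<le> (f ^^ m) y" "x2 \<le> (f ^^ n) y" "\<And>x. x1 \<le> x \<Longrightarrow> x2 \<le> x \<Longrightarrow> z \<le> (x + 1) * (x + 1)"
    for f m n y z x1 x2
  proof -
    let ?x = "(f ^^ (max m n)) y"
    have "x1 \<le> ?x" "x2 \<le> ?x"
      using le(1,2) funpow_infl_mono[OF good_infl[OF f] _ order_refl, of _ "max m n" y]
      by (meson max.cobounded1 max.cobounded2 order_trans)+
    then have "z \<le> (?x + 1) * (?x + 1)" by (rule le(3))
    also have "\<dots> \<le> f ?x" using f by (simp add: good_def)
    finally show ?thesis by simp
  qed
  show ?thesis using assms
  proof (induction t)
    case (Var x) then show ?case by (intro exI[of _ 0]) simp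
  next
    case Zero show ?case by simp
  next
    case One
    have "1 \<le> (f ^^ 1) y" if "good f" for f y
      using that order_trans[of 1 "(y+1)*(y+1)" "f y"] by (simp add: good_def)
    then show ?case by (intro exI[of _ 1]) simp
  next
    case (Add s t)
    then obtain m n where mn: "\<forall>f v y. good f \<longrightarrow> (\<forall>j<k. v j \<le> y) \<longrightarrow> evt v s \<le> (f ^^ m) y"
      "\<forall>f v y. good f \<longrightarrow> (\<forall>j<k. v j \<le> y) \<longrightarrow> evt v t \<le> (f ^^ n) y" by auto
    show ?case
    proof (intro exI[of _ "Suc (max m n)"] allI HOL.impI)
      fix f and v :: "nat \<Rightarrow> nat" and y assume *: "good f" "\<forall>j<k. v j \<le> y"
      show "evt v (Add s t) \<le> (f ^^ Suc (max m n)) y"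
        by (rule op[OF *(1), of "evt v s" m y "evt v t" n]) (use mn * in auto)
    qed
  next
    case (Mul s t)
    then obtain m n where mn: "\<forall>f v y. good f \<longrightarrow> (\<forall>j<k. v j \<le> y) \<longrightarrow> evt v s \<le> (f ^^ m) y"
      "\<forall>f v y. good f \<longrightarrow> (\<forall>j<k. v j \<le> y) \<longrightarrow> evt v t \<le> (f ^^ n) y" by auto
    show ?case
    proof (intro exI[of _ "Suc (max m n)"] allI HOL.impI)
      fix f and v :: "nat \<Rightarrow> nat" and y assume *: "good f" "\<forall>j<k. v j \<le> y"
      show "evt v (Mul s t) \<le> (f ^^ Suc (max m n)) y"
      proof (rule op[OF *(1), of "evt v s" m y "evt v t" n])
        show "evt v (Mul s t) \<le> (x + 1) * (x + 1)" if "evt v s \<le> x" "evt v t \<le> x" for x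
          unfolding evt.simps using that by (intro mult_le_mono) auto
      qed (use mn * in auto)
    qed
  qed
qed

text \<open>A counterexample to a bounded quantifier is below the value of its bounding term, and
  this value is reached from the parameters by a number of applications of a good function that
  depends only on the term.\<close>

lemma bounded_tame:
  assumes "bounded A" shows "\<exists>k n. \<forall>f V k'. k \<le> k' \<longrightarrow> good f \<longrightarrow> tame (f ^^ n) V k' A"
  using assms
proof (induction rule: bounded.induct)
  case (5 A B)
  then obtain j m k n where h: "\<forall>f V k'. j \<le> k' \<longrightarrow> good f \<longrightarrow> tame (f ^^ m) V k' A"
    "\<forall>f V k'. k \<le> k' \<longrightarrow> good f \<longrightarrow> tame (f ^^ n) V k' B" by blast
  have "tame (f ^^ (max m n)) V k' A \<and> tame (f ^^ (max m n)) V k' B" if "max j k \<le> k'" "good f" for f V k'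
  proof
    show "tame (f ^^ max m n) V k' A"
      by (rule tame_mono[of "f ^^ m"]) (use h(1) that in \<open>auto intro: funpow_infl_mono good_infl\<close>)
    show "tame (f ^^ max m n) V k' B"
      by (rule tame_mono[of "f ^^ n"]) (use h(2) that in \<open>auto intro: funpow_infl_mono good_infl\<close>)
  qed
  then show ?case by (intro exI[of _ "max j k"] exI[of _ "max m n"]) simp
next
  case (6 A t)
  then obtain k n where h: "\<forall>f V k'. k \<le> k' \<longrightarrow> good f \<longrightarrow> tame (f ^^ n) V k' A" by blast
  obtain j where j: "fvt_below j t" using fvt_below_ex by blast
  obtain m where m: "\<forall>f v y. good f \<longrightarrow> (\<forall>i<j. v i \<le> y) \<longrightarrow> evt v t \<le> (f ^^ m) y" using evt_bounded[OF j] by blast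
  have "tame (f ^^ (max m n)) V k' (AllN (Imp (Lt (Var 0) (lift_trm t)) A))" if k': "max j k \<le> k'" "good f" for f V k'
  proof -
    have "tame (f ^^ (max m n)) V (Suc k') A"
      by (rule tame_mono[of "f ^^ n"]) (use h that in \<open>auto intro: funpow_infl_mono good_infl\<close>)
    moreover have "x \<le> (f ^^ max m n) y" if "\<forall>j<k'. v j \<le> y" "x < evt v t" for v x y
    proof -
      have "evt v t \<le> (f ^^ m) y" using m k' that(1) by auto
      also have "\<dots> \<le> (f ^^ max m n) y" using k'(2) by (auto intro: funpow_infl_mono good_infl)
      finally show ?thesis using that(2) by simp
    qed
    ultimately show ?thesis by (auto simp: evt_lift_trm)
  qed
  then show ?case by (intro exI[of _ "max j k"] exI[of _ "max m n"]) simp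
qed auto

lemma forces_iff_sat_bounded:
  assumes "ok p" "\<forall>k. dom p (v k)" "bounded A"
  shows "forces A p v V \<longleftrightarrow> (\<forall>\<^sub>F i in flt p. sat (\<lambda>k. v k i) (\<lambda>X. V X i) A)"
proof -
  obtain k n where h: "\<forall>f V k'. k \<le> k' \<longrightarrow> good f \<longrightarrow> tame (f ^^ n) V k' A" using bounded_tame[OF assms(3)] by blast
  have "\<forall>\<^sub>F i in flt p. tame (fn p i ^^ n) (\<lambda>X. V X i) k A"
    using ok_good[OF assms(1)] by eventually_elim (simp add: h)
  then show ?thesis by (rule forces_iff_sat[OF assms(1,2), where P="\<lambda>i. fn p i ^^ n" and n=n]) simp
qed

subsection \<open>The axioms\<close>

definition valid :: "fm \<Rightarrow> bool" where
  "valid A \<longleftrightarrow> (\<forall>p v V. ok p \<longrightarrow> (\<forall>k. dom p (v k)) \<longrightarrow> forces A p v V)"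

lemma dom_case_nat: "dom p x \<Longrightarrow> \<forall>k. dom p (v k) \<Longrightarrow> \<forall>k. dom p (case_nat x v k)"
  by (simp split: nat.split)

lemma valid_AllN: "valid A \<Longrightarrow> valid (AllN A)"
  unfolding valid_def forces.simps using dom_case_nat dom_ext ext_ok by meson

lemma valid_AllS: "valid A \<Longrightarrow> valid (AllS A)"
  unfolding valid_def forces.simps by blast

lemma valid_closures: assumes "valid A" "B \<in> closures A" shows "valid B"
proof -
  have "valid ((AllS ^^ l) A)" for l by (induction l) (use assms(1) valid_AllS in auto)
  then have "valid ((AllN ^^ k) ((AllS ^^ l) A))" for k l by (induction k) (use valid_AllN in auto)
  then show ?thesis using assms(2) unfolding closures_def by blast
qed

lemma valid_basic: assumes "B \<in> basic_axioms" shows "valid B"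
proof -
  obtain A where A: "B = AllN (AllN A)" and *: "A \<in> {Neg (Eq (Add (Var 1) One) Zero),
     Imp (Eq (Add (Var 0) One) (Add (Var 1) One)) (Eq (Var 0) (Var 1)),
     Eq (Add (Var 0) Zero) (Var 0),
     Eq (Add (Var 0) (Add (Var 1) One)) (Add (Add (Var 0) (Var 1)) One),
     Eq (Mul (Var 0) Zero) Zero,
     Eq (Mul (Var 0) (Add (Var 1) One)) (Add (Mul (Var 0) (Var 1)) (Var 0)),
     Neg (Lt (Var 0) Zero),
     Iff (Lt (Var 0) (Add (Var 1) One)) (Or (Lt (Var 0) (Var 1)) (Eq (Var 0) (Var 1)))}"
    using assms unfolding basic_axioms_def Let_def by blast
  have "bounded A" using * by (auto simp: conn intro!: bounded.intros)
  moreover have "sat v V A" for v V using * by auto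
  moreover note A
  ultimately have A: "B = AllN (AllN A)" "bounded A" "\<And>v V. sat v V A" by blast+
  have "valid A" unfolding valid_def using forces_iff_sat_bounded A by simp
  then show ?thesis unfolding A by (intro valid_AllN)
qed

text \<open>The condition on \<open>A\<close> says that it is equivalent to \<open>\<exists>x. \<forall>y. \<Theta> x y\<close>.\<close>

lemma forces_ind_ax:
  assumes ok: "ok p" and v: "\<forall>k. dom p (v k)"
    and pos: "\<And>r n. r \<preceq> p \<Longrightarrow> dom r n \<Longrightarrow> \<forall>\<^sub>F i in flt r. \<exists>x\<le>lo r i. \<forall>y<hi r i. \<Theta> i (n i) x y \<Longrightarrow> forces A r (case_nat n v) V"
    and neg: "\<And>r n. r \<preceq> p \<Longrightarrow> dom r n \<Longrightarrow> (\<And>s x. s \<preceq> r \<Longrightarrow> dom s x \<Longrightarrow> \<exists>y. dom s y \<and> (\<forall>\<^sub>F i in flt s. \<not> \<Theta> i (n i) (x i) (y i)))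
         \<Longrightarrow> \<not> forces A r (case_nat n v) V"
  shows "forces (ind_ax A) p v V"
  unfolding ind_ax_def forces.simps(5,6)
proof (intro allI HOL.impI)
  fix p0 q N
  assume p0: "p0 \<preceq> p" "forces (And (instN A Zero) (AllN (Imp A (sub (case_nat (Add (Var 0) One) (\<lambda>n. Var (Suc n))) (\<lambda>n. n) A)))) p0 v V"
    and q: "q \<preceq> p0" "dom q N"
  have zero: "forces A p0 (case_nat (\<lambda>i. 0) v) V"
    using p0(2) unfolding forces_And[OF ext_ok[OF p0(1)]] by (simp add: forces_instN)
  have step: "forces A r (case_nat (\<lambda>i. n i + 1) v) V" if "r \<preceq> p0" "dom r n" "forces A r (case_nat n v) V" for r n
  proof -
    have "forces (Imp A (sub (case_nat (Add (Var 0) One) (\<lambda>n. Var (Suc n))) (\<lambda>n. n) A)) r (case_nat n v) V"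
      using p0(2) that unfolding forces_And[OF ext_ok[OF p0(1)]] by simp
    then have "forces (sub (case_nat (Add (Var 0) One) (\<lambda>n. Var (Suc n))) (\<lambda>n. n) A) r (case_nat n v) V"
      using forces_Imp_mp that ext_ok by blast
    moreover have "(\<lambda>m i. evt (\<lambda>k. case_nat n v k i) (case_nat (Add (Var 0) One) (\<lambda>n. Var (Suc n)) m)) = case_nat (\<lambda>i. n i + 1) v"
      by (intro ext) (simp split: nat.split)
    ultimately show ?thesis by (simp add: forces_sub)
  qed
  show "forces A q (case_nat N v) V"
  proof (rule forces_raa[OF ext_ok[OF q(1)]])
    fix r0 assume r0: "r0 \<preceq> q" "forces (Neg A) r0 (case_nat N v) V"
    \<comment> \<open>The dichotomy handles at most as many statements as its lower end allows, so
      \<open>N\<close> is first moved below \<open>lo\<close>.\<close>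
    obtain r where r: "r \<preceq> r0" "\<forall>\<^sub>F i in flt r. N i \<le> lo r i"
      using dom_below_lo[OF ext_ok[OF r0(1)] dom_ext[OF q(2) r0(1)]] by blast
    note okr = ext_ok[OF r(1)]
    \<comment> \<open>The dichotomy is applied downwards from \<open>N\<close>: statement
      \<open>j\<close> says that \<open>A\<close> fails at \<open>N - j\<close>. Thus
      \<open>k\<close> is the distance from \<open>N\<close> to the nearest number below at which
      \<open>A\<close> holds, and the induction step breaks between \<open>N - k\<close> and
      \<open>N - (k - 1)\<close>. One level is spent.\<close>
    define G where "G i t \<longleftrightarrow> (case t of (a', b', f', k) \<Rightarrow> lo r i \<le> a' \<and> b' \<le> hi r i \<and> infl f' \<and> (\<forall>x. fn r i x \<le> f' x) \<and>
        Phi (lv r i - 1) f' a' < b' \<and> k \<le> N i + 1 \<and>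
        (\<forall>j x. j < k \<longrightarrow> f' (max (lo r i) x) < b' \<longrightarrow> (\<exists>y\<le>f' (max (lo r i) x). \<not> \<Theta> i (N i - j) x y)) \<and>
        (k \<le> N i \<longrightarrow> (\<exists>x\<le>a'. \<forall>y<b'. \<Theta> i (N i - k) x y)))" for i t
    have "\<forall>\<^sub>F i in flt r. 1 \<le> lv r i" using okr filterlim_at_top unfolding ok_def by blast
    then have "\<forall>\<^sub>F i in flt r. \<exists>t. G i t" using ok_ev[OF okr] r(2)
    proof eventually_elim
      case (elim i)
      then have *: "infl (fn r i)" "Phi (Suc (lv r i - 1)) (fn r i) (lo r i) < hi r i" "N i \<le> lo r i"
        using good_infl by simp_all
      show ?case
        by (rule dichotomy[OF *, of "\<lambda>j x y. \<not> \<Theta> i (N i - j) x y"])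
          (rule exI[where x="(_, _, _, _)"], unfold G_def prod.case, intro conjI allI HOL.impI, (assumption | blast)+)
    qed
    then have G: "\<forall>\<^sub>F i in flt r. G i (SOME t. G i t)" by eventually_elim (rule someI_ex)
    define a' where "a' i = fst (SOME t. G i t)" for i
    define b' where "b' i = fst (snd (SOME t. G i t))" for i
    define f' where "f' i = fst (snd (snd (SOME t. G i t)))" for i
    define k where "k i = snd (snd (snd (SOME t. G i t)))" for i
    have G: "\<forall>\<^sub>F i in flt r. G i (a' i, b' i, f' i, k i)" using G by (simp add: a'_def b'_def f'_def k_def)
    define s where "s = Cond (flt r) a' f' b' (\<lambda>i. lv r i - 1)"
    have s_sel[simp]: "flt s = flt r" "lo s = a'" "fn s = f'" "hi s = b'" "lv s = (\<lambda>i. lv r i - 1)" by (simp_all add: s_def)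
    have "\<forall>\<^sub>F i in flt r. good (f' i)" using G ok_good[OF okr]
      by eventually_elim (auto simp: G_def good_def intro: order_trans)
    then have "\<forall>\<^sub>F i in flt r. good (f' i) \<and> Phi (lv r i - 1) (f' i) (a' i) < b' i" using G
      by eventually_elim (simp add: G_def)
    moreover have "filterlim (\<lambda>i. lv r i - 1) at_top (flt r)"
    proof (rule filterlim_at_top[THEN iffD2, rule_format])
      fix Z
      have "\<forall>\<^sub>F i in flt r. Z + 1 \<le> lv r i" using okr filterlim_at_top unfolding ok_def by blast
      then show "\<forall>\<^sub>F i in flt r. Z \<le> lv r i - 1" by eventually_elim simp
    qed
    ultimately have oks: "ok s" using okr by (simp add: ok_def)
    have "s \<preceq> r" unfolding ext_def using oks G by (auto simp: G_def elim: eventually_mono)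
    then have sp0: "s \<preceq> p0" "s \<preceq> r0" using r(1) r0(1) q(1) ext_trans by blast+
    have dN: "dom t N" if "t \<preceq> s" for t using that sp0(2) r0(1) q(2) dom_ext by blast
    have no: "\<not> forces A t (case_nat N v) V" if "t \<preceq> s" for t
      using r0(2) ext_trans[OF that sp0(2)] unfolding forces_Neg by blast
    \<comment> \<open>For statements before \<open>k\<close>, the function \<open>f'\<close> at the
      maximum of \<open>lo r\<close> and \<open>x\<close> bounds the witness. This value is in the
      segment because every extension of \<open>s\<close> is closed under \<open>f'\<close>.\<close>
    have neg': "\<not> forces A t (case_nat (\<lambda>i. N i - j i) v) V" if t: "t \<preceq> s" and j: "\<forall>\<^sub>F i in flt t. j i < k i" for t j
    proof (rule neg)
      show "t \<preceq> p" using t sp0 p0 ext_trans by blast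
      show "dom t (\<lambda>i. N i - j i)" by (rule dom_mono[OF dN[OF t]]) simp
      fix u x assume u: "u \<preceq> t" "dom u x"
      have us: "u \<preceq> s" using u t ext_trans by blast
      note oku = ext_ok[OF us]
      have ur: "u \<preceq> r" using ext_trans[OF us \<open>s \<preceq> r\<close>] .
      define z where "z i = f' i (max (lo r i) (x i))" for i
      have "dom u (lo r)" unfolding dom_def using ur by (intro exI[of _ 0]) (auto simp: ext_def elim: eventually_mono)
      from dom_funpow[OF oku dom_max[OF oku this u(2)], of 1]
      have "dom u (\<lambda>i. fn u i (max (lo r i) (x i)))" by simp
      moreover have "\<forall>\<^sub>F i in flt u. z i \<le> fn u i (max (lo r i) (x i))"
        using us unfolding ext_def z_def by (auto elim: eventually_mono)
      ultimately have dz: "dom u z" by (rule dom_mono)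
      have "\<forall>\<^sub>F i in flt u. z i < b' i"
      proof -
        have "\<forall>\<^sub>F i in flt u. hi u i \<le> b' i" using us unfolding ext_def by (auto elim: eventually_mono)
        then show ?thesis using dom_less_hi[OF oku dz] by eventually_elim simp
      qed
      then have "\<forall>\<^sub>F i in flt u. \<exists>y\<le>z i. \<not> \<Theta> i (N i - j i) (x i) y"
        using ext_eventually[OF ur G] ext_eventually[OF u(1) j]
        by eventually_elim (auto simp: G_def z_def)
      then have y: "\<forall>\<^sub>F i in flt u. (SOME y. y \<le> z i \<and> \<not> \<Theta> i (N i - j i) (x i) y) \<le> z i \<and>
          \<not> \<Theta> i (N i - j i) (x i) (SOME y. y \<le> z i \<and> \<not> \<Theta> i (N i - j i) (x i) y)"
        by eventually_elim (rule someI_ex)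
      then have "dom u (\<lambda>i. SOME y. y \<le> z i \<and> \<not> \<Theta> i (N i - j i) (x i) y)"
        by (intro dom_mono[OF dz]) (auto elim: eventually_mono)
      then show "\<exists>y. dom u y \<and> (\<forall>\<^sub>F i in flt u. \<not> \<Theta> i (N i - j i) (x i) (y i))"
        using y by (intro exI[of _ "\<lambda>i. SOME y. y \<le> z i \<and> \<not> \<Theta> i (N i - j i) (x i) y"]) (auto elim: eventually_mono)
    qed
    have pos': "forces A t (case_nat (\<lambda>i. N i - k i) v) V" if t: "t \<preceq> s" "\<forall>\<^sub>F i in flt t. k i \<le> N i" "lo t = a'" "hi t = b'" for t
    proof (rule pos)
      show "t \<preceq> p" using t sp0 p0 ext_trans by blast
      show "dom t (\<lambda>i. N i - k i)" by (rule dom_mono[OF dN[OF t(1)]]) simp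
      show "\<forall>\<^sub>F i in flt t. \<exists>x\<le>lo t i. \<forall>y<hi t i. \<Theta> i (N i - k i) x y" unfolding t
        using t(2) ext_eventually[OF t(1), simplified, OF G] by eventually_elim (auto simp: G_def)
    qed
    \<comment> \<open>Otherwise the filter can be restricted to the indices with
      \<open>k = 0\<close>, where \<open>A\<close> is forced at \<open>N\<close> itself, contrary to
      the choice of \<open>r0\<close>.\<close>
    have "\<forall>\<^sub>F i in flt s. k i \<noteq> 0"
    proof (rule ccontr)
      assume "\<not> ?thesis"
      then have "frequently (\<lambda>i. k i = 0) (flt s)" by (simp add: frequently_def)
      note t = restr_ext[OF oks this]
      have "forces A (restr s (\<lambda>i. k i = 0)) (case_nat (\<lambda>i. N i - k i) v) V"
        by (rule pos'[OF t(1) eventually_mono[OF t(2)]]) simp_all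
      moreover have "\<forall>\<^sub>F i in flt (restr s (\<lambda>i. k i = 0)). case_nat (\<lambda>i. N i - k i) v j i = case_nat N v j i" for j
        using t(2) by eventually_elim (simp split: nat.split)
      ultimately have "forces A (restr s (\<lambda>i. k i = 0)) (case_nat N v) V" using forces_cong by blast
      then show False using no t(1) by blast
    qed
    \<comment> \<open>If \<open>k\<close> exceeded \<open>N\<close>, the statement with index
      \<open>N\<close> would hold and refute \<open>A\<close> at \<open>0\<close>.\<close>
    moreover have "\<forall>\<^sub>F i in flt s. k i \<le> N i"
    proof (rule ccontr)
      assume "\<not> ?thesis"
      then have f: "frequently (\<lambda>i. \<not> k i \<le> N i) (flt s)" by (simp add: frequently_def)
      note t = restr_ext[OF oks f]
      have "\<not> forces A (restr s (\<lambda>i. \<not> k i \<le> N i)) (case_nat (\<lambda>i. N i - N i) v) V"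
        by (rule neg'[OF t(1) eventually_mono[OF t(2)]]) simp
      moreover have "forces A (restr s (\<lambda>i. \<not> k i \<le> N i)) (case_nat (\<lambda>i. 0) v) V"
        using zero forces_ext ext_trans t(1) sp0(1) by blast
      ultimately show False by simp
    qed
    ultimately have ev: "\<forall>\<^sub>F i in flt s. k i \<noteq> 0 \<and> k i \<le> N i" by eventually_elim simp
    have "forces A s (case_nat (\<lambda>i. N i - k i) v) V"
      by (rule pos'[OF ext_refl[OF oks] eventually_mono[OF ev]]) simp_all
    then have "forces A s (case_nat (\<lambda>i. N i - k i + 1) v) V"
      by (rule step[OF sp0(1) dom_mono[OF dN[OF ext_refl[OF oks]]], rotated]) simp
    moreover have "\<forall>\<^sub>F i in flt s. case_nat (\<lambda>i. N i - k i + 1) v j i = case_nat (\<lambda>i. N i - (k i - 1)) v j i" for j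
      using ev by eventually_elim (auto split: nat.split)
    ultimately have "forces A s (case_nat (\<lambda>i. N i - (k i - 1)) v) V" using forces_cong by blast
    moreover have "\<not> forces A s (case_nat (\<lambda>i. N i - (k i - 1)) v) V"
      by (rule neg'[OF ext_refl[OF oks] eventually_mono[OF ev]]) simp
    ultimately show False by blast
  qed
qed

text \<open>Treated as the case of two quantifiers with a dummy inner one: \<open>\<Theta>\<close>
  ignores its last argument.\<close>

lemma valid_ind_Sigma1: assumes "Sigma0 1 A" shows "valid (ind_ax A)"
proof -
  obtain B where A: "A = ExN B" "bounded B" using assms unfolding One_nat_def by auto
  show ?thesis unfolding valid_def
  proof (intro allI HOL.impI)
    fix p and v :: "nat \<Rightarrow> nat \<Rightarrow> nat" and V assume p: "ok p" "\<forall>k. dom p (v k)"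
    define \<Theta> where "\<Theta> i n x (y::nat) \<longleftrightarrow> sat (case_nat x (case_nat n (\<lambda>k. v k i))) (\<lambda>X. V X i) B" for i n x y
    have B: "forces B r (case_nat x (case_nat n v)) V \<longleftrightarrow> (\<forall>\<^sub>F i in flt r. \<Theta> i (n i) (x i) 0)" if "r \<preceq> p" "dom r n" "dom r x" for r n x
      using forces_iff_sat_bounded[OF ext_ok[OF that(1)] dom_case_nat[OF that(3) dom_case_nat[OF that(2)]] A(2)] p(2) dom_ext[OF _ that(1)]
      by (simp add: case_nat_eta \<Theta>_def)
    show "forces (ind_ax A) p v V"
    proof (rule forces_ind_ax[OF p, where \<Theta>=\<Theta>])
      fix r n assume r: "r \<preceq> p" "dom r n" "\<forall>\<^sub>F i in flt r. \<exists>x\<le>lo r i. \<forall>y<hi r i. \<Theta> i (n i) x y"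
      define x where "x i = (SOME x. x \<le> lo r i \<and> \<Theta> i (n i) x 0)" for i
      have x: "\<forall>\<^sub>F i in flt r. x i \<le> lo r i \<and> \<Theta> i (n i) (x i) 0"
        using r(3) dom_less_hi[OF ext_ok[OF r(1)] dom_const]
      proof eventually_elim
        case (elim i)
        then have "\<exists>x. x \<le> lo r i \<and> \<Theta> i (n i) x 0" by blast
        then show ?case unfolding x_def by (rule someI_ex)
      qed
      have dx: "dom r x" unfolding dom_def by (intro exI[of _ 0]) (use x in \<open>auto elim: eventually_mono\<close>)
      show "forces A r (case_nat n v) V" unfolding A
        by (rule forces_ExN_I[OF dx]) (use B[OF r(1,2) dx] x in \<open>auto elim: eventually_mono\<close>)
    next
      fix r n assume r: "r \<preceq> p" "dom r n"
        and h: "\<And>s x. s \<preceq> r \<Longrightarrow> dom s x \<Longrightarrow> \<exists>y. dom s y \<and> (\<forall>\<^sub>F i in flt s. \<not> \<Theta> i (n i) (x i) (y i))"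
      show "\<not> forces A r (case_nat n v) V"
      proof
        assume "forces A r (case_nat n v) V"
        then obtain s x where s: "s \<preceq> r" "dom s x" "forces B s (case_nat x (case_nat n v)) V"
          unfolding A forces_ExN using ext_refl ext_ok r(1) by blast
        have "\<forall>\<^sub>F i in flt s. \<Theta> i (n i) (x i) 0" using B[OF ext_trans[OF s(1) r(1)] dom_ext[OF r(2) s(1)] s(2)] s(3) by simp
        moreover obtain y where "\<forall>\<^sub>F i in flt s. \<not> \<Theta> i (n i) (x i) (y i)" using h s by blast
        ultimately have "\<forall>\<^sub>F i in flt s. False" by eventually_elim (simp add: \<Theta>_def)
        then show False using not_eventually_False ext_ok s by blast
      qed
    qed
  qed
qed

lemma valid_ind_Sigma2: assumes "Sigma0 2 A" shows "valid (ind_ax A)"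
proof -
  obtain B where A: "A = ExN (AllN B)" "bounded B" using assms by (auto simp: numeral_2_eq_2)
  show ?thesis unfolding valid_def
  proof (intro allI HOL.impI)
    fix p and v :: "nat \<Rightarrow> nat \<Rightarrow> nat" and V assume p: "ok p" "\<forall>k. dom p (v k)"
    define \<Theta> where "\<Theta> i n x y \<longleftrightarrow> sat (case_nat y (case_nat x (case_nat n (\<lambda>k. v k i)))) (\<lambda>X. V X i) B" for i n x y
    have B: "forces B r (case_nat y (case_nat x (case_nat n v))) V \<longleftrightarrow> (\<forall>\<^sub>F i in flt r. \<Theta> i (n i) (x i) (y i))"
      if "r \<preceq> p" "dom r n" "dom r x" "dom r y" for r n x y
      using forces_iff_sat_bounded[OF ext_ok[OF that(1)] dom_case_nat[OF that(4) dom_case_nat[OF that(3) dom_case_nat[OF that(2)]]] A(2)]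
        p(2) dom_ext[OF _ that(1)]
      by (simp add: case_nat_eta \<Theta>_def)
    show "forces (ind_ax A) p v V"
    proof (rule forces_ind_ax[OF p, where \<Theta>=\<Theta>])
      fix r n assume r: "r \<preceq> p" "dom r n" "\<forall>\<^sub>F i in flt r. \<exists>x\<le>lo r i. \<forall>y<hi r i. \<Theta> i (n i) x y"
      define x where "x i = (SOME x. x \<le> lo r i \<and> (\<forall>y<hi r i. \<Theta> i (n i) x y))" for i
      have x: "\<forall>\<^sub>F i in flt r. x i \<le> lo r i \<and> (\<forall>y<hi r i. \<Theta> i (n i) (x i) y)"
        using r(3) by eventually_elim (unfold x_def, rule someI_ex)
      have dx: "dom r x" unfolding dom_def by (intro exI[of _ 0]) (use x in \<open>auto elim: eventually_mono\<close>)
      have "forces (AllN B) r (case_nat x (case_nat n v)) V" unfolding forces.simps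
      proof (intro allI HOL.impI)
        fix q y assume q: "q \<preceq> r" "dom q y"
        have "\<forall>\<^sub>F i in flt q. hi q i \<le> hi r i" using q unfolding ext_def by (auto elim: eventually_mono)
        then have "\<forall>\<^sub>F i in flt q. \<Theta> i (n i) (x i) (y i)"
          using dom_less_hi[OF ext_ok[OF q(1)] q(2)] ext_eventually[OF q(1) x] by eventually_elim simp
        then show "forces B q (case_nat y (case_nat x (case_nat n v))) V"
          using B[OF ext_trans[OF q(1) r(1)] dom_ext[OF r(2) q(1)] dom_ext[OF dx q(1)] q(2)] by simp
      qed
      then show "forces A r (case_nat n v) V" unfolding A by (rule forces_ExN_I[OF dx])
    next
      fix r n assume r: "r \<preceq> p" "dom r n"
        and h: "\<And>s x. s \<preceq> r \<Longrightarrow> dom s x \<Longrightarrow> \<exists>y. dom s y \<and> (\<forall>\<^sub>F i in flt s. \<not> \<Theta> i (n i) (x i) (y i))"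
      show "\<not> forces A r (case_nat n v) V"
      proof
        assume "forces A r (case_nat n v) V"
        then obtain s x where s: "s \<preceq> r" "dom s x" "forces (AllN B) s (case_nat x (case_nat n v)) V"
          unfolding A forces_ExN using ext_refl ext_ok r(1) by blast
        obtain y where y: "dom s y" "\<forall>\<^sub>F i in flt s. \<not> \<Theta> i (n i) (x i) (y i)" using h s by blast
        then have "forces B s (case_nat y (case_nat x (case_nat n v))) V" using s ext_refl[OF ext_ok] by simp
        then have "\<forall>\<^sub>F i in flt s. \<Theta> i (n i) (x i) (y i)"
          using B[OF ext_trans[OF s(1) r(1)] dom_ext[OF r(2) s(1)] s(2) y(1)] by simp
        then have "\<forall>\<^sub>F i in flt s. False" using y(2) by eventually_elim simp
        then show False using not_eventually_False ext_ok s by blast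
      qed
    qed
  qed
qed

lemma valid_comp: assumes "Sigma0 1 A" "Pi0 1 B" shows "valid (comp_ax A B)"
proof -
  obtain A' B' where A: "A = ExN A'" "bounded A'" and B: "B = AllN B'" "bounded B'"
    using assms unfolding One_nat_def by auto
  show ?thesis unfolding valid_def comp_ax_def forces.simps(5)
  proof (intro allI HOL.impI)
    fix p0 p and v :: "nat \<Rightarrow> nat \<Rightarrow> nat" and V assume p0: "ok p0" "\<forall>k. dom p0 (v k)" and p: "p \<preceq> p0" "forces (AllN (Iff A B)) p v V"
    define SA where "SA i n y \<longleftrightarrow> sat (case_nat y (case_nat n (\<lambda>k. v k i))) (\<lambda>X. V X i) A'" for i n y
    define SB where "SB i n y \<longleftrightarrow> sat (case_nat y (case_nat n (\<lambda>k. v k i))) (\<lambda>X. V X i) B'" for i n y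
    have fA: "forces A' r (case_nat y (case_nat n v)) V \<longleftrightarrow> (\<forall>\<^sub>F i in flt r. SA i (n i) (y i))"
      and fB: "forces B' r (case_nat y (case_nat n v)) V \<longleftrightarrow> (\<forall>\<^sub>F i in flt r. SB i (n i) (y i))"
      if "r \<preceq> p" "dom r n" "dom r y" for r n y
    proof -
      have d: "\<forall>k. dom r (case_nat y (case_nat n v) k)"
        using dom_case_nat[OF that(3) dom_case_nat[OF that(2)]] p0(2) dom_ext p(1) that(1) by blast
      show "forces A' r (case_nat y (case_nat n v)) V \<longleftrightarrow> (\<forall>\<^sub>F i in flt r. SA i (n i) (y i))"
        "forces B' r (case_nat y (case_nat n v)) V \<longleftrightarrow> (\<forall>\<^sub>F i in flt r. SB i (n i) (y i))"
        using forces_iff_sat_bounded[OF ext_ok[OF that(1)] d A(2)] forces_iff_sat_bounded[OF ext_ok[OF that(1)] d B(2)]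
        by (simp_all add: case_nat_eta SA_def SB_def)
    qed
    have AB: "forces A r (case_nat n v) V \<longleftrightarrow> forces B r (case_nat n v) V" if "r \<preceq> p" "dom r n" for r n
      using p(2) that forces_Iff_D[OF ext_ok[OF that(1)]] by simp
    \<comment> \<open>In the segment, either a witness for \<open>A'\<close> or a counterexample to
      \<open>B'\<close> is to be found, but not both. Which one comes first makes sense at every
      index and so defines a sequence of sets, although the two formulas need not agree outside the
      segment.\<close>
    define X where "X i = {n. \<exists>y. SA i n y \<and> (\<forall>y'<y. SB i n y')}" for i
    have key: "forces A r (case_nat n v) V \<longleftrightarrow> (\<forall>\<^sub>F i in flt r. n i \<in> X i)" if r: "r \<preceq> p" "dom r n" for r n
    proof
      assume h: "forces A r (case_nat n v) V"
      show "\<forall>\<^sub>F i in flt r. n i \<in> X i"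
      proof (rule eventually_by_ext[OF ext_ok[OF r(1)]])
        fix q assume q: "q \<preceq> r" "\<forall>\<^sub>F i in flt q. n i \<notin> X i"
        obtain s y where s: "s \<preceq> q" "dom s y" "forces A' s (case_nat y (case_nat n v)) V"
          using h q(1) unfolding A forces_ExN by blast
        have sr: "s \<preceq> r" using s q ext_trans by blast
        have sp: "s \<preceq> p" "dom s n" using sr ext_trans r(1) dom_ext[OF r(2)] by blast+
        have ya: "\<forall>\<^sub>F i in flt s. SA i (n i) (y i)" using fA[OF sp s(2)] s(3) by simp
        define y' where "y' i = (SOME y'. y' < y i \<and> \<not> SB i (n i) y')" for i
        have y': "\<forall>\<^sub>F i in flt s. y' i < y i \<and> \<not> SB i (n i) (y' i)" using ya ext_eventually[OF s(1) q(2)]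
        proof eventually_elim
          case (elim i)
          then have "\<exists>y'. y' < y i \<and> \<not> SB i (n i) y'" unfolding X_def by blast
          then show ?case unfolding y'_def by (rule someI_ex)
        qed
        then have dy': "dom s y'" by (intro dom_mono[OF s(2)]) (auto elim: eventually_mono)
        have "forces B s (case_nat n v) V" using AB[OF sp] forces_ext[OF h sr] by simp
        then have "forces B' s (case_nat y' (case_nat n v)) V" unfolding B using dy' ext_refl[OF ext_ok[OF s(1)]] by simp
        then have "\<forall>\<^sub>F i in flt s. SB i (n i) (y' i)" using fB[OF sp dy'] by simp
        then have "\<forall>\<^sub>F i in flt s. False" using y' by eventually_elim simp
        then show False using not_eventually_False ext_ok s by blast
      qed
    next
      assume h: "\<forall>\<^sub>F i in flt r. n i \<in> X i"
      show "forces A r (case_nat n v) V"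
      proof (rule forces_raa[OF ext_ok[OF r(1)]])
        fix q assume q: "q \<preceq> r" "forces (Neg A) q (case_nat n v) V"
        have qp: "q \<preceq> p" "dom q n" using q ext_trans r(1) dom_ext[OF r(2)] by blast+
        have "\<not> forces B q (case_nat n v) V" using q(2) AB[OF qp] ext_refl[OF ext_ok[OF q(1)]] unfolding forces_Neg by blast
        then obtain s y where s: "s \<preceq> q" "dom s y" "\<not> forces B' s (case_nat y (case_nat n v)) V"
          unfolding B by auto
        have sp: "s \<preceq> p" "dom s n" using s ext_trans qp(1) dom_ext[OF qp(2)] by blast+
        have "frequently (\<lambda>i. \<not> SB i (n i) (y i)) (flt s)" using s(3) fB[OF sp s(2)] by (simp add: not_eventually)
        note t = restr_ext[OF ext_ok[OF s(1)] this]
        define t' where "t' = restr s (\<lambda>i. \<not> SB i (n i) (y i))"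
        note t = t[folded t'_def]
        have tp: "t' \<preceq> p" "dom t' n" "dom t' y" using t(1) ext_trans sp(1) dom_ext[OF sp(2)] dom_ext[OF s(2)] by blast+
        define z where "z i = (SOME z. z \<le> y i \<and> SA i (n i) z)" for i
        have "\<forall>\<^sub>F i in flt t'. n i \<in> X i" using ext_eventually h q(1) s(1) t(1) by blast
        then have z: "\<forall>\<^sub>F i in flt t'. z i \<le> y i \<and> SA i (n i) (z i)" using t(2)
        proof eventually_elim
          case (elim i)
          then obtain z0 where z0: "SA i (n i) z0" "\<forall>y'<z0. SB i (n i) y'" unfolding X_def by blast
          then have "z0 \<le> y i" using elim(2) by (meson not_le)
          then have "\<exists>z. z \<le> y i \<and> SA i (n i) z" using z0 by blast
          then show ?case unfolding z_def by (rule someI_ex)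
        qed
        then have dz: "dom t' z" by (intro dom_mono[OF tp(3)]) (auto elim: eventually_mono)
        have "forces A' t' (case_nat z (case_nat n v)) V" using fA[OF tp(1,2) dz] z by (auto elim: eventually_mono)
        then have "forces A t' (case_nat n v) V" unfolding A by (rule forces_ExN_I[OF dz])
        then show False using q(2) s(1) t(1) ext_trans unfolding forces_Neg by blast
      qed
    qed
    have "forces (AllN (Iff (Mem (Var 0) 0) (liftS A))) p v (case_nat X V)"
      unfolding forces.simps(6)
    proof (intro allI HOL.impI)
      fix q n assume q: "q \<preceq> p" "dom q n"
      have *: "forces (Mem (Var 0) 0) r (case_nat n v) (case_nat X V) \<longleftrightarrow> forces (liftS A) r (case_nat n v) (case_nat X V)"
        if "r \<preceq> q" for r using key[OF ext_trans[OF that q(1)] dom_ext[OF q(2) that]] by (simp add: forces_liftS)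
      show "forces (Iff (Mem (Var 0) 0) (liftS A)) q (case_nat n v) (case_nat X V)"
        unfolding Iff_def forces_And[OF ext_ok[OF q(1)]] forces.simps(5) using * by blast
    qed
    moreover have "forces (ExS C) p v V" if "forces C p v (case_nat X V)" for C
      unfolding ExS_def forces_Neg
    proof (intro allI HOL.impI HOL.notI)
      fix q assume q: "q \<preceq> p" "forces (AllS (Neg C)) q v V"
      then have "forces (Neg C) q v (case_nat X V)" by simp
      then show False using forces_ext[OF that q(1)] ext_refl[OF ext_ok[OF q(1)]] unfolding forces_Neg by blast
    qed
    ultimately show "forces (ExS (AllN (Iff (Mem (Var 0) 0) (liftS A)))) p v V" by blast
  qed
qed

theorem valid_axioms: assumes "A \<in> RCA0 \<union> Sigma0_IND 2" shows "valid A"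
  using assms valid_basic valid_closures valid_ind_Sigma1 valid_ind_Sigma2 valid_comp
  unfolding RCA0_def Sigma0_IND_def Delta01_CA_def by blast

section \<open>The upgrade to the Ouroboros successor\<close>

text \<open>The change of base as a function on natural numbers. When \<open>2 \<le> b\<close> and
  the digits are upgraded by a total function \<open>h\<close>, the value \<open>\<infinity>\<close>
  does not arise.\<close>

definition ch :: "(nat \<Rightarrow> nat) \<Rightarrow> nat \<Rightarrow> nat \<Rightarrow> nat \<Rightarrow> nat" where
  "ch h b c m = the_enat (change (\<lambda>k. enat (h k)) b c m)"

lemma decomp_props:
  assumes "2 \<le> (b::nat)" "b \<le> m"
  defines "e \<equiv> GREATEST e. b ^ e \<le> m"
  shows "0 < e" "e < m" "0 < m div b ^ e" "m div b ^ e < b" "m mod b ^ e < b ^ e" "m mod b ^ e < m"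
    "b ^ e \<le> m" "m = b ^ e * (m div b ^ e) + m mod b ^ e"
proof -
  have m: "0 < m" using assms by simp
  note g = greatest_exponent[OF assms(1) m, folded e_def]
  show "0 < e" using g(2) assms(2) by (cases e) auto
  show "e < m" unfolding e_def by (rule greatest_exponent_less[OF assms(1) m])
  show "b ^ e \<le> m" by (rule g)
  show "m div b ^ e < b" using g(2) assms(1) by (simp add: less_mult_imp_div_less)
  have p: "0 < b ^ e" using assms(1) by simp
  then show "0 < m div b ^ e" using g(1) by (simp add: div_greater_zero_iff)
  show "m mod b ^ e < b ^ e" using p by simp
  then show "m mod b ^ e < m" using g(1) by simp
  show "m = b ^ e * (m div b ^ e) + m mod b ^ e" by simp
qed

lemma change_enat_ch:
  assumes "2 \<le> b" shows "change (\<lambda>k. enat (h k)) b c m = enat (ch h b c m)"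
proof -
  have "\<exists>v. change (\<lambda>k. enat (h k)) b c m = enat v"
  proof (induction m rule: less_induct)
    case (less m)
    show ?case
    proof (cases "m < b")
      case True then show ?thesis by (subst change.simps) simp
    next
      case False
      then obtain v w where "change (\<lambda>k. enat (h k)) b c (GREATEST e. b ^ e \<le> m) = enat v"
        "change (\<lambda>k. enat (h k)) b c (m mod b ^ (GREATEST e. b ^ e \<le> m)) = enat w"
        using less.IH decomp_props[OF assms, of m] by (meson leI)
      then show ?thesis using False assms by (subst change.simps) (simp add: Let_def)
    qed
  qed
  then show ?thesis by (auto simp: ch_def)
qed

lemma change_eq_ch:
  assumes "2 \<le> b" "\<And>k. k < b \<Longrightarrow> u k = enat (h k)" shows "change u b c m = enat (ch h b c m)"
  using change_cong[of b u "\<lambda>k. enat (h k)" b c c m m] assms(2) change_enat_ch[OF assms(1)] by simp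

lemma ch_small: "2 \<le> b \<Longrightarrow> m < b \<Longrightarrow> ch h b c m = h m"
  unfolding ch_def by (subst change.simps) simp

lemma ch_decomp:
  assumes "2 \<le> b" "0 < e" "0 < a" "a < b" "r < b ^ e"
  shows "ch h b c (b ^ e * a + r) = c ^ ch h b c e * h a + ch h b c r"
proof -
  let ?m = "b ^ e * a + r"
  have be: "b \<le> b ^ e" using assms by (simp add: self_le_power)
  have le: "b ^ e \<le> b ^ e * a" using assms by simp
  have m: "b \<le> ?m" using be le by linarith
  have "rdecomp (\<lambda>c e v. v = c ^ e) b ?m e a r"
  proof -
    have "?m < b ^ e * (a + 1)" using assms by simp
    also have "\<dots> \<le> b ^ e * b" using assms by (intro mult_left_mono) auto
    finally have "?m < b ^ (e + 1)" by (simp add: mult.commute)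
    moreover have "b ^ e \<le> ?m" using le by (rule trans_le_add1)
    ultimately show ?thesis using assms unfolding rdecomp_def by blast
  qed
  then have d: "(GREATEST e. b ^ e \<le> ?m) = e" "?m div b ^ e = a" "?m mod b ^ e = r"
    unfolding rdecomp_iff by metis+
  then have "change (\<lambda>k. enat (h k)) b c ?m = (case (change (\<lambda>k. enat (h k)) b c e, enat (h a), change (\<lambda>k. enat (h k)) b c r) of
          (enat e', enat a', enat r') \<Rightarrow> enat (c ^ e' * a' + r')
        | _ \<Rightarrow> \<infinity>)"
    using m assms(1) by (subst change.simps) (simp only: Let_def d if_False not_le[symmetric] simp_thms)
  then show ?thesis by (simp add: change_enat_ch[OF assms(1)])
qed

lemma ch_big:
  assumes "2 \<le> b" "b \<le> m"
  obtains e a r where "m = b ^ e * a + r" "0 < e" "e < m" "0 < a" "a < b" "r < b ^ e" "r < m" "b ^ e \<le> m"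
    "ch h b c m = c ^ ch h b c e * h a + ch h b c r"
proof -
  note d = decomp_props[OF assms]
  show thesis
    using that[OF d(8,1,2,3,4,5,6,7)] ch_decomp[OF assms(1) d(1,3,4,5), of h c] d(8) by simp
qed

text \<open>The upgraded digits are below the new base, so the new expansions compare like the old
  ones. To compare different leading exponents, the induction also carries that a value with leading
  exponent \<open>e\<close> is less than \<open>c ^ (?f e + 1)\<close>.\<close>

lemma ch_strict_mono:
  assumes b: "2 \<le> b" and h: "\<And>i j. i < j \<Longrightarrow> j < b \<Longrightarrow> h i < h j" "h 0 = 0" and c: "\<And>k. k < b \<Longrightarrow> h k < c"
  shows "k < m \<Longrightarrow> ch h b c k < ch h b c m"
proof -
  let ?f = "ch h b c"
  have cpos: "2 \<le> c" using c[of 1] h(1)[of 0 1] h(2) b by simp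
  have "(\<forall>k<m. ?f k < ?f m) \<and> (\<forall>e a r. m = b ^ e * a + r \<longrightarrow> 0 < e \<longrightarrow> 0 < a \<longrightarrow> a < b \<longrightarrow> r < b ^ e \<longrightarrow> ?f m < c ^ (?f e + 1))" for m
  proof (induction m rule: less_induct)
    case (less m)
    have lt: "?f r < c ^ ?f e" if e: "0 < e" "e < m" and r: "r < b ^ e" "r < m" for r e
    proof (cases "r < b")
      case True
      have "?f r < c" using True c ch_small[OF b] by simp
      also have "\<dots> \<le> c ^ ?f e"
      proof -
        have "?f 0 < ?f e" using less.IH[OF e(2)] e(1) by blast
        then show ?thesis using cpos by (intro self_le_power) auto
      qed
      finally show ?thesis .
    next
      case False
      then obtain e2 a2 r2 where d: "r = b ^ e2 * a2 + r2" "0 < e2" "0 < a2" "a2 < b" "r2 < b ^ e2" "b ^ e2 \<le> r"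
        using ch_big[OF b, of r h c] by (metis not_le)
      have "b ^ e2 < b ^ e" using d(6) r by simp
      then have "e2 < e" using b by (simp add: power_strict_increasing_iff)
      then have "?f e2 + 1 \<le> ?f e" using less.IH[OF e(2)] by (simp add: Suc_le_eq)
      then have "c ^ (?f e2 + 1) \<le> c ^ ?f e" using cpos by (intro power_increasing) auto
      moreover have "?f r < c ^ (?f e2 + 1)" using less.IH[OF r(2)] d by blast
      ultimately show ?thesis by simp
    qed
    have pos: "0 < h a" if "0 < a" "a < b" for a using h(1)[OF that] h(2) by simp
    show ?case
    proof (intro conjI allI HOL.impI)
      fix e a r assume m: "m = b ^ e * a + r" "0 < e" "0 < a" "a < b" "r < b ^ e"
      have "b ^ e \<le> m" using m(1,3) by (simp add: trans_le_add1)
      moreover have "e < b ^ e" using less_exp[of e] power_mono[of 2 b e] b by linarith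
      ultimately have em: "e < m" "r < m" using m(5) by linarith+
      have "?f m = c ^ ?f e * h a + ?f r" using ch_decomp[OF b m(2-5)] m(1) by simp
      also have "\<dots> < c ^ ?f e * (h a + 1)" using lt[OF m(2) em(1) m(5) em(2)] by simp
      also have "\<dots> \<le> c ^ ?f e * c" using c[OF m(4)] by (intro mult_left_mono) auto
      finally show "?f m < c ^ (?f e + 1)" by (simp add: mult.commute)
    next
      fix k assume k: "k < m"
      show "?f k < ?f m"
      proof (cases "m < b")
        case True then show ?thesis using k h(1) ch_small[OF b] by simp
      next
        case False
        then obtain e a r where m: "m = b ^ e * a + r" "0 < e" "e < m" "0 < a" "a < b" "r < b ^ e" "r < m" "b ^ e \<le> m"
            "?f m = c ^ ?f e * h a + ?f r"
          using ch_big[OF b, of m h c] by (metis not_le)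
        have le: "c ^ ?f e \<le> ?f m" using m(9) pos[OF m(4,5)] by (simp add: trans_le_add1)
        show ?thesis
        proof (cases "k < b ^ e")
          case True
          then show ?thesis using lt[OF m(2,3) True k] le by simp
        next
          case nk: False
          have "b \<le> b ^ e" using m(2) b by (simp add: self_le_power)
          then have "b \<le> k" using nk by simp
          then obtain e1 a1 r1 where d: "k = b ^ e1 * a1 + r1" "0 < e1" "0 < a1" "a1 < b" "r1 < b ^ e1" "e1 < k" "r1 < k" "b ^ e1 \<le> k"
            "?f k = c ^ ?f e1 * h a1 + ?f r1" using ch_big[OF b, of k h c] by metis
          have "e1 = e"
          proof (rule ccontr)
            assume ne: "e1 \<noteq> e"
            have "k < b ^ e1 * (a1 + 1)" using d(1,5) by simp
            also have "\<dots> \<le> b ^ e1 * b" using d(4) by (intro mult_left_mono) auto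
            finally have "b ^ e < b ^ (Suc e1)" using nk by (simp add: mult.commute)
            then have "e < Suc e1" using b by (simp add: power_strict_increasing_iff del: power_Suc)
            then have "e < e1" using ne by simp
            then have "b ^ Suc e \<le> b ^ e1" using b by (intro power_increasing) auto
            moreover have "m < b ^ Suc e"
            proof -
              have "m < b ^ e * (a + 1)" using m(1,6) by simp
              also have "\<dots> \<le> b ^ e * b" using m(5) by (intro mult_left_mono) auto
              finally show ?thesis by (simp add: mult.commute)
            qed
            ultimately show False using d(8) k by simp
          qed
          have "a1 \<le> a"
          proof (rule ccontr)
            assume "\<not> a1 \<le> a"
            then have "b ^ e * (a + 1) \<le> b ^ e * a1" by (intro mult_left_mono) auto
            then show False using k m(1,6) d(1) \<open>e1 = e\<close> by simp
          qed
          show ?thesis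
          proof (cases "a1 = a")
            case True
            then have "r1 < r" using k m(1) d(1) \<open>e1 = e\<close> by simp
            then have "?f r1 < ?f r" using less.IH[OF m(7)] by blast
            then show ?thesis using m(9) d(9) True \<open>e1 = e\<close> by simp
          next
            case False
            then have "h a1 + 1 \<le> h a" using h(1)[of a1 a] \<open>a1 \<le> a\<close> m(5) by simp
            then have "c ^ ?f e * (h a1 + 1) \<le> c ^ ?f e * h a" by (intro mult_left_mono) auto
            moreover have "?f r1 < c ^ ?f e" using lt[of e r1] m(2,3) d(5,7) k \<open>e1 = e\<close> by simp
            ultimately show ?thesis using m(9) d(9) \<open>e1 = e\<close> by simp
          qed
        qed
      qed
    qed
  qed
  then show "k < m \<Longrightarrow> ?f k < ?f m" by blast
qed

lemma ch_mult:
  assumes "2 \<le> b" "0 < a" "a < b" "h 0 = 0" "h 1 = 1" shows "ch h b c (b * a) = c * h a"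
proof -
  have "ch h b c (b ^ 1 * a + 0) = c ^ ch h b c 1 * h a + ch h b c 0"
    by (rule ch_decomp) (use assms in auto)
  then show ?thesis using assms by (simp add: ch_small)
qed

section \<open>The stages of the Ouroboros successor\<close>

locale ouro =
  fixes B :: "nat set" and i :: nat
  assumes B: "B \<noteq> {}" "0 \<notin> B" "1 \<notin> B" and i: "1 \<le> i"
begin

abbreviation "\<mu> \<equiv> Inf B"
abbreviation "base \<equiv> base_of B"
abbreviation "S \<equiv> stage B i"
definition "c n = Max (S n)"
definition "h n = the_enat (upgrade B (S n) n)"
abbreviation "C \<equiv> ouroboros B i"

lemma mu: "\<mu> \<in> B" "2 \<le> \<mu>" "b \<in> B \<Longrightarrow> \<mu> \<le> b"
proof -
  show m: "\<mu> \<in> B" using B(1) by (rule Inf_nat_def1)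
  show "b \<in> B \<Longrightarrow> \<mu> \<le> b" by (simp add: cInf_lower)
  have "\<mu> \<noteq> 0" "\<mu> \<noteq> 1" using m B by metis+
  then show "2 \<le> \<mu>" by linarith
qed

lemma base: assumes "\<mu> \<le> n" shows "base n \<in> B" "base n \<le> n" "\<And>b. b \<in> B \<Longrightarrow> b \<le> n \<Longrightarrow> b \<le> base n" "2 \<le> base n"
proof -
  have e: "base n = Max {b \<in> B. b \<le> n}" using assms by (simp add: base_of_def)
  have "\<mu> \<in> {b \<in> B. b \<le> n}" using mu assms by simp
  then have "base n \<in> {b \<in> B. b \<le> n}" unfolding e by (intro Max_in) auto
  then show "base n \<in> B" "base n \<le> n" by simp_all
  then show "2 \<le> base n" using mu(2) mu(3)[of "base n"] by simp
  show "\<And>b. b \<in> B \<Longrightarrow> b \<le> n \<Longrightarrow> b \<le> base n" unfolding e by (simp add: Max_ge)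
qed

lemma base_eq: assumes "b \<in> B" "b \<le> n" "\<And>x. x \<in> B \<Longrightarrow> b < x \<Longrightarrow> n < x" shows "base n = b"
proof -
  have "\<mu> \<le> n" using assms mu(3) by (meson order_trans)
  then show ?thesis using base[of n] assms by (meson antisym not_le)
qed

lemma base_in: "b \<in> B \<Longrightarrow> base b = b" by (rule base_eq) auto

lemma base_Suc: "\<mu> \<le> n \<Longrightarrow> Suc n \<notin> B \<Longrightarrow> base (Suc n) = base n"
  by (rule base_eq) (use base[of n] in \<open>auto simp: less_Suc_eq\<close>, metis Suc_lessI not_le not_less_eq)

lemma S_fin: "finite (S n)" "S n \<noteq> {}" by (rule stage_fin)+

lemma S_Suc_mono: "S n \<subseteq> S (Suc n)"
proof (cases "Suc n \<le> \<mu>")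
  case True
  then have "S n = {\<mu> + 1}" by (cases n) (auto simp: Let_def)
  then show ?thesis using True by (simp add: Let_def)
qed (auto simp: Let_def)

lemma S_mono: "m \<le> n \<Longrightarrow> S m \<subseteq> S n"
  by (rule lift_Suc_mono_le[of S]) (rule S_Suc_mono)

lemma S_low: "n \<le> \<mu> \<Longrightarrow> S n = {\<mu> + 1}" by (cases n) (auto simp: Let_def)

lemma c_in: "c n \<in> S n" unfolding c_def using S_fin by (rule Max_in)
lemma c_ge: "x \<in> S n \<Longrightarrow> x \<le> c n" unfolding c_def using S_fin by (simp add: Max_ge)
lemma c_mono: "m \<le> n \<Longrightarrow> c m \<le> c n" using S_mono[of m n] c_in[of m] c_ge by blast

lemma upgrade_low: "n < \<mu> \<Longrightarrow> upgrade B X n = enat n" by (subst upgrade.simps) simp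

text \<open>The alternatives in the last premise are the negations of the two inequalities required
  of an admissible base.\<close>

lemma upgrade_eqI:
  assumes m: "\<mu> \<le> m" and u: "\<And>k. k < m \<Longrightarrow> upgrade B X k = enat (g k)" and "d \<in> X"
    and v: "v = ch g (base m) d m" "g (m - 1) < v" and gap: "\<And>x. x \<in> X \<Longrightarrow> d < x \<Longrightarrow> v < x"
    and least: "\<And>x. x \<in> X \<Longrightarrow> x < d \<Longrightarrow> ch g (base m) x m \<le> g (m - 1) \<or> (\<exists>y\<in>X. x < y \<and> y \<le> ch g (base m) x m)"
  shows "upgrade B X m = enat v"
proof -
  have m0: "0 < m" using m mu(2) by simp
  have ch: "change (upgrade B X) (base m) x m = enat (ch g (base m) x m)" for x
    by (rule change_eq_ch[OF base(4)[OF m]]) (use u base(2)[OF m] in simp)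
  define P where "P = (\<lambda>x. x \<in> X \<and> upgrade B X (m - 1) < change (upgrade B X) (base m) x m \<and>
                       change (upgrade B X) (base m) x m < succ_base X x)"
  have P: "P x \<longleftrightarrow> x \<in> X \<and> g (m - 1) < ch g (base m) x m \<and> (\<forall>y. y \<in> X \<and> x < y \<longrightarrow> ch g (base m) x m < y)" for x
    unfolding P_def ch rbelow_iff[symmetric] rbelow_def using u[of "m - 1"] m0 by simp
  have Pd: "P d" unfolding P using assms by blast
  moreover have "d \<le> x" if "P x" for x using that least[of x] unfolding P by (meson not_le)
  ultimately have l: "(LEAST x. P x) = d" by (rule Least_equality)
  have "\<not> (B = {} \<or> m = 0 \<or> m < \<mu>)" using B m m0 by simp
  then have "upgrade B X m = (if \<exists>x. P x then change (upgrade B X) (base m) (LEAST x. P x) m else \<infinity>)"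
    using upgrade.simps[of B X m] unfolding P_def Let_def by (simp only: if_False)
  then show ?thesis using Pd l ch v by auto
qed

text \<open>The stages are built with upgrades into unfinished hierarchies. The invariant says that
  this is harmless: \<open>m\<close> is upgraded with the maximum \<open>c m\<close> of its stage,
  smaller elements of that stage are inadmissible for \<open>m\<close>, and everything added later
  exceeds \<open>h m\<close>. Hence the upgrade of \<open>m\<close> does not change after stage
  \<open>m\<close>.\<close>

definition Inv :: "nat \<Rightarrow> bool" where
  "Inv n \<longleftrightarrow> (\<forall>m\<le>n. upgrade B (S n) m = enat (h m)) \<and> (\<forall>k m. k < m \<longrightarrow> m \<le> n \<longrightarrow> h k < h m) \<and>
    (\<forall>m. \<mu> \<le> m \<longrightarrow> m \<le> n \<longrightarrow> h m = ch h (base m) (c m) m \<and> c m \<le> h m \<and>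
      (\<forall>x\<in>S n. x \<notin> S m \<longrightarrow> h m < x) \<and>
      (\<forall>x\<in>S m. x < c m \<longrightarrow> ch h (base m) x m \<le> h (m - 1) \<or> (\<exists>y\<in>S m. x < y \<and> y \<le> ch h (base m) x m)))"

lemma h_low: "n < \<mu> \<Longrightarrow> h n = n" by (simp add: h_def upgrade_low)

lemma h01: "h 0 = 0" "h 1 = 1" using h_low mu(2) by simp_all

lemma ch_self: "2 \<le> b \<Longrightarrow> ch h b d b = d"
  using ch_mult[of b 1 h d] h01 by simp

lemma Inv_mu: "Inv \<mu>"
proof -
  have S: "S \<mu> = {\<mu> + 1}" by (rule S_low) simp
  have c: "c \<mu> = \<mu> + 1" unfolding c_def S by simp
  have "upgrade B (S \<mu>) \<mu> = enat (\<mu> + 1)"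
  proof (rule upgrade_eqI[where g = h and d = "\<mu> + 1"])
    show "h (\<mu> - 1) < \<mu> + 1" using h_low[of "\<mu> - 1"] mu(2) by simp
    show "\<mu> + 1 = ch h (base \<mu>) (\<mu> + 1) \<mu>" using ch_self[OF mu(2)] by (simp add: base_in mu(1))
  qed (use S upgrade_low h_low in auto)
  then have "h \<mu> = \<mu> + 1" by (simp add: h_def)
  note hm = this
  have le: "m = \<mu> \<or> m < \<mu>" if "m \<le> \<mu>" for m using that by auto
  have "upgrade B (S \<mu>) m = enat (h m)" if "m \<le> \<mu>" for m
    using le[OF that] \<open>upgrade B (S \<mu>) \<mu> = enat (\<mu> + 1)\<close> hm by (auto simp: upgrade_low h_low)
  moreover have "h k < h m" if "k < m" "m \<le> \<mu>" for k m
    using le[OF that(2)] that(1) hm by (auto simp: h_low)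
  moreover have "m = \<mu>" if "\<mu> \<le> m" "m \<le> \<mu>" for m using that by simp
  ultimately show ?thesis unfolding Inv_def
    using hm ch_self[OF mu(2)] base_in[OF mu(1)] S c by simp
qed

lemma InvD:
  assumes "Inv n"
  shows "m \<le> n \<Longrightarrow> upgrade B (S n) m = enat (h m)"
    "k < m \<Longrightarrow> m \<le> n \<Longrightarrow> h k < h m"
    "\<mu> \<le> m \<Longrightarrow> m \<le> n \<Longrightarrow> h m = ch h (base m) (c m) m"
    "\<mu> \<le> m \<Longrightarrow> m \<le> n \<Longrightarrow> c m \<le> h m"
    "\<mu> \<le> m \<Longrightarrow> m \<le> n \<Longrightarrow> x \<in> S n \<Longrightarrow> x \<notin> S m \<Longrightarrow> h m < x"
    "\<mu> \<le> m \<Longrightarrow> m \<le> n \<Longrightarrow> x \<in> S m \<Longrightarrow> x < c m \<Longrightarrow> ch h (base m) x m \<le> h (m - 1) \<or> (\<exists>y\<in>S m. x < y \<and> y \<le> ch h (base m) x m)"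
  using assms unfolding Inv_def by blast+

lemma Inv_base:
  assumes "Inv n" "b \<in> B" "b \<le> n" shows "h b = c b"
  using InvD(3)[OF assms(1) mu(3)[OF assms(2)] assms(3)] base_in[OF assms(2)] ch_self mu(2) mu(3)[OF assms(2)] by simp

lemma Inv_below_c:
  assumes I: "Inv n" and b: "b \<in> B" "b \<le> n" and k: "k < b" shows "h k < c n"
  using InvD(2)[OF I k b(2)] Inv_base[OF I b] c_mono[OF b(2)] by simp

lemma Inv_ch_mono:
  assumes I: "Inv n" and b: "b \<in> B" "b \<le> n" and d: "c n \<le> d" and "k < m" shows "ch h b d k < ch h b d m"
proof (rule ch_strict_mono)
  show "2 \<le> b" using mu(2) mu(3)[OF b(1)] by simp
  show "h k < d" if "k < b" for k using Inv_below_c[OF I b that] d by simp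
  show "h i < h j" if "i < j" "j < b" for i j using InvD(2)[OF I that(1)] that b by simp
qed (use h01 assms in auto)

text \<open>The iterates in the third case of the construction, at a critical \<open>N\<close>; they
  start from the maximum of the preceding stage.\<close>

fun dd :: "nat \<Rightarrow> nat \<Rightarrow> nat" where
  "dd N 0 = c (N - 1)"
| "dd N (Suc j) = ch h (base N) (dd N j) N"

declare dd.simps [simp del]

lemma stage_step:
  assumes I: "Inv n" and n: "\<mu> \<le> n"
  defines "N \<equiv> Suc n"
  shows "N \<in> B \<Longrightarrow> S N = insert (c N) (S n) \<and> h n < c N \<and> c N \<le> h n + c n"
    "N \<notin> B \<Longrightarrow> base N dvd N \<Longrightarrow> S N = S n \<union> dd N ` {1..i} \<and> strict_mono (dd N) \<and> h n < dd N 1 \<and> c N = dd N i"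
    "N \<notin> B \<Longrightarrow> \<not> base N dvd N \<Longrightarrow> S N = S n"
proof -
  have nlt: "\<not> Suc n \<le> \<mu>" using n by simp
  note b = base[OF n]
  show "S N = S n" if "N \<notin> B" "\<not> base N dvd N" using that nlt by (simp add: N_def Let_def)
  have c0: "0 < c n" using Inv_below_c[OF I mu(1) n, of 0] mu(2) by simp
  show "S N = insert (c N) (S n) \<and> h n < c N \<and> c N \<le> h n + c n" if "N \<in> B"
  proof -
    have ch: "change (upgrade B (S n)) (base n) (c n) n = enat (h n)"
      using change_eq_ch[OF b(4), of "upgrade B (S n)" h "c n" n] InvD(1)[OF I] b(2) InvD(3)[OF I n] by simp
    define a where "a = (LEAST a. h n < c n * a)"
    have ex: "h n < c n * (h n + 1)" using c0 using mult_le_mono1[of 1 "c n" "h n + 1"] by simp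
    have a: "h n < c n * a" unfolding a_def using ex by (rule LeastI)
    have a': "\<not> h n < c n * a'" if "a' < a" for a' using that not_less_Least unfolding a_def by blast
    have "{c n * a | a. enat (h n) < enat (c n * a) \<and> (\<forall>a'<a. \<not> enat (h n) < enat (c n * a'))} = {c n * a}"
    proof -
      have "a' = a" if "h n < c n * a'" "\<forall>a''<a'. \<not> h n < c n * a''" for a'
        using that(1) that(2)[rule_format, of a] a a'[of a'] by (meson linorder_neqE_nat)
      moreover have "\<forall>a'<a. \<not> h n < c n * a'" using a' by blast
      ultimately show ?thesis using a unfolding enat_ord_simps by blast
    qed
    then have S: "S N = S n \<union> {c n * a}"
      using that nlt unfolding N_def by (simp add: Let_def c_def[symmetric] ch)
    have "c n \<le> h n" by (rule InvD(4)[OF I n order_refl])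
    have "x \<le> c n * a" if "x \<in> S N" for x using that c_ge[of x n] a \<open>c n \<le> h n\<close> unfolding S by auto
    then have cN: "c N = c n * a" using c_in[of N] c_ge[of "c n * a" N] S by (auto intro: antisym)
    have "0 < a" using a by (cases a) auto
    then have "c n * (a - 1) \<le> h n" using a'[of "a - 1"] by simp
    then have "c n * a \<le> h n + c n" using \<open>0 < a\<close> by (cases a) auto
    then show ?thesis using S cN a by simp
  qed
  show "S N = S n \<union> dd N ` {1..i} \<and> strict_mono (dd N) \<and> h n < dd N 1 \<and> c N = dd N i" if "N \<notin> B" "base N dvd N"
  proof -
    have bN: "base N = base n" unfolding N_def by (rule base_Suc) (use n that N_def in auto)
    have ch: "change (upgrade B (S n)) (base N) d N = enat (ch h (base N) d N)" for d
      by (rule change_eq_ch) (use b(2,4) bN InvD(1)[OF I] in auto)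
    have it: "iter (\<lambda>d. change (upgrade B (S n)) (base N) d N) (c n) j = enat (dd N j)" for j
      by (induction j) (auto simp: ch[unfolded N_def] N_def dd.simps)
    have "{d. \<exists>j. 1 \<le> j \<and> j \<le> i \<and> enat (dd N j) = enat d} = dd N ` {1..i}" by auto
    then have S: "S N = S n \<union> dd N ` {1..i}"
      using that nlt it unfolding N_def by (simp add: Let_def c_def[symmetric])
    have "base n < N" using b(2) by (simp add: N_def)
    \<comment> \<open>Changing the base to \<open>d\<close> sends \<open>base n\<close> to
      \<open>d\<close>, and \<open>N\<close> is larger than \<open>base n\<close>.\<close>
    have ge: "c n \<le> dd N j \<and> dd N j < dd N (Suc j)" for j
    proof (induction j)
      case 0
      then show ?case using Inv_ch_mono[OF I b(1,2), of "c n" "base n" N] ch_self[OF b(4)] \<open>base n < N\<close> bN by (simp add: N_def dd.simps)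
    next
      case (Suc j)
      then show ?case using Inv_ch_mono[OF I b(1,2), of "dd N (Suc j)" "base n" N] ch_self[OF b(4), of "dd N (Suc j)"] \<open>base n < N\<close> bN by (simp add: dd.simps(2)[of N "Suc j"])
    qed
    then have sm: "strict_mono (dd N)" by (simp add: strict_mono_Suc_iff)
    have "h n = ch h (base n) (c n) n" using InvD(3)[OF I n] by simp
    then have "h n < dd N 1" using Inv_ch_mono[OF I b(1,2), of "c n" n N] bN by (simp add: N_def dd.simps One_nat_def)
    moreover have "c N = dd N i" unfolding c_def
    proof (rule Max_eqI)
      show "dd N i \<in> S N" using S i by auto
      fix y assume "y \<in> S N"
      then consider "y \<in> S n" | j where "j \<le> i" "y = dd N j" unfolding S by auto
      then show "y \<le> dd N i"
      proof cases
        case 1 then show ?thesis using c_ge ge[of i] order_trans by blast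
      next
        case 2 then show ?thesis using sm by (simp add: strict_mono_less_eq)
      qed
    qed (rule S_fin)
    ultimately show ?thesis using S sm by simp
  qed
qed

lemma Inv_Suc:
  assumes I: "Inv n" and n: "\<mu> \<le> n" shows "Inv (Suc n)"
proof -
  define N where "N = Suc n"
  note b = base[OF n]
  have N: "\<mu> \<le> N" using n by (simp add: N_def)
  note st = stage_step[OF I n, folded N_def]
  have new: "h n < x" if "x \<in> S N" "x \<notin> S n" for x
  proof (cases "N \<in> B")
    case True then show ?thesis using st(1) that by auto
  next
    case False
    then have cr: "base N dvd N" using st(3) that by blast
    then have "x \<in> dd N ` {1..i}" using st(2)[OF False] that by blast
    then obtain j where j: "1 \<le> j" "x = dd N j" by auto
    then have "dd N 1 \<le> x" using st(2)[OF False cr] by (simp add: strict_mono_less_eq)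
    then show ?thesis using st(2)[OF False cr] by simp
  qed
  have cn: "c n \<le> h n" by (rule InvD(4)[OF I n order_refl])
  define v where "v = ch h (base N) (c N) N"
  have v: "h n < v \<and> c N \<le> v \<and>
     (\<forall>x\<in>S N. x < c N \<longrightarrow> ch h (base N) x N \<le> h n \<or> (\<exists>y\<in>S N. x < y \<and> y \<le> ch h (base N) x N))"
  proof (cases "N \<in> B")
    case True
    \<comment> \<open>Here \<open>N\<close> is its own base, so its image is the new base itself.
      The old elements are at most \<open>h n\<close>; only the multiple just added is
      larger.\<close>
    have vv: "ch h (base N) x N = x" for x using ch_self mu(2) mu(3)[OF True] base_in[OF True] by simp
    have "x \<le> h n" if "x \<in> S N" "x < c N" for x using that st(1)[OF True] c_ge[of x n] cn by auto
    then show ?thesis unfolding v_def vv using st(1)[OF True] by blast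
  next
    case False
    have e: "base N = base n" unfolding N_def by (rule base_Suc) (use n False N_def in auto)
    have lt: "base n < N" using b(2) by (simp add: N_def)
    have cN: "c n \<le> c N" by (rule c_mono) (simp add: N_def)
    have "v > ch h (base n) (c N) (base n)" unfolding v_def e by (rule Inv_ch_mono[OF I b(1,2) cN lt])
    then have vc: "c N < v" using ch_self[OF b(4)] by simp
    show ?thesis
    proof (cases "base N dvd N")
      case True
      note s = st(2)[OF False True]
      have "dd N 1 \<le> c N" using s i by (simp add: strict_mono_less_eq)
      then have "h n < v" using s vc by simp
      moreover have "ch h (base N) x N \<le> h n \<or> (\<exists>y\<in>S N. x < y \<and> y \<le> ch h (base N) x N)" if x: "x \<in> S N" "x < c N" for x
      proof (cases "x < c n")
        case True
        \<comment> \<open>An element below the old maximum is skipped: its value is below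
          \<open>c n \<le> h n\<close>, or else it reaches the larger element
          \<open>c n\<close>.\<close>
        then have xn: "x \<in> S n" using new cn x(1) by fastforce
        show ?thesis
        proof (cases "c n \<le> ch h (base N) x N")
          case t: True
          have "c n \<in> S N" using S_Suc_mono[of n] c_in[of n] unfolding N_def by blast
          then show ?thesis using t True by blast
        qed (use cn in auto)
      next
        case nlt: False
        have "\<exists>j<i. x = dd N j"
        proof (cases "x \<in> S n")
          case True
          then have "x = dd N 0" using nlt c_ge[OF True] by (simp add: N_def dd.simps)
          then show ?thesis using i by (intro exI[of _ 0]) auto
        next
          case False
          then obtain j where j: "j \<le> i" "x = dd N j" using s x(1) by auto
          then have "j \<noteq> i" using s x(2) by auto
          then have "j < i" using j(1) by linarith
          then show ?thesis using j(2) by blast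
        qed
        then obtain j where j: "j < i" "x = dd N j" by blast
        \<comment> \<open>The value of \<open>N\<close> for the base \<open>dd N j\<close> is the
          next member of the chain, hence not below it. So only the last member of the chain is
          admissible.\<close>
        have "dd N (Suc j) \<in> S N" using s j by auto
        moreover have "dd N j < dd N (Suc j)" using s by (simp add: strict_mono_Suc_iff)
        ultimately show ?thesis unfolding j(2) by (metis dd.simps(2) order_refl)
      qed
      ultimately show ?thesis using vc by (meson less_imp_le)
    next
      case nd: False
      have Se: "S N = S n" by (rule st(3)[OF False nd])
      then have ce: "c N = c n" by (simp add: c_def)
      have "h n = ch h (base n) (c n) n" using InvD(3)[OF I n] by simp
      then have "h n < v" unfolding v_def e ce using Inv_ch_mono[OF I b(1,2), of "c n" n N] by (simp add: N_def)
      moreover have "ch h (base N) x N \<le> h n \<or> (\<exists>y\<in>S N. x < y \<and> y \<le> ch h (base N) x N)" if x: "x \<in> S N" "x < c N" for x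
        using c_in[of n] Se x cn ce by (metis nle_le order_trans)
      ultimately show ?thesis using vc by (meson less_imp_le)
    qed
  qed
  have A5: "h m < x" if "\<mu> \<le> m" "m \<le> n" "x \<in> S N" "x \<notin> S m" for m x
  proof (cases "x \<in> S n")
    case True then show ?thesis using InvD(5)[OF I that(1,2)] that by blast
  next
    case False
    then have "h n < x" using new that by blast
    moreover have "h m \<le> h n" using InvD(2)[OF I, of m n] that(2) by (cases "m = n") auto
    ultimately show ?thesis by simp
  qed
  have U: "upgrade B (S N) m = enat (h m)" if "m \<le> n" for m
    using that
  proof (induction m rule: less_induct)
    case (less m)
    show ?case
    proof (cases "m < \<mu>")
      case True then show ?thesis by (simp add: upgrade_low h_low)
    next
      case False
      then have m: "\<mu> \<le> m" by simp
      show ?thesis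
      proof (rule upgrade_eqI[where g = h and d = "c m", OF m])
        show "upgrade B (S N) k = enat (h k)" if "k < m" for k using less that by simp
        show "c m \<in> S N" using S_mono[of m N] c_in less(2) by (auto simp: N_def)
        show "h m = ch h (base m) (c m) m" using InvD(3)[OF I m less(2)] .
        show "h (m - 1) < h m" using m mu(2) less(2) by (intro InvD(2)[OF I]) auto
        show "h m < x" if "x \<in> S N" "c m < x" for x
          using A5[OF m less(2) that(1)] c_ge[of x m] that(2) by fastforce
        show "ch h (base m) x m \<le> h (m - 1) \<or> (\<exists>y\<in>S N. x < y \<and> y \<le> ch h (base m) x m)" if "x \<in> S N" "x < c m" for x
        proof -
          have "x \<in> S m" using A5[OF m less(2) that(1)] InvD(4)[OF I m less(2)] that(2) by fastforce
          then show ?thesis using InvD(6)[OF I m less(2) _ that(2)] S_mono[of m N] less(2) unfolding N_def by fastforce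
        qed
      qed
    qed
  qed
  have "upgrade B (S N) N = enat v"
  proof (rule upgrade_eqI[where g = h and d = "c N", OF N])
    show "upgrade B (S N) k = enat (h k)" if "k < N" for k using U that by (simp add: N_def)
    show "v = ch h (base N) (c N) N" by (simp add: v_def)
    show "v < x" if "x \<in> S N" "c N < x" for x using c_ge that by fastforce
    show "c N \<in> S N" by (rule c_in)
    show "h (N - 1) < v" using v by (simp add: N_def)
    show "ch h (base N) x N \<le> h (N - 1) \<or> (\<exists>y\<in>S N. x < y \<and> y \<le> ch h (base N) x N)" if "x \<in> S N" "x < c N" for x
      using v that unfolding N_def diff_Suc_1 by blast
  qed
  then have hN: "h N = v" by (simp add: h_def)
  have le_N: "m \<le> n \<or> m = N" if "m \<le> N" for m using that by (auto simp: N_def)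
  have "upgrade B (S N) m = enat (h m)" if "m \<le> N" for m
    using le_N[OF that] U \<open>upgrade B (S N) N = enat v\<close> hN by auto
  moreover have "h k < h m" if "k < m" "m \<le> N" for k m
  proof (cases "m = N")
    case True
    then have "h k \<le> h n" using InvD(2)[OF I, of k n] that by (cases "k = n") (auto simp: N_def)
    then show ?thesis using v hN True by simp
  qed (use InvD(2)[OF I that(1)] le_N[OF that(2)] in auto)
  moreover have "h m = ch h (base m) (c m) m \<and> c m \<le> h m \<and>
      (\<forall>x\<in>S N. x \<notin> S m \<longrightarrow> h m < x) \<and>
      (\<forall>x\<in>S m. x < c m \<longrightarrow> ch h (base m) x m \<le> h (m - 1) \<or> (\<exists>y\<in>S m. x < y \<and> y \<le> ch h (base m) x m))"
    if "\<mu> \<le> m" "m \<le> N" for m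
    using le_N[OF that(2)]
  proof
    assume "m \<le> n"
    then show ?thesis using InvD(3,4,6)[OF I that(1)] A5[OF that(1)] by blast
  next
    assume m: "m = N"
    show ?thesis unfolding m hN using v v_def unfolding N_def diff_Suc_1 by blast
  qed
  ultimately show ?thesis unfolding Inv_def N_def[symmetric] by blast
qed

lemma Inv_all: "\<mu> \<le> n \<Longrightarrow> Inv n"
  by (induction n rule: dec_induct) (auto intro: Inv_mu Inv_Suc)

lemma strict_mono_h: "strict_mono h"
proof (rule strict_monoI)
  fix k m :: nat assume "k < m"
  then show "h k < h m" using InvD(2)[OF Inv_all[of "max \<mu> m"]] by simp
qed

lemma h_ge: "n \<le> h n" using strict_mono_h by (rule strict_mono_imp_increasing)

lemma h_eq: "\<mu> \<le> n \<Longrightarrow> h n = ch h (base n) (c n) n" using InvD(3)[OF Inv_all] by blast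

lemma c_le_h: "\<mu> \<le> n \<Longrightarrow> c n \<le> h n" using InvD(4)[OF Inv_all] by blast

lemma C_eq: "x \<in> C \<longleftrightarrow> (\<exists>n. x \<in> S n)" by (auto simp: ouroboros_def)

lemma c_in_C: "c n \<in> C" using c_in C_eq by blast

lemma not_in_stage: assumes "\<mu> \<le> m" "x \<in> C" "x \<notin> S m" shows "h m < x"
proof -
  obtain n where n: "x \<in> S n" using assms C_eq by blast
  then have "x \<in> S (max m n)" using S_mono[of n "max m n"] by auto
  then show ?thesis using InvD(5)[OF Inv_all, of "max m n" m x] assms by auto
qed

lemma above_c: "\<mu> \<le> m \<Longrightarrow> x \<in> C \<Longrightarrow> c m < x \<Longrightarrow> h m < x"
  using not_in_stage c_ge by (meson not_le)

lemma h_upgrade_stage: "\<mu> \<le> n \<Longrightarrow> m \<le> n \<Longrightarrow> upgrade B (S n) m = enat (h m)"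
  using InvD(1)[OF Inv_all] by blast

lemma upgrade_stage_h: "upgrade B (S n) n = enat (h n)"
  by (cases "n < \<mu>") (simp_all add: h_upgrade_stage h_low upgrade_low)

text \<open>Later additions exceed \<open>h m\<close>, so they neither become the base for
  \<open>m\<close> nor spoil the upper bound on its value.\<close>

lemma upgrade_h: "upgrade B C m = enat (h m)"
proof (induction m rule: less_induct)
  case (less m)
  show ?case
  proof (cases "m < \<mu>")
    case True then show ?thesis by (simp add: upgrade_low h_low)
  next
    case False
    then have m: "\<mu> \<le> m" by simp
    show ?thesis
    proof (rule upgrade_eqI[where g = h and d = "c m", OF m])
      show "h (m - 1) < h m" using strict_mono_h m mu(2) by (intro strict_monoD[OF strict_mono_h]) simp
      show "ch h (base m) x m \<le> h (m - 1) \<or> (\<exists>y\<in>C. x < y \<and> y \<le> ch h (base m) x m)" if "x \<in> C" "x < c m" for x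
      proof -
        have "x \<in> S m" using not_in_stage[OF m that(1)] c_le_h[OF m] that(2) by fastforce
        then show ?thesis using InvD(6)[OF Inv_all[OF m] m order_refl _ that(2)] C_eq by blast
      qed
    qed (use less c_in_C h_eq m above_c in auto)
  qed
qed

text \<open>An element that is new at a stage \<open>n\<close> above the minimum exceeds
  \<open>h (n - 1) \<ge> n - 1\<close>. The bound provides a small witness for membership in the
  union of the stages.\<close>

lemma in_C_stage: assumes "x \<in> C" obtains n where "n \<le> x" "x \<in> S n"
proof -
  define n where "n = (LEAST n. x \<in> S n)"
  have n: "x \<in> S n" unfolding n_def using assms C_eq by (metis LeastI)
  have nl: "x \<notin> S m" if "m < n" for m using that not_less_Least unfolding n_def by blast
  have "n \<le> x"
  proof (cases "n \<le> \<mu>")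
    case True
    then have "S n = S 0" using S_low by simp
    then show ?thesis using n nl by fastforce
  next
    case False
    then have "h (n - 1) < x" using not_in_stage[of "n - 1" x] nl[of "n - 1"] assms by simp
    then show ?thesis using h_ge[of "n - 1"] by simp
  qed
  then show thesis using that n by blast
qed

section \<open>Upgrades of sums and multiples of a base\<close>

lemma h_base: "b \<in> B \<Longrightarrow> h b = c b" using Inv_base[OF Inv_all] mu(3) by blast

lemma h_mu: "h \<mu> = \<mu> + 1"
  using h_base[OF mu(1)] S_low[of \<mu>] by (simp add: c_def)

lemma mu_C: "Inf C = \<mu> + 1" "C \<noteq> {}" "0 \<notin> C" "1 \<notin> C"
proof -
  have in_C: "\<mu> + 1 \<in> C" using S_low[of 0] C_eq by blast
  have ge: "\<mu> + 1 \<le> x" if "x \<in> C" for x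
  proof (cases "x \<in> S \<mu>")
    case True then show ?thesis using S_low[of \<mu>] by simp
  next
    case False then show ?thesis using not_in_stage[of \<mu> x] h_mu that by simp
  qed
  show "C \<noteq> {}" using in_C by blast
  show "0 \<notin> C" "1 \<notin> C" using ge mu(2) by fastforce+
  show "Inf C = \<mu> + 1" using in_C ge by (intro cInf_eq_minimum) auto
qed

lemma c_no_crit:
  assumes "\<mu> \<le> n" "\<And>m. n < m \<Longrightarrow> m \<le> k \<Longrightarrow> m \<notin> B \<and> \<not> base m dvd m" "n \<le> k" shows "c k = c n"
  using assms(3,2)
proof (induction k rule: dec_induct)
  case (step k)
  have "S (Suc k) = S k" by (rule stage_step(3)[OF Inv_all]) (use step assms(1) in auto)
  then show ?case using step by (simp add: c_def)
qed simp

text \<open>Nothing after \<open>b\<close> up to \<open>b + r\<close> is critical, so the maximum of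
  the stages stays at \<open>h b\<close>, and \<open>r < b\<close> is upgraded like a digit.\<close>

lemma h_add:
  assumes b: "b \<in> B" "r < b" and gap: "\<And>x. x \<in> B \<Longrightarrow> b < x \<Longrightarrow> b + r < x"
  shows "h (b + r) = h b + h r" "\<And>x. x \<in> C \<Longrightarrow> h b < x \<Longrightarrow> h b + h r < x"
proof -
  have b2: "2 \<le> b" "\<mu> \<le> b" using mu(2) mu(3)[OF b(1)] by simp_all
  have bs: "base (b + s) = b" if "s \<le> r" for s using base_eq[OF b(1), of "b + s"] gap that by fastforce
  have ce: "c (b + r) = c b"
  proof (rule c_no_crit[OF b2(2)])
    fix m assume m: "b < m" "m \<le> b + r"
    then have "base m = b" using bs[of "m - b"] by simp
    moreover have "\<not> b dvd m"
    proof
      assume "b dvd m"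
      then have "b dvd m - b" by simp
      then show False using m b(2) by (auto dest: dvd_imp_le)
    qed
    ultimately show "m \<notin> B \<and> \<not> base m dvd m" using gap m by fastforce
  qed simp
  have "h (b + r) = ch h b (c b) (b ^ 1 * 1 + r)" using h_eq[of "b + r"] b2 bs[of r] ce by simp
  also have "\<dots> = c b ^ ch h b (c b) 1 * h 1 + ch h b (c b) r"
    by (rule ch_decomp) (use b2 b in auto)
  also have "\<dots> = c b + h r" using b2 b h01 by (simp add: ch_small)
  finally show *: "h (b + r) = h b + h r" by (simp add: h_base[OF b(1)])
  show "h b + h r < x" if "x \<in> C" "h b < x" for x
    using above_c[of "b + r" x] b2 that ce * h_base[OF b(1)] by simp
qed

text \<open>The number \<open>b * a\<close> falls under the third case of the construction. The
  digit \<open>a\<close> is fixed by the upgrade because \<open>a < \<mu>\<close>, so every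
  iteration multiplies by \<open>a\<close>: the chain is geometric, and no other base lies within
  it.\<close>

lemma h_critical:
  assumes b: "b \<in> B" and a: "2 \<le> a" "a < \<mu>" and gap: "\<And>x. x \<in> B \<Longrightarrow> b < x \<Longrightarrow> b * a < x"
  obtains d where "\<And>j. j \<le> i \<Longrightarrow> d j \<in> C" "h b \<le> d 0" "\<And>j. j < i \<Longrightarrow> d (Suc j) = d j * a" "h (b * a) = d i * a"
    "\<And>j x. j < i \<Longrightarrow> x \<in> C \<Longrightarrow> d j < x \<Longrightarrow> d (Suc j) \<le> x" "\<And>x. x \<in> C \<Longrightarrow> d i < x \<Longrightarrow> d i * a < x"
proof -
  define N where "N = b * a"
  have b2: "2 \<le> b" "\<mu> \<le> b" using mu(2) mu(3)[OF b(1)] by simp_all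
  have bN: "b < N" unfolding N_def using a b2 by simp
  have bs: "base N = b" using base_eq[OF b(1), of N] gap bN by (simp add: N_def)
  define n where "n = N - 1"
  have n: "N = Suc n" "\<mu> \<le> n" "b \<le> n" using bN b2 by (auto simp: n_def)
  have NB: "N \<notin> B" using gap[of N] bN by (auto simp: N_def)
  have dv: "base N dvd N" unfolding bs by (simp add: N_def)
  note s = stage_step(2)[OF Inv_all[OF n(2)] n(2), folded n(1), OF NB dv]
  have mult: "ch h (base N) d N = d * a" for d
    unfolding bs unfolding N_def using ch_mult[of b a h d] b2 a h01 h_low[of a] by simp
  have hN: "h N = dd N i * a" using h_eq[of N] n s mult by simp
  have d0: "dd N 0 = c n" by (simp add: n_def dd.simps)
  show thesis
  proof (rule that[of "dd N"])
    show "dd N j \<in> C" if "j \<le> i" for j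
    proof (cases j)
      case 0 then show ?thesis using d0 c_in_C by simp
    next
      case (Suc k) then have "dd N j \<in> S N" using s that by auto
      then show ?thesis using C_eq by blast
    qed
    show "h b \<le> dd N 0" using d0 h_base[OF b(1)] c_mono[OF n(3)] by simp
    show "dd N (Suc j) = dd N j * a" if "j < i" for j using mult by (simp add: dd.simps)
    show "h (b * a) = dd N i * a" using hN by (simp add: N_def)
    show "dd N i * a < x" if "x \<in> C" "dd N i < x" for x using above_c[of N x] hN that s n by simp
    show "dd N (Suc j) \<le> x" if x: "j < i" "x \<in> C" "dd N j < x" for j x
    proof (cases "x \<in> S N")
      case True
      have "c n \<le> dd N j" using d0 s strict_mono_less_eq[of "dd N" 0 j] by simp
      then have "x \<notin> S n" using c_ge[of x n] x(3) by auto
      then obtain l where l: "x = dd N l" using s True by auto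
      then have "j < l" using x(3) s by (simp add: strict_mono_less)
      then show ?thesis using l s by (simp add: strict_mono_less_eq Suc_le_eq del: dd.simps)
    next
      case False
      then have "h N < x" using not_in_stage[of N x] n x(2) by simp
      moreover have "dd N i \<le> h N" using hN a by simp
      moreover have "dd N (Suc j) \<le> dd N i" using s x(1) by (simp add: strict_mono_less_eq Suc_le_eq del: dd.simps)
      ultimately show ?thesis by simp
    qed
  qed
qed

text \<open>The digit \<open>\<mu>\<close> is the least one to be changed by the upgrade, namely to
  \<open>\<mu> + 1\<close>.\<close>

lemma h_top:
  assumes b: "b \<in> B" and gap: "\<And>x. x \<in> B \<Longrightarrow> b < x \<Longrightarrow> b * \<mu> < x"
  obtains d where "d \<in> C" "d * (\<mu> + 1) \<le> h (b * \<mu>)" "\<And>x. x \<in> C \<Longrightarrow> d < x \<Longrightarrow> d * (\<mu> + 1) < x"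
proof -
  have b2: "2 \<le> b" "\<mu> \<le> b" using mu(2) mu(3)[OF b(1)] by simp_all
  let ?N = "b * \<mu>"
  have bN: "b < ?N" using mu(2) b2 by simp
  have bs: "base ?N = b" using base_eq[OF b(1), of ?N] gap bN by simp
  have mN: "\<mu> \<le> ?N" using bN b2 by simp
  have ge: "c ?N * (\<mu> + 1) \<le> h ?N"
  proof (cases "\<mu> < b")
    case True
    then show ?thesis using h_eq[OF mN] bs ch_mult[of b \<mu> h "c ?N"] b2 mu(2) h01 h_mu by simp
  next
    case False
    \<comment> \<open>For \<open>b = \<mu>\<close> the number is not a multiple of \<open>b\<close>
      by a digit but the power \<open>b ^ 2\<close>. Its image is a power of the new base with
      exponent at least \<open>2\<close>.\<close>
    then have bm: "b = \<mu>" using b2 by simp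
    have "h ?N = ch h b (c ?N) (b ^ 2 * 1 + 0)" using h_eq[OF mN] bs bm by (simp add: power2_eq_square)
    also have "\<dots> = c ?N ^ ch h b (c ?N) 2 * h 1 + ch h b (c ?N) 0" by (rule ch_decomp) (use b2 in auto)
    finally have hN: "h ?N = c ?N ^ ch h b (c ?N) 2" using h01 b2 by (simp add: ch_small)
    have m: "ch h b (c ?N) k < ch h b (c ?N) m" if "k < m" for k m
    proof (rule Inv_ch_mono[OF Inv_all[OF mN] b _ order_refl that])
      show "b \<le> ?N" using bN by simp
    qed
    have "2 \<le> ch h b (c ?N) 2" using m[of 0 1] m[of 1 2] by simp
    moreover have "\<mu> + 1 \<le> c ?N" using c_mono[OF mN] h_base[OF mu(1)] h_mu by simp
    moreover have "c ?N * (\<mu> + 1) \<le> c ?N ^ 2" using mult_le_mono2[OF calculation(2), of "c ?N"] by (simp only: power2_eq_square)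
    moreover have "c ?N ^ 2 \<le> c ?N ^ ch h b (c ?N) 2" using calculation(1,2) by (intro power_increasing) auto
    ultimately show ?thesis using hN by linarith
  qed
  show thesis
    by (rule that[OF c_in_C ge]) (use above_c[OF mN] ge in fastforce)
qed

end

section \<open>Lower bounds for the Goodstein process\<close>

declare base_seq.simps(2) [simp del] goodstein.simps(2) [simp del]

locale process =
  fixes B0 :: "nat set"
  assumes B0: "B0 \<noteq> {}" "0 \<notin> B0" "1 \<notin> B0"
begin

abbreviation "BB \<equiv> base_seq B0"
definition "up i n = the_enat (upgrade (BB i) (BB (Suc i)) n)"

lemma ouro_BB: "ouro (BB i) (Suc i)"
proof (induction i)
  case 0
  then show ?case using B0 by unfold_locales auto
next
  case (Suc i)
  then interpret ouro "BB i" "Suc i" .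
  show ?case using mu_C by unfold_locales (auto simp: base_seq.simps(2))
qed

lemma Inf_BB: "Inf (BB i) = Inf B0 + i"
proof (induction i)
  case (Suc i)
  interpret ouro "BB i" "Suc i" by (rule ouro_BB)
  show ?case using mu_C Suc by (simp add: base_seq.simps(2))
qed simp

lemma h_eq_up: "ouro.h (BB i) (Suc i) = up i"
  using ouro.upgrade_h[OF ouro_BB, of i] by (intro ext) (simp add: up_def base_seq.simps(2))

lemma upgrade_up: "upgrade (BB i) (BB (Suc i)) n = enat (up i n)"
  using ouro.upgrade_h[OF ouro_BB, of i n] by (simp add: h_eq_up base_seq.simps(2))

lemma up_strict_mono: "strict_mono (up i)"
  using ouro.strict_mono_h[OF ouro_BB, of i] by (simp add: h_eq_up)

lemma up_less: "m < n \<Longrightarrow> up i m < up i n" using up_strict_mono strict_monoD by blast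
lemma up_mono: "m \<le> n \<Longrightarrow> up i m \<le> up i n" using up_strict_mono strict_mono_less_eq by blast
lemma up_ge: "n \<le> up i n" using ouro.h_ge[OF ouro_BB, of n i] by (simp add: h_eq_up)

lemma up_base: "b \<in> BB i \<Longrightarrow> up i b \<in> BB (Suc i)"
  using ouro.h_base[OF ouro_BB, of b i] ouro.c_in_C[OF ouro_BB, of i b] by (simp add: h_eq_up base_seq.simps(2))

lemma BB_pos: "b \<in> BB i \<Longrightarrow> 2 \<le> b"
  using ouro.mu(2)[OF ouro_BB, of i] ouro.mu(3)[OF ouro_BB, of b i] by simp

lemmas up_add = ouro.h_add[OF ouro_BB, unfolded h_eq_up, folded base_seq.simps]
lemmas up_critical = ouro.h_critical[OF ouro_BB, unfolded h_eq_up Inf_BB, folded base_seq.simps]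
lemmas up_top = ouro.h_top[OF ouro_BB, unfolded h_eq_up Inf_BB, folded base_seq.simps]

text \<open>\<open>lasts i w t\<close>: the process that has the value \<open>w\<close> at time \<open>i\<close> does not reach \<open>0\<close> before
  time \<open>t\<close>.\<close>

inductive lasts :: "nat \<Rightarrow> nat \<Rightarrow> nat \<Rightarrow> bool" where
  lasts_le: "t \<le> i \<Longrightarrow> lasts i w t"
| lasts_step: "0 < w \<Longrightarrow> lasts (Suc i) (up i w - 1) t \<Longrightarrow> lasts i w t"

lemma lasts_goodstein:
  "lasts i w t \<Longrightarrow> goodstein B0 n i = enat w \<Longrightarrow> i \<le> j \<Longrightarrow> j < t \<Longrightarrow> goodstein B0 n j \<noteq> 0"
proof (induction rule: lasts.induct)
  case (lasts_step w i t)
  have "goodstein B0 n (Suc i) = enat (up i w - 1)"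
    using lasts_step(1,4) by (simp add: goodstein.simps(2) upgrade_up one_enat_def)
  show ?case
  proof (cases "i = j")
    case True then show ?thesis using lasts_step(1,4) by (simp add: zero_enat_def)
  next
    case False then show ?thesis using lasts_step(3)[OF \<open>goodstein B0 n (Suc i) = enat (up i w - 1)\<close>] lasts_step(5,6) by simp
  qed
qed auto

lemma lasts_mono: "lasts i w t \<Longrightarrow> w \<le> w' \<Longrightarrow> lasts i w' t"
proof (induction arbitrary: w' rule: lasts.induct)
  case (lasts_step w i t)
  have "lasts (Suc i) (up i w' - 1) t" using lasts_step(3)[of "up i w' - 1"] up_mono[OF lasts_step(4), of i] by simp
  then show ?case by (rule lasts.lasts_step[rotated]) (use lasts_step(1,4) in simp)
qed (auto intro: lasts_le)

lemma lasts_antimono: "lasts i w t \<Longrightarrow> t' \<le> t \<Longrightarrow> lasts i w t'"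
  by (induction rule: lasts.induct) (auto intro: lasts.intros)

text \<open>Upgrades without subtraction: this is what happens to the leading summand while lower
  summands run down.\<close>

primrec track :: "nat \<Rightarrow> nat \<Rightarrow> nat \<Rightarrow> nat" where
  "track i n 0 = n"
| "track i n (Suc k) = up (i + k) (track i n k)"

lemma track_shift: "track (Suc i) (up i n) k = track i n (Suc k)"
  by (induction k) auto

lemma track_mono: "m \<le> n \<Longrightarrow> track i m k \<le> track i n k"
  by (induction k) (auto intro: up_mono)

lemma track_add: "track (i + k) (track i n k) j = track i n (k + j)"
  by (induction j) (auto simp: add.assoc)

text \<open>Demanded along the whole track, because a leading summand starts to run down only after
  the lower ones have been used up, at a time not known in advance.\<close>

definition speed :: "nat \<Rightarrow> nat \<Rightarrow> (nat \<Rightarrow> nat) \<Rightarrow> bool" where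
  "speed i n f \<longleftrightarrow> (\<forall>k. lasts (i + k) (track i n k) (f (i + k)))"

lemma speed_lasts: "speed i n f \<Longrightarrow> lasts i n (f i)"
  unfolding speed_def by (metis add_0_right track.simps(1))

lemma speed_mono: "speed i n f \<Longrightarrow> n \<le> n' \<Longrightarrow> speed i n' f"
  unfolding speed_def using lasts_mono track_mono by blast

lemma speed_track: "speed i n f \<Longrightarrow> speed (i + k) (track i n k) f"
  unfolding speed_def track_add by (metis add.assoc)

lemma speed_up: "speed i n f \<Longrightarrow> speed (Suc i) (up i n) f"
  using speed_track[of i n f 1] by simp

text \<open>Every subtraction is taken from the upgrade of \<open>r\<close>, while \<open>c\<close>
  is merely upgraded. At time \<open>t\<close> the leading summand is still intact, and from there
  it lasts until \<open>f t\<close>.\<close>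

lemma lasts_add:
  "lasts i r t \<Longrightarrow> c \<in> BB i \<Longrightarrow> r < c \<Longrightarrow> (\<And>x. x \<in> BB i \<Longrightarrow> c < x \<Longrightarrow> c + r < x) \<Longrightarrow> speed i c f \<Longrightarrow> infl f
    \<Longrightarrow> lasts i (c + r) (f t)"
proof (induction arbitrary: c rule: lasts.induct)
  case (lasts_le t i w)
  have "lasts i c (f i)" using lasts_le by (intro speed_lasts)
  then show ?case using infl_monoD[OF lasts_le(6,1)] by (meson lasts_antimono lasts_mono le_add1)
next
  case (lasts_step w i t)
  note a = up_add[OF lasts_step(4,5,6)]
  have w: "w \<le> up i w" by (rule up_ge)
  have "lasts (Suc i) (up i c + (up i w - 1)) (f t)"
  proof (rule lasts_step.IH)
    show "up i c \<in> BB (Suc i)" by (rule up_base[OF lasts_step(4)])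
    show "up i w - 1 < up i c" using up_less[OF lasts_step(5), of i] by simp
    show "up i c + (up i w - 1) < x" if "x \<in> BB (Suc i)" "up i c < x" for x
      using a(2)[of x] that lasts_step(6) by simp
    show "speed (Suc i) (up i c) f" by (rule speed_up[OF lasts_step(7)])
  qed (rule lasts_step)
  moreover have "up i (c + w) - 1 = up i c + (up i w - 1)" using a(1) lasts_step(1) w by simp
  ultimately have "lasts (Suc i) (up i (c + w) - 1) (f t)" by simp
  then show ?case by (rule lasts.lasts_step[rotated]) (use lasts_step(1) in simp)
qed

section \<open>Gaps above a base and the chains that they produce\<close>

definition gap :: "nat \<Rightarrow> nat \<Rightarrow> nat \<Rightarrow> bool" where
  "gap i b a \<longleftrightarrow> b \<in> BB i \<and> (\<forall>x\<in>BB i. b < x \<longrightarrow> b * a < x)"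

lemma gap_mono: "gap i b a \<Longrightarrow> a' \<le> a \<Longrightarrow> gap i b a'"
  unfolding gap_def by (meson le_less_trans mult_le_mono2)

text \<open>Consecutive bases of the chain have ratio \<open>a\<close>, so all but the last have a
  gap with factor \<open>a - 1\<close> only. This loss is what makes \<open>speed_Phi\<close> use a
  gap with factor \<open>m + 3\<close> to call its induction hypothesis at
  \<open>m + 2\<close>.\<close>

lemma gap_critical:
  assumes g: "gap i b a" and a: "2 \<le> a" "a < Inf B0 + i"
  obtains d where "\<And>j. j \<le> i \<Longrightarrow> gap (Suc i) (d j) (a - 1)" "\<And>j. j \<le> i \<Longrightarrow> d (Suc j) = d j * a"
    "\<And>j x. j \<le> i \<Longrightarrow> x \<in> BB (Suc i) \<Longrightarrow> d j < x \<Longrightarrow> d (Suc j) \<le> x"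
    "gap (Suc i) (d (Suc i)) a" "up i b \<le> d 0" "up i (b * a) = d (Suc i) * a"
proof (rule up_critical)
  show "b \<in> BB i" "2 \<le> a" "a < Inf B0 + i" using g a by (auto simp: gap_def)
  show "b * a < x" if "x \<in> BB i" "b < x" for x using g that by (auto simp: gap_def)
next
  fix d assume d: "\<And>j. j \<le> Suc i \<Longrightarrow> d j \<in> BB (Suc i)" "up i b \<le> d 0" "\<And>j. j < Suc i \<Longrightarrow> d (Suc j) = d j * a"
    "up i (b * a) = d (Suc i) * a"
    "\<And>j x. j < Suc i \<Longrightarrow> x \<in> BB (Suc i) \<Longrightarrow> d j < x \<Longrightarrow> d (Suc j) \<le> x"
    "\<And>x. x \<in> BB (Suc i) \<Longrightarrow> d (Suc i) < x \<Longrightarrow> d (Suc i) * a < x"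
  show thesis
  proof (rule that[of d])
    show "gap (Suc i) (d (Suc i)) a" using d(1)[of "Suc i"] d(6) unfolding gap_def by blast
    show dj: "d (Suc j) = d j * a" if j: "j \<le> i" for j using d(3) j by simp
    show "gap (Suc i) (d j) (a - 1)" if j: "j \<le> i" for j
    proof -
      have "2 \<le> d j" using d(1)[of j] BB_pos j by (metis le_SucI)
      then have "d j * (a - 1) < d j * a" using a by simp
      then have "d j * (a - 1) < x" if "x \<in> BB (Suc i)" "d j < x" for x
        using d(5)[of j x] that j dj[OF j] by (metis le_imp_less_Suc less_le_trans)
      then show ?thesis using d(1)[of j] j unfolding gap_def by auto
    qed
    show "d (Suc j) \<le> x" if "j \<le> i" "x \<in> BB (Suc i)" "d j < x" for j x using d(5)[of j x] that by simp
  qed (use d(2,4) in auto)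
qed

text \<open>The minima grow with time, so the digit \<open>a\<close> stays below them and is never
  changed.\<close>

lemma gap_track:
  assumes g: "gap i b a" and a: "2 \<le> a" "a < Inf B0 + i"
  obtains e where "gap (i + k) e a" "track i (b * a) k = e * a" "track i b k \<le> e"
proof -
  have "\<exists>e. gap (i + k) e a \<and> track i (b * a) k = e * a \<and> track i b k \<le> e"
  proof (induction k)
    case 0 show ?case using g by auto
  next
    case (Suc k)
    then obtain e where e: "gap (i + k) e a" "track i (b * a) k = e * a" "track i b k \<le> e" by blast
    obtain d where d: "\<And>j. j \<le> i + k \<Longrightarrow> d (Suc j) = d j * a"
      "gap (Suc (i + k)) (d (Suc (i + k))) a" "up (i + k) e \<le> d 0" "up (i + k) (e * a) = d (Suc (i + k)) * a"
      by (rule gap_critical[OF e(1) a(1)]) (use a in auto)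
    have "d 0 \<le> d j" if "j \<le> Suc (i + k)" for j
      using that
    proof (induction j)
      case (Suc j)
      then have "d (Suc j) = d j * a" "d 0 \<le> d j" using d(1) by auto
      then show ?case using a mult_le_mono2[of 1 a "d j"] by linarith
    qed simp
    then have "d 0 \<le> d (Suc (i + k))" by blast
    moreover have "track i b (Suc k) \<le> d 0" using d(3) up_mono[OF e(3), of "i + k"] by simp
    ultimately show ?case using d e by (intro exI[of _ "d (Suc (i + k))"]) auto
  qed
  then show thesis using that by blast
qed

lemma speed_Phi:
  "gap i b (m + 2) \<Longrightarrow> m + 2 < Inf B0 + i \<Longrightarrow> infl f \<Longrightarrow> speed i b f \<Longrightarrow> speed i (b * (m + 2)) (Phi m f)"
proof (induction m arbitrary: i b f)
  case 0
  show ?case unfolding speed_def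
  proof
    fix k
    obtain e where e: "gap (i + k) e 2" "track i (b * 2) k = e * 2" "track i b k \<le> e"
      by (rule gap_track[of i b 2 k]) (use 0 in \<open>auto simp: numeral_2_eq_2\<close>)
    define t where "t = i + k"
    have se: "speed t e f" unfolding t_def by (rule speed_mono[OF speed_track[OF 0(4)] e(3)])
    have t2: "2 < Inf B0 + t" using 0(2) by (simp add: t_def)
    obtain d where d: "\<And>j. j \<le> t \<Longrightarrow> gap (Suc t) (d j) 1" "\<And>j. j \<le> t \<Longrightarrow> d (Suc j) = d j * 2"
      "\<And>j x. j \<le> t \<Longrightarrow> x \<in> BB (Suc t) \<Longrightarrow> d j < x \<Longrightarrow> d (Suc j) \<le> x"
      "gap (Suc t) (d (Suc t)) 2" "up t e \<le> d 0" "up t (e * 2) = d (Suc t) * 2"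
      by (rule gap_critical[OF e(1)[folded t_def] order_refl t2]) auto
    have pos: "2 \<le> d 0" using d(1)[of 0] BB_pos unfolding gap_def by blast
    have d1: "d 1 = d 0 * 2" using d(2)[of 0] by simp
    have "d 1 \<le> d (Suc j)" if "j \<le> t" for j using that
    proof (induction j)
      case (Suc j) then show ?case using d(2)[of "Suc j"] by simp
    qed simp
    then have d1t: "d 1 \<le> d (Suc t)" by simp
    \<comment> \<open>To treat \<open>d 0\<close> as a lower summand of \<open>d 1\<close>, their
      sum has to stay below the next base. That base is at least \<open>d 2\<close>, except for
      \<open>t = 0\<close>, where the chain ends with \<open>d 1\<close> and the gap at its end is
      used.\<close>
    have g1: "d 1 + d 0 < x" if "x \<in> BB (Suc t)" "d 1 < x" for x
    proof (cases "t = 0")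
      case True
      then have "d 1 * 2 < x" using d(4) that unfolding gap_def by simp
      then show ?thesis using d1 by simp
    next
      case False
      then have "d 1 * 2 \<le> x" using d(2,3)[of 1] that by simp
      then show ?thesis using d1 pos by simp
    qed
    have s0: "speed (Suc t) (d 0) f" by (rule speed_mono[OF speed_up[OF se] d(5)])
    then have s1: "speed (Suc t) (d 1) f" by (rule speed_mono) (use d1 in linarith)
    \<comment> \<open>Running down \<open>d 0\<close> takes until \<open>f (Suc t)\<close>, and
      \<open>d 1\<close> then takes until \<open>f\<close> of that. The value after the step, twice
      the top base minus \<open>1\<close>, is at least this sum.\<close>
    have "lasts (Suc t) (d 1 + d 0) (f (f (Suc t)))"
    proof (rule lasts_add[OF speed_lasts[OF s0] _ _ g1 s1 0(3)])
      show "d 1 \<in> BB (Suc t)" using d(1)[of 1] d(4) unfolding gap_def by (cases t) auto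
      show "d 0 < d 1" using d1 pos by simp
    qed
    moreover have "f (f t) \<le> f (f (Suc t))" by (rule infl_monoD[OF 0(3) infl_monoD[OF 0(3)]]) simp
    ultimately have "lasts (Suc t) (d 1 + d 0) (f (f t))" by (rule lasts_antimono)
    then have "lasts (Suc t) (up t (e * 2) - 1) (f (f t))"
      by (rule lasts_mono) (use d(6) d1t d1 pos in simp)
    moreover have "0 < e * 2" using e(1) BB_pos[of e "i + k"] by (simp add: gap_def)
    ultimately have "lasts t (e * 2) (f (f t))" by (rule lasts_step[rotated])
    then show "lasts (i + k) (track i (b * (0 + 2)) k) (Phi 0 f (i + k))"
      by (simp only: t_def add_0 Phi.simps comp_apply e(2))
  qed
next
  case (Suc m)
  note IH = Suc.IH and prems = Suc.prems
  show ?case unfolding speed_def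
  proof
    fix k
    let ?a = "m + 3"
    have g: "gap i b ?a" "?a < Inf B0 + i" using prems by (simp_all add: numeral_3_eq_3 add.commute)
    obtain e where e: "gap (i + k) e ?a" "track i (b * ?a) k = e * ?a" "track i b k \<le> e"
      by (rule gap_track[OF g(1) _ g(2), of k]) auto
    define t where "t = i + k"
    have se: "speed t e f" unfolding t_def by (rule speed_mono[OF speed_track[OF prems(4)] e(3)])
    have ta: "2 \<le> ?a" "?a < Inf B0 + t" using g(2) by (simp_all add: t_def)
    obtain d where d: "\<And>j. j \<le> t \<Longrightarrow> gap (Suc t) (d j) (?a - 1)" "\<And>j. j \<le> t \<Longrightarrow> d (Suc j) = d j * ?a"
      "gap (Suc t) (d (Suc t)) ?a" "up t e \<le> d 0" "up t (e * ?a) = d (Suc t) * ?a"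
      by (rule gap_critical[OF e(1)[folded t_def] ta]) blast
    have gd: "gap (Suc t) (d j) (m + 2)" if "j \<le> Suc t" for j
    proof (cases "j = Suc t")
      case True then show ?thesis using gap_mono[OF d(3), of "m + 2"] by simp
    next
      case False then show ?thesis using d(1)[of j] that by simp
    qed
    have I: "infl ((Phi m ^^ j) f)" for j by (rule infl_Phi_funpow[OF prems(3)])
    have step: "speed (Suc t) (d j * (m + 2)) ((Phi m ^^ Suc j) f)" if "j \<le> Suc t" "speed (Suc t) (d j) ((Phi m ^^ j) f)" for j
      using IH[OF gd[OF that(1)] _ I that(2)] ta by simp
    \<comment> \<open>The base \<open>d (Suc j) = d j * (m + 3)\<close> is above
      \<open>d j * (m + 2)\<close>, to which the induction hypothesis applies. So each link of the
      chain gains one application of \<open>Phi m\<close>.\<close>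
    have sd: "speed (Suc t) (d j) ((Phi m ^^ j) f)" if "j \<le> Suc t" for j using that
    proof (induction j)
      case 0 show ?case using speed_mono[OF speed_up[OF se] d(4)] by simp
    next
      case (Suc j)
      then have "speed (Suc t) (d j * (m + 2)) ((Phi m ^^ Suc j) f)" by (intro step) auto
      then show ?case by (rule speed_mono) (use d(2)[of j] Suc in \<open>simp add: algebra_simps\<close>)
    qed
    \<comment> \<open>Subtracting \<open>1\<close> from \<open>d (Suc t) * (m + 3)\<close> leaves at
      least the multiple by \<open>m + 2\<close>. The last link thus gives application number
      \<open>t + 2\<close>, as the definition of \<open>Phi (Suc m) f t\<close> requires.\<close>
    have "lasts (Suc t) (d (Suc t) * (m + 2)) ((Phi m ^^ Suc (Suc t)) f (Suc t))"
      by (rule speed_lasts[OF step[OF order_refl sd[OF order_refl]]])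
    moreover have "Phi (Suc m) f t \<le> (Phi m ^^ Suc (Suc t)) f (Suc t)"
      using infl_monoD[OF I, of t "Suc t" "Suc (Suc t)"] by (simp only: Phi.simps add_2_eq_Suc' le_SucI order_refl)
    ultimately have "lasts (Suc t) (d (Suc t) * (m + 2)) (Phi (Suc m) f t)" by (rule lasts_antimono)
    moreover have "2 \<le> d (Suc t)" using d(3) BB_pos unfolding gap_def by blast
    ultimately have "lasts (Suc t) (up t (e * ?a) - 1) (Phi (Suc m) f t)"
      by (elim lasts_mono) (simp only: d(5), simp add: algebra_simps)
    moreover have "0 < e * ?a" using e(1) BB_pos[of e "i + k"] by (simp add: gap_def)
    ultimately have "lasts t (e * ?a) (Phi (Suc m) f t)" by (rule lasts_step[rotated])
    moreover have "Suc m + 2 = ?a" by simp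
    ultimately show "lasts (i + k) (track i (b * (Suc m + 2)) k) (Phi (Suc m) f (i + k))"
      using e(2) unfolding t_def by metis
  qed
qed

lemma speed_Suc: assumes "1 \<le> n" shows "speed i n Suc"
  unfolding speed_def
proof
  fix k
  have "1 \<le> track i n k" using assms by (induction k) (auto intro: order_trans[OF _ up_ge])
  moreover have "lasts (Suc (i + k)) (up (i + k) (track i n k) - 1) (Suc (i + k))" by (rule lasts_le) simp
  ultimately show "lasts (i + k) (track i n k) (Suc (i + k))" by (intro lasts_step[of "track i n k"]) auto
qed

text \<open>The upgrade is strictly increasing, so a surplus of \<open>k\<close> shrinks by at most
  \<open>1\<close> in each step. After \<open>k\<close> steps the value is still at least the
  undisturbed upgrade of \<open>n\<close>.\<close>

lemma lasts_delay: "lasts (i + k) (track i n k) t \<Longrightarrow> lasts i (n + k) t"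
proof (induction k arbitrary: i n)
  case (Suc k)
  have "lasts (Suc i + k) (track (Suc i) (up i n) k) t"
    unfolding track_shift using Suc.prems by simp
  then have "lasts (Suc i) (up i n + k) t" by (rule Suc.IH)
  moreover have "up i n + k \<le> up i (n + k)"
  proof (induction k)
    case (Suc k) then show ?case using up_less[of "n + k" "n + Suc k" i] by simp
  qed simp
  moreover have "up i (n + k) \<le> up i (n + Suc k) - 1" using up_less[of "n + k" "n + Suc k" i] by simp
  ultimately have "lasts (Suc i) (up i (n + Suc k) - 1) t" by (meson lasts_mono order_trans)
  then show ?case by (rule lasts_step[rotated]) simp
qed simp

theorem lasts_Phi:
  assumes g: "gap 0 b (Inf B0)" shows "lasts 0 (b * Inf B0 + k) (Phi k Suc k)"
proof -
  let ?m = "Inf B0"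
  have m2: "2 \<le> ?m" using ouro.mu(2)[OF ouro_BB, of 0] by simp
  have tr: "\<exists>e. gap k e (?m + k) \<and> e * (?m + k) \<le> track 0 (b * ?m) k" for k
  proof (induction k)
    case 0 then show ?case using g by auto
  next
    case (Suc k)
    then obtain e where e: "gap k e (?m + k)" "e * (?m + k) \<le> track 0 (b * ?m) k" by blast
    obtain d where "d \<in> BB (Suc k)" "d * (?m + k + 1) \<le> up k (e * (?m + k))"
      "\<And>x. x \<in> BB (Suc k) \<Longrightarrow> d < x \<Longrightarrow> d * (?m + k + 1) < x"
      by (rule up_top[of e k]) (use e(1) in \<open>auto simp: gap_def\<close>)
    then show ?case using up_mono[OF e(2), of k] by (intro exI[of _ d]) (auto simp: gap_def)
  qed
  obtain e where e: "gap k e (?m + k)" "e * (?m + k) \<le> track 0 (b * ?m) k" using tr by blast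
  \<comment> \<open>One more step is made because \<open>speed_Phi\<close> wants the factor to be
    below the minimum. At time \<open>k + 1\<close> the minimum is \<open>?m + k + 1\<close>, and
    subtracting \<open>1\<close> lowers the factor to \<open>?m + k\<close>.\<close>
  obtain d where d: "d \<in> BB (Suc k)" "d * (?m + k + 1) \<le> up k (e * (?m + k))"
      "\<And>x. x \<in> BB (Suc k) \<Longrightarrow> d < x \<Longrightarrow> d * (?m + k + 1) < x"
      by (rule up_top[of e k]) (use e(1) in \<open>auto simp: gap_def\<close>)
  define j where "j = ?m + k - 2"
  have j: "j + 2 = ?m + k" "k \<le> j" using m2 by (simp_all add: j_def)
  have d2: "2 \<le> d" using d(1) BB_pos by blast
  have "gap (Suc k) d (?m + k + 1)" using d by (simp add: gap_def)
  then have "gap (Suc k) d (j + 2)" by (rule gap_mono) (use j in linarith)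
  then have "speed (Suc k) (d * (j + 2)) (Phi j Suc)"
    by (rule speed_Phi) (use infl_Suc speed_Suc[of d] d2 j in auto)
  then have "lasts (Suc k) (d * (j + 2)) (Phi j Suc (Suc k))" by (rule speed_lasts)
  moreover have "d * (j + 2) \<le> up k (e * (?m + k)) - 1" using d(2) d2 j by simp
  moreover have "Phi k Suc k \<le> Phi j Suc (Suc k)"
    using Phi_index_mono[OF infl_Suc j(2), of k] infl_monoD[OF infl_Phi[OF infl_Suc], of k "Suc k" j] by simp
  ultimately have "lasts (Suc k) (up k (e * (?m + k)) - 1) (Phi k Suc k)" by (meson lasts_mono lasts_antimono)
  moreover have "0 < e * (?m + k)" using e(1) BB_pos[of e k] m2 by (simp add: gap_def)
  ultimately have "lasts k (e * (?m + k)) (Phi k Suc k)" by (rule lasts_step[rotated])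
  then have "lasts (0 + k) (track 0 (b * ?m) k) (Phi k Suc k)" using e(2) by (simp add: lasts_mono)
  then show ?thesis by (rule lasts_delay)
qed

end

section \<open>Upper bounds for upgrades\<close>

text \<open>Bounds \<open>c ^ e * a + r\<close> when \<open>c\<close>, \<open>e\<close>,
  \<open>a\<close> and \<open>r\<close> are at most \<open>x\<close>. The base \<open>x + 1\<close>
  is positive, so larger exponents give larger powers.\<close>

definition tow :: "nat \<Rightarrow> nat" where "tow x = (x + 1) ^ x * x + x"

lemma infl_tow: "infl tow"
proof (rule inflI)
  fix x y :: nat assume "x \<le> y"
  then have "(x + 1) ^ x \<le> (y + 1) ^ x" by (intro power_mono) auto
  also have "\<dots> \<le> (y + 1) ^ y" using \<open>x \<le> y\<close> by (intro power_increasing) auto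
  finally show "tow x \<le> tow y" unfolding tow_def using \<open>x \<le> y\<close> by (intro add_mono mult_mono) auto
qed (simp add: tow_def)

lemma tow_double: "x + x \<le> tow x"
  using mult_le_mono1[of 1 "(x + 1) ^ x" x] by (simp add: tow_def)

lemma tame_growth_tow: "tame_growth tow"
  unfolding tow_def by (intro tame_growth_intros)

text \<open>The recursion has depth at most \<open>m\<close>, and each level costs one application
  of \<open>tow\<close>.\<close>

lemma change_le:
  assumes "\<And>k w. k < b \<Longrightarrow> k \<le> m \<Longrightarrow> u k = enat w \<Longrightarrow> w \<le> X" "c \<le> X" "change u b c m = enat v"
  shows "v \<le> (tow ^^ m) X"
  using assms(1,3)
proof (induction m arbitrary: v rule: less_induct)
  case (less m)
  show ?case
  proof (cases "m < b \<or> b < 2")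
    case True
    then have "u m = enat v" "m < b" using less(3) by (auto simp: change.simps[of u b c m] split: if_splits)
    then have "v \<le> X" using less(2) by blast
    also have "X \<le> (tow ^^ m) X" by (rule infl_le[OF infl_funpow[OF infl_tow]])
    finally show ?thesis .
  next
    case False
    then have b: "2 \<le> b" "b \<le> m" by auto
    note d = decomp_props[OF b]
    define e where "e = (GREATEST e. b ^ e \<le> m)"
    note d = d[folded e_def]
    have "change u b c m = (case (change u b c e, u (m div b ^ e), change u b c (m mod b ^ e)) of
          (enat e', enat a', enat r') \<Rightarrow> enat (c ^ e' * a' + r')
        | _ \<Rightarrow> \<infinity>)"
      using b by (subst change.simps) (simp add: Let_def e_def)
    then obtain e' a' r' where v: "change u b c e = enat e'" "u (m div b ^ e) = enat a'" "change u b c (m mod b ^ e) = enat r'"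
      "v = c ^ e' * a' + r'" using less(3) by (auto split: enat.splits)
    define Z where "Z = (tow ^^ (m - 1)) X"
    have up: "(tow ^^ k) X \<le> Z" if "k < m" for k
      unfolding Z_def using that by (intro funpow_infl_mono infl_tow) auto
    have XZ: "X \<le> Z" using up[of 0] b by simp
    have "e' \<le> Z" using less.IH[OF d(2) _ v(1)] less(2) d(2) up[OF d(2)] by (meson less_imp_le order_trans)
    moreover have "r' \<le> Z" using less.IH[OF d(6) _ v(3)] less(2) d(6) up[OF d(6)] by (meson less_imp_le order_trans)
    moreover have "a' \<le> Z" using less(2)[OF d(4) _ v(2)] XZ by (meson div_le_dividend order_trans)
    moreover have "c ^ e' \<le> (Z + 1) ^ Z"
    proof -
      have "c ^ e' \<le> (Z + 1) ^ e'" using assms(2) XZ by (intro power_mono) auto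
      also have "\<dots> \<le> (Z + 1) ^ Z" using \<open>e' \<le> Z\<close> by (intro power_increasing) auto
      finally show ?thesis .
    qed
    ultimately have "v \<le> tow Z" unfolding v(4) tow_def by (intro add_mono mult_mono) auto
    also have "tow Z = (tow ^^ m) X" unfolding Z_def using b by (cases m) auto
    finally show ?thesis .
  qed
qed

text \<open>For positive \<open>m\<close>, the upgrades of the digits cost
  \<open>(m - 1) * (m - 1)\<close> applications of \<open>tow\<close> and the change of base another
  \<open>m\<close>; together this is at most \<open>m * m\<close>.\<close>

lemma upgrade_le:
  assumes B: "B \<noteq> {}" "0 \<notin> B" and C: "\<And>x. x \<in> C \<Longrightarrow> x \<le> Y"
  shows "upgrade B C m = enat w \<Longrightarrow> w \<le> (tow ^^ (m * m)) (Y + m)"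
proof (induction m arbitrary: w rule: less_induct)
  case (less m)
  from less(2)[THEN upgrade_iff[OF B, THEN iffD1]] consider "w = m"
    | b c where "Inf B \<le> m" "b = base_of B m" "c \<in> C" "change (upgrade B C) b c m = enat w"
    unfolding rmin_iff[OF B(1)] rbase_iff[OF B(1)] radm_def by blast
  then show ?case
  proof cases
    case 1
    then have "w \<le> Y + m" by simp
    also have "\<dots> \<le> (tow ^^ (m * m)) (Y + m)" by (rule infl_le[OF infl_funpow[OF infl_tow]])
    finally show ?thesis .
  next
    case 2
    then have bm: "b \<le> m" using base_of_le[OF B(1)] by simp
    define X where "X = (tow ^^ ((m - 1) * (m - 1))) (Y + m)"
    have "v \<le> X" if "k < b" "upgrade B C k = enat v" for k v
    proof -
      have "v \<le> (tow ^^ (k * k)) (Y + k)" using less.IH[of k v] that bm by simp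
      also have "\<dots> \<le> X" unfolding X_def using that(1) bm
        by (intro funpow_infl_mono infl_tow mult_mono) auto
      finally show ?thesis .
    qed
    moreover have "c \<le> X"
      using C[OF 2(3)] infl_le[OF infl_funpow[OF infl_tow], of "Y + m" "(m - 1) * (m - 1)"] unfolding X_def by simp
    ultimately have "w \<le> (tow ^^ m) X" by (intro change_le[OF _ _ 2(4)])
    also have "\<dots> = (tow ^^ (m + (m - 1) * (m - 1))) (Y + m)" by (simp add: X_def funpow_add)
    also have "\<dots> \<le> (tow ^^ (m * m)) (Y + m)"
      by (intro funpow_infl_mono infl_tow) (cases m; simp)+
    finally show ?thesis .
  qed
qed

lemma iterates_le:
  assumes "\<And>d v. f d = enat v \<Longrightarrow> v \<le> (tow ^^ m) (max d X)"
  shows "iter f c j = enat v \<Longrightarrow> v \<le> (tow ^^ (m * j)) (max c X)"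
proof (induction j arbitrary: v)
  case (Suc j)
  then obtain d where d: "iter f c j = enat d" "f d = enat v" by (auto split: enat.splits)
  let ?z = "(tow ^^ (m * j)) (max c X)"
  have "max c X \<le> ?z" by (rule infl_le[OF infl_funpow[OF infl_tow]])
  then have "max d X \<le> ?z" using Suc.IH[OF d(1)] by simp
  then have "v \<le> (tow ^^ m) ?z"
    using assms[OF d(2)] funpow_infl_mono[OF infl_tow order_refl, of "max d X" ?z m] by (meson order_trans)
  then show ?case by (simp add: funpow_add)
qed simp

text \<open>Reaching stage \<open>N\<close> from the stage before costs
  \<open>1 + N * (i + 1) + N * N\<close> applications of \<open>tow\<close>: \<open>N * N\<close>
  for the upgrades, \<open>N * (i + 1)\<close> for the change of base and its iterates, and one to
  absorb the summand \<open>N\<close>.\<close>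

lemma stage_le:
  assumes B: "B \<noteq> {}" "0 \<notin> B"
  shows "x \<in> stage B i n \<Longrightarrow> x \<le> (tow ^^ (n * (1 + n * (i + 1) + n * n))) (Inf B + 1 + n)"
proof (induction n arbitrary: x)
  case 0 then show ?case by simp
next
  case (Suc n)
  define Y where "Y = (tow ^^ (n * (1 + n * (i + 1) + n * n))) (Inf B + 1 + n)"
  let ?N = "Suc n" and ?C = "stage B i n"
  define X where "X = (tow ^^ (?N * ?N)) (Y + ?N)"
  have IH: "x \<le> Y" if "x \<in> ?C" for x using Suc.IH[OF that] by (simp add: Y_def)
  have YX: "Y \<le> X" using infl_le[OF infl_funpow[OF infl_tow], of "Y + ?N" "?N * ?N"] by (simp add: X_def)
  have ug: "w \<le> X" if "upgrade B ?C k = enat w" "k \<le> ?N" for k w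
  proof -
    have "w \<le> (tow ^^ (k * k)) (Y + k)" by (rule upgrade_le[OF B IH that(1)])
    also have "\<dots> \<le> X" unfolding X_def using that(2) by (intro funpow_infl_mono infl_tow mult_mono) auto
    finally show ?thesis .
  qed
  have ch: "v \<le> (tow ^^ m) (max d X)" if "change (upgrade B ?C) b d m = enat v" "m \<le> ?N" for b d m v
    by (rule change_le[OF _ _ that(1)]) (use ug that(2) in \<open>auto simp: le_max_iff_disj\<close>)
  have mx: "Max ?C \<le> X" using IH[OF Max_in[OF stage_fin(1,2)]] YX by simp
  define Z where "Z = (tow ^^ (?N * (i + 1))) X"
  have lift: "(tow ^^ k) X \<le> Z" if "k \<le> ?N * (i + 1)" for k
    unfolding Z_def using that by (intro funpow_infl_mono infl_tow) auto
  have XZ: "X \<le> Z" using lift[of 0] by simp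
  have "x \<le> Z"
  proof -
    consider "x = Inf B + 1" | "x \<in> ?C"
      | a where "x = Max ?C * a" "change (upgrade B ?C) (base_of B n) (Max ?C) n < enat x"
         "\<forall>a'<a. \<not> change (upgrade B ?C) (base_of B n) (Max ?C) n < enat (Max ?C * a')"
      | j where "1 \<le> j" "j \<le> i" "iter (\<lambda>d. change (upgrade B ?C) (base_of B (Suc n)) d (Suc n)) (Max ?C) j = enat x"
      using Suc.prems by (auto simp: Let_def split: if_splits)
    then show ?thesis
    proof cases
      case 1
      have "Inf B + 1 \<le> Y" unfolding Y_def
        by (rule order_trans[OF _ infl_le[OF infl_funpow[OF infl_tow]]]) simp
      then show ?thesis using 1 YX XZ by simp
    next
      case 2 then show ?thesis using IH YX XZ by (meson order_trans)
    next
      case 3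
      obtain v where v: "change (upgrade B ?C) (base_of B n) (Max ?C) n = enat v" using 3(2) by (cases "change (upgrade B ?C) (base_of B n) (Max ?C) n") auto
      have "0 < a" using 3 v by (cases a) auto
      then have "\<not> v < Max ?C * (a - 1)" using 3(3) v by auto
      then have "x \<le> v + Max ?C" using 3(1) \<open>0 < a\<close> by (cases a) auto
      moreover have "v \<le> (tow ^^ n) X" using ch[OF v] mx by (simp add: max_absorb2)
      moreover have "X \<le> (tow ^^ n) X" by (rule infl_le[OF infl_funpow[OF infl_tow]])
      ultimately have "x \<le> (tow ^^ n) X + (tow ^^ n) X" using mx by simp
      also have "\<dots> \<le> (tow ^^ ?N) X" using tow_double by simp
      also have "\<dots> \<le> Z" by (rule lift) simp
      finally show ?thesis .
    next
      case 4
      have "x \<le> (tow ^^ (?N * j)) (max (Max ?C) X)"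
        by (rule iterates_le[OF _ 4(3)]) (use ch in blast)
      also have "\<dots> \<le> Z" using lift[OF mult_le_mono2[of j "i + 1" ?N]] 4(2) mx by (simp only: max_absorb2 trans_le_add1)
      finally show ?thesis .
    qed
  qed
  also have "Z \<le> (tow ^^ (?N * (i + 1) + ?N * ?N)) (Y + ?N)" by (simp only: Z_def X_def funpow_add comp_apply order_refl)
  also have "\<dots> \<le> (tow ^^ (?N * (i + 1) + ?N * ?N)) (tow Y)"
  proof (rule infl_monoD[OF infl_funpow[OF infl_tow]])
    have "?N \<le> Y" unfolding Y_def
      by (rule order_trans[OF _ infl_le[OF infl_funpow[OF infl_tow]]]) simp
    then show "Y + ?N \<le> tow Y" using tow_double[of Y] by simp
  qed
  also have "\<dots> = (tow ^^ (?N * (i + 1) + ?N * ?N + 1 + n * (1 + n * (i + 1) + n * n))) (Inf B + 1 + n)"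
    by (simp only: Y_def funpow_add comp_apply One_nat_def funpow.simps id_apply)
  also have "\<dots> \<le> (tow ^^ (?N * (1 + ?N * (i + 1) + ?N * ?N))) (Inf B + 1 + ?N)"
    by (intro funpow_infl_mono infl_tow) (auto simp: algebra_simps)
  finally show ?case .
qed

text \<open>Gives a bound for the base chosen in the description of the upgrade, in terms of the
  value.\<close>

lemma change_ge:
  assumes u: "\<And>k. 0 < k \<Longrightarrow> 0 < u k" and b: "2 \<le> b" "b \<le> m" and v: "change u b c m = enat v" shows "c \<le> v"
proof (cases "c = 0")
  case False
  note d = decomp_props[OF b]
  define e where "e = (GREATEST e. b ^ e \<le> m)"
  note d = d[folded e_def]
  have "change u b c m = (case (change u b c e, u (m div b ^ e), change u b c (m mod b ^ e)) of
          (enat e', enat a', enat r') \<Rightarrow> enat (c ^ e' * a' + r')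
        | _ \<Rightarrow> \<infinity>)"
    using b by (subst change.simps) (simp add: Let_def e_def)
  then obtain e' a' r' where w: "change u b c e = enat e'" "u (m div b ^ e) = enat a'"
      "v = c ^ e' * a' + r'" using v by (auto split: enat.splits)
  have "0 < e'" using change_pos[of u c e b] u d(1) False w(1) by (simp add: zero_enat_def)
  then have "c \<le> c ^ e'" using False by (intro self_le_power) auto
  moreover have "0 < a'" using u[OF d(3)] w(2) by (simp add: zero_enat_def)
  ultimately have "c \<le> c ^ e' * a'" by (metis One_nat_def Suc_leI le_trans mult.right_neutral mult_le_mono2)
  then show ?thesis using w by simp
qed simp

definition bound_stage :: "nat \<Rightarrow> nat \<Rightarrow> nat" where
  "bound_stage \<mu> y = (tow ^^ (y * (1 + y * (y + 2) + y * y))) (\<mu> + y + 1 + y)"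
definition bound_upgrade :: "nat \<Rightarrow> nat \<Rightarrow> nat" where
  "bound_upgrade \<mu> y = (tow ^^ (y * y)) (bound_stage \<mu> y + y)"
text \<open>The summands are for different quantifiers: iterated \<open>tow\<close> for changes of
  base and for the chain, the power for decompositions, where exponents up to \<open>e + 1\<close>
  occur, and the rest for the minima of the hierarchies.\<close>

definition bound_all :: "nat \<Rightarrow> nat \<Rightarrow> nat" where
  "bound_all \<mu> y = (tow ^^ (y * y + y)) (bound_upgrade \<mu> y + y) + (y + 1) ^ (y + 1) + \<mu> + y + 1"

lemma tame_growth_bound_all: "tame_growth (bound_all \<mu>)"
  unfolding bound_all_def bound_upgrade_def bound_stage_def
  by (intro tame_growth_intros tame_growth_tow infl_tow)

context process
begin

lemma BB_ok: "BB i \<noteq> {}" "0 \<notin> BB i"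
  using ouro.B[OF ouro_BB, of i] by simp_all

lemma stage_bound:
  assumes "i \<le> y" "n \<le> y" "x \<in> stage (BB i) (Suc i) n" shows "x \<le> bound_stage (Inf B0) y"
proof -
  have "x \<le> (tow ^^ (n * (1 + n * (Suc i + 1) + n * n))) (Inf (BB i) + 1 + n)"
    by (rule stage_le[OF BB_ok assms(3)])
  also have "\<dots> \<le> bound_stage (Inf B0) y" unfolding bound_stage_def Inf_BB
  proof (rule funpow_infl_mono[OF infl_tow])
    show "n * (1 + n * (Suc i + 1) + n * n) \<le> y * (1 + y * (y + 2) + y * y)"
    proof -
      have "n * (Suc i + 1) \<le> y * (y + 2)" "n * n \<le> y * y" using assms(1,2) by (simp_all only: mult_le_mono add_2_eq_Suc' Suc_eq_plus1[symmetric] Suc_le_mono)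
      then show ?thesis using assms(2) by (intro mult_le_mono) auto
    qed
  qed (use assms(1,2) in simp)
  finally show ?thesis .
qed

lemma upgrade_stage_bound:
  assumes "i \<le> y" "n \<le> y" "m \<le> y" "upgrade (BB i) (stage (BB i) (Suc i) n) m = enat w"
  shows "w \<le> bound_upgrade (Inf B0) y"
proof -
  have "w \<le> (tow ^^ (m * m)) (bound_stage (Inf B0) y + m)"
    by (rule upgrade_le[OF BB_ok stage_bound[OF assms(1,2)] assms(4)])
  also have "\<dots> \<le> bound_upgrade (Inf B0) y" unfolding bound_upgrade_def using assms(3)
    by (intro funpow_infl_mono infl_tow mult_mono add_mono) auto
  finally show ?thesis .
qed

text \<open>\<open>upgrade_le\<close> needs a bounded target. The upgrade of \<open>m\<close> into
  stage \<open>m\<close> has the same value as the one into the whole successor.\<close>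

lemma upgrade_bound:
  assumes "i \<le> y" "m \<le> y" "upgrade (BB i) (BB (Suc i)) m = enat w"
  shows "w \<le> bound_upgrade (Inf B0) y"
proof -
  have "upgrade (BB i) (stage (BB i) (Suc i) m) m = upgrade (BB i) (BB (Suc i)) m"
    using ouro.upgrade_stage_h[OF ouro_BB, of i m] by (simp add: upgrade_up h_eq_up)
  then show ?thesis using upgrade_stage_bound[OF assms(1,2,2)] assms(3) by simp
qed

lemma bound_upgrade_le: "bound_upgrade (Inf B0) y \<le> bound_all (Inf B0) y"
proof -
  have "bound_upgrade (Inf B0) y + y \<le> (tow ^^ (y * y + y)) (bound_upgrade (Inf B0) y + y)"
    by (rule infl_le[OF infl_funpow[OF infl_tow]])
  then show ?thesis by (simp add: bound_all_def)
qed

lemma bound_stage_le_upgrade: "bound_stage (Inf B0) y \<le> bound_upgrade (Inf B0) y"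
proof -
  have "bound_stage (Inf B0) y + y \<le> bound_upgrade (Inf B0) y"
    unfolding bound_upgrade_def by (rule infl_le[OF infl_funpow[OF infl_tow]])
  then show ?thesis by simp
qed

lemma change_bound:
  assumes "c \<le> y" "m \<le> y" "\<And>k w. k \<le> y \<Longrightarrow> u k = enat w \<Longrightarrow> w \<le> bound_upgrade (Inf B0) y"
    "change u b c m = enat v"
  shows "v \<le> bound_all (Inf B0) y"
proof -
  have "v \<le> (tow ^^ m) (bound_upgrade (Inf B0) y + y)"
  proof (rule change_le[OF _ _ assms(4)])
    fix k w assume "k \<le> m" "u k = enat w"
    then show "w \<le> bound_upgrade (Inf B0) y + y" using assms(2) assms(3)[of k w] by simp
  qed (use assms(1) in simp)
  also have "\<dots> \<le> (tow ^^ (y * y + y)) (bound_upgrade (Inf B0) y + y)"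
    using assms(2) by (intro funpow_infl_mono infl_tow) auto
  finally show ?thesis by (simp add: bound_all_def)
qed

lemma Dg_bound:
  assumes "i \<le> y" "n \<le> y" "j \<le> y" "Dg (BB i) (Suc i) n j d" shows "d \<le> bound_all (Inf B0) y"
proof -
  obtain n' where n: "n = n' + 1" "it (BB i) (Suc i) n j = enat d" using assms(4) by (auto simp: Dg_def)
  let ?C = "stage (BB i) (Suc i) n'"
  let ?X = "bound_upgrade (Inf B0) y"
  have mx: "Max ?C \<le> ?X"
  proof -
    have "Max ?C \<in> ?C" using stage_fin(1,2) by (rule Max_in)
    then show ?thesis
      using stage_bound[OF assms(1), of n' "Max ?C"] assms(2) n(1) bound_stage_le_upgrade[of y] by simp
  qed
  have "d \<le> (tow ^^ (n * j)) (max (Max ?C) ?X)"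
  proof (rule iterates_le)
    show "iter (\<lambda>d. change (upgrade (BB i) ?C) (base_of (BB i) n) d n) (Max ?C) j = enat d"
      using n by simp
    show "v \<le> (tow ^^ n) (max d ?X)" if "change (upgrade (BB i) ?C) (base_of (BB i) n) d n = enat v" for d v
    proof (rule change_le[OF _ _ that])
      fix k w assume "k \<le> n" "upgrade (BB i) ?C k = enat w"
      then show "w \<le> max d ?X" using upgrade_stage_bound[OF assms(1), of n' k w] assms(2) n(1) by simp
    qed simp
  qed
  also have "\<dots> = (tow ^^ (n * j)) ?X" using mx by (simp add: max_absorb2)
  also have "\<dots> \<le> (tow ^^ (y * y + y)) (?X + y)"
    using assms(2,3) mult_le_mono[of n y j y] by (intro funpow_infl_mono infl_tow) auto
  finally show ?thesis by (simp add: bound_all_def)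
qed

end

section \<open>Witnesses for the formula describing the process\<close>

text \<open>Forgets the variables that are bound between the depths \<open>k\<close> and \<open>k'\<close>.\<close>

definition dr :: "nat \<Rightarrow> nat \<Rightarrow> (nat \<Rightarrow> nat) \<Rightarrow> nat \<Rightarrow> nat" where
  "dr k k' v = (\<lambda>n. v (n + (k' - k)))"

lemma dr_Suc[simp]: "k \<le> k' \<Longrightarrow> dr k (Suc k') (case_nat x v) = dr k k' v"
  unfolding dr_def by (rule ext) (simp add: Suc_diff_le)

lemma dr_self[simp]: "dr k k v = v" by (simp add: dr_def)

lemma dr_dr[simp]: "k \<le> k1 \<Longrightarrow> k1 \<le> k' \<Longrightarrow> dr k k1 (dr k1 k' v) = dr k k' v"
  unfolding dr_def by (rule ext) (simp add: add.assoc)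

lemma dr_bound: "\<forall>j<k'. v j \<le> y \<Longrightarrow> k \<le> k' \<Longrightarrow> \<forall>j<k. dr k k' v j \<le> y"
  unfolding dr_def by auto

text \<open>A term, as a function of the depth, that denotes a variable bound outside depth \<open>k\<close>.\<close>

definition arg :: "nat \<Rightarrow> tm \<Rightarrow> bool" where
  "arg k t \<longleftrightarrow> (\<forall>k' v. k \<le> k' \<longrightarrow> evt v (t k') = evt (dr k k' v) (t k)) \<and>
     (\<forall>v y. (\<forall>j<k. v j \<le> y) \<longrightarrow> evt v (t k) \<le> y)"

lemma arg_var: "k0 < k \<Longrightarrow> arg k (\<lambda>k'. Var (k' - Suc k0))"
  unfolding arg_def dr_def by (auto intro!: arg_cong[where f="\<lambda>n. v n" for v])

lemma arg_mono: assumes "arg k t" "k \<le> k1" shows "arg k1 t"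
  unfolding arg_def
proof (intro conjI allI HOL.impI)
  fix k' v assume "k1 \<le> k'"
  then show "evt v (t k') = evt (dr k1 k' v) (t k1)"
    using assms unfolding arg_def by (metis dr_dr le_trans)
next
  fix v y assume "\<forall>j<k1. v j \<le> (y::nat)"
  then show "evt v (t k1) \<le> y" using assms dr_bound[of k1 v y k] unfolding arg_def by metis
qed

lemma arg_Suc: "arg k t \<Longrightarrow> evt (case_nat x v) (t (Suc k)) = evt v (t k)"
  unfolding arg_def by (metis dr_Suc dr_self le_Suc_eq order_refl)

lemma arg_Suc2: "arg k t \<Longrightarrow> evt (case_nat x (case_nat y v)) (t (Suc (Suc k))) = evt v (t k)"
  using arg_Suc arg_mono le_SucI order_refl by metis

lemma arg_le: "arg k t \<Longrightarrow> \<forall>j<k. v j \<le> y \<Longrightarrow> evt v (t k) \<le> y"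
  unfolding arg_def by blast

lemma arg_dr: "arg k t \<Longrightarrow> k \<le> k' \<Longrightarrow> evt (dr k k' v) (t k) = evt v (t k')"
  unfolding arg_def by metis

abbreviation pow :: "nat \<Rightarrow> nat \<Rightarrow> nat \<Rightarrow> bool" where "pow \<equiv> (\<lambda>c e v. v = c ^ e)"

text \<open>The setting inside the prefix of set quantifiers: \<open>l\<close> of them are in scope,
  \<open>E\<close> denotes the true exponentiation, and witnesses are sought below
  \<open>P\<close>.\<close>

locale frame =
  fixes V :: "nat \<Rightarrow> nat set" and P :: "nat \<Rightarrow> nat" and l :: nat and E :: sv
  assumes P_exp: "(y + 1) ^ (y + 1) \<le> P y"
    and E_iff: "c \<rhd> e \<rhd> v \<in> V (E l) \<longleftrightarrow> v = c ^ e"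
begin

lemma P_gt: "y < P y"
proof -
  have "y + 1 \<le> (y + 1) ^ (y + 1)" by (rule self_le_power) auto
  then show ?thesis using P_exp[of y] by simp
qed

lemma P_ge: "x \<le> y \<Longrightarrow> x \<le> P y" using P_gt[of y] by simp

lemma P_pow: assumes "c \<le> y" "e \<le> y + 1" shows "c ^ e \<le> P y"
proof -
  have "c ^ e \<le> (y + 1) ^ e" using assms by (intro power_mono) auto
  also have "\<dots> \<le> (y + 1) ^ (y + 1)" using assms by (intro power_increasing) auto
  finally show ?thesis using P_exp[of y] by simp
qed

abbreviation tm where "tm k A \<equiv> tame P V k (A k l)"
abbreviation st where "st v k A \<equiv> sat v V (A k l)"

lemma tm_simps[simp]:
  "tame P V k ((s \<^bold>= t) k' l)" "tame P V k ((s \<^bold>< t) k' l)" "tame P V k ((s \<^bold>\<le> t) k' l)" "tame P V k ((t \<^bold>\<in> X) k' l)"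
  "tame P V k ((\<^bold>\<not> A) k' l) = tame P V k (A k' l)"
  "tame P V k ((A \<^bold>\<and> B) k' l) = (tame P V k (A k' l) \<and> tame P V k (B k' l))"
  "tame P V k ((A \<^bold>\<or> B) k' l) = (tame P V k (A k' l) \<and> tame P V k (B k' l))"
  "tame P V k ((A \<^bold>\<longrightarrow> B) k' l) = (tame P V k (A k' l) \<and> tame P V k (B k' l))"
  "tame P V k ((A \<^bold>\<longleftrightarrow> B) k' l) = (tame P V k (A k' l) \<and> tame P V k (B k' l))"
  by (auto simp: eqP_def ltP_def leP_def memP_def notP_def andP_def orP_def impP_def iffP_def conn)

abbreviation bv where "bv k \<equiv> (\<lambda>k'. Var (k' - Suc k))"

lemma tm_allI:
  assumes "tame P V (Suc k) (F (bv k) (Suc k) l)"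
    "\<And>v y w. \<forall>j<k. v j \<le> y \<Longrightarrow> \<not> sat (case_nat w v) V (F (bv k) (Suc k) l) \<Longrightarrow> w \<le> P y"
  shows "tame P V k (allP F k l)"
  unfolding allP_def tame.simps using assms by blast

text \<open>Only some witness has to be small, whereas \<open>tm_exI\<close> asks for all of them.
  The weaker demand is for the union of the stages, since an element belongs to all later stages,
  too.\<close>

lemma tm_exI':
  assumes "tame P V (Suc k) (F (bv k) (Suc k) l)"
    "\<And>v y w. \<forall>j<k. v j \<le> y \<Longrightarrow> sat (case_nat w v) V (F (bv k) (Suc k) l) \<Longrightarrow> \<exists>w\<le>P y. sat (case_nat w v) V (F (bv k) (Suc k) l)"
  shows "tame P V k (exP F k l)"
proof -
  have "\<exists>x\<le>P y. sat (case_nat x v) V (F (bv k) (Suc k) l)"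
    if "\<forall>j<k. v j \<le> y" "\<exists>x. sat (case_nat x v) V (F (bv k) (Suc k) l)" for v y
    using that assms(2) by blast
  then show ?thesis using assms(1) by (simp add: exP_def ExN_def Neg_def)
qed

lemma tm_exI:
  assumes "tame P V (Suc k) (F (bv k) (Suc k) l)"
    "\<And>v y w. \<forall>j<k. v j \<le> y \<Longrightarrow> sat (case_nat w v) V (F (bv k) (Suc k) l) \<Longrightarrow> w \<le> P y"
  shows "tame P V k (exP F k l)"
  by (rule tm_exI'[where F = F]) (use assms in blast)+

lemma tm_intros:
  "tame P V k ((s \<^bold>= t) k' l)" "tame P V k ((s \<^bold>< t) k' l)" "tame P V k ((s \<^bold>\<le> t) k' l)" "tame P V k ((t \<^bold>\<in> X) k' l)"
  "tame P V k (A k' l) \<Longrightarrow> tame P V k ((\<^bold>\<not> A) k' l)"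
  "tame P V k (A k' l) \<Longrightarrow> tame P V k (B k' l) \<Longrightarrow> tame P V k ((A \<^bold>\<and> B) k' l)"
  "tame P V k (A k' l) \<Longrightarrow> tame P V k (B k' l) \<Longrightarrow> tame P V k ((A \<^bold>\<or> B) k' l)"
  "tame P V k (A k' l) \<Longrightarrow> tame P V k (B k' l) \<Longrightarrow> tame P V k ((A \<^bold>\<longrightarrow> B) k' l)"
  "tame P V k (A k' l) \<Longrightarrow> tame P V k (B k' l) \<Longrightarrow> tame P V k ((A \<^bold>\<longleftrightarrow> B) k' l)"
  by simp_all

definition holds :: "nat \<Rightarrow> fm \<Rightarrow> bool" where
  "holds k A \<longleftrightarrow> tame P V k A \<and> (\<forall>v. sat v V A)"

lemma holds_all: "holds (Suc k) (F (bv k) (Suc k) l) \<Longrightarrow> holds k (allP F k l)"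
  unfolding holds_def by (auto simp: allP_def)

lemma holds_and: "holds k (A k' l) \<Longrightarrow> holds k (B k' l) \<Longrightarrow> holds k ((A \<^bold>\<and> B) k' l)"
  unfolding holds_def by simp

subsection \<open>Relations given by formulas\<close>

text \<open>The argument is a term that is evaluated at the depth of use, but hidden parameters are
  read from the assignment at depth \<open>k\<close>, recovered by \<open>dr\<close>. So the formula
  may be placed under any further quantifiers.\<close>

definition rel1 :: "nat \<Rightarrow> (tm \<Rightarrow> pr) \<Rightarrow> ((nat \<Rightarrow> nat) \<Rightarrow> nat \<Rightarrow> bool) \<Rightarrow> bool" where
  "rel1 k R \<rho> \<longleftrightarrow> (\<forall>a k'. tame P V k' (R a k' l)) \<and>
     (\<forall>a v k'. k \<le> k' \<longrightarrow> sat v V (R a k' l) = \<rho> (dr k k' v) (evt v (a k')))"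
definition rel2 :: "nat \<Rightarrow> (tm \<Rightarrow> tm \<Rightarrow> pr) \<Rightarrow> ((nat \<Rightarrow> nat) \<Rightarrow> nat \<Rightarrow> nat \<Rightarrow> bool) \<Rightarrow> bool" where
  "rel2 k R \<rho> \<longleftrightarrow> (\<forall>a b k'. tame P V k' (R a b k' l)) \<and>
     (\<forall>a b v k'. k \<le> k' \<longrightarrow> sat v V (R a b k' l) = \<rho> (dr k k' v) (evt v (a k')) (evt v (b k')))"
definition rel3 :: "nat \<Rightarrow> (tm \<Rightarrow> tm \<Rightarrow> tm \<Rightarrow> pr) \<Rightarrow> ((nat \<Rightarrow> nat) \<Rightarrow> nat \<Rightarrow> nat \<Rightarrow> nat \<Rightarrow> bool) \<Rightarrow> bool" where
  "rel3 k R \<rho> \<longleftrightarrow> (\<forall>a b c k'. tame P V k' (R a b c k' l)) \<and>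
     (\<forall>a b c v k'. k \<le> k' \<longrightarrow> sat v V (R a b c k' l) = \<rho> (dr k k' v) (evt v (a k')) (evt v (b k')) (evt v (c k')))"
definition rel4 :: "nat \<Rightarrow> (tm \<Rightarrow> tm \<Rightarrow> tm \<Rightarrow> tm \<Rightarrow> pr) \<Rightarrow> ((nat \<Rightarrow> nat) \<Rightarrow> nat \<Rightarrow> nat \<Rightarrow> nat \<Rightarrow> nat \<Rightarrow> bool) \<Rightarrow> bool" where
  "rel4 k R \<rho> \<longleftrightarrow> (\<forall>a b c d k'. tame P V k' (R a b c d k' l)) \<and>
     (\<forall>a b c d v k'. k \<le> k' \<longrightarrow> sat v V (R a b c d k' l) =
        \<rho> (dr k k' v) (evt v (a k')) (evt v (b k')) (evt v (c k')) (evt v (d k')))"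
definition rel5 :: "nat \<Rightarrow> (tm \<Rightarrow> tm \<Rightarrow> tm \<Rightarrow> tm \<Rightarrow> tm \<Rightarrow> pr) \<Rightarrow> ((nat \<Rightarrow> nat) \<Rightarrow> nat \<Rightarrow> nat \<Rightarrow> nat \<Rightarrow> nat \<Rightarrow> nat \<Rightarrow> bool) \<Rightarrow> bool" where
  "rel5 k R \<rho> \<longleftrightarrow> (\<forall>a b c d e k'. tame P V k' (R a b c d e k' l)) \<and>
     (\<forall>a b c d e v k'. k \<le> k' \<longrightarrow> sat v V (R a b c d e k' l) =
        \<rho> (dr k k' v) (evt v (a k')) (evt v (b k')) (evt v (c k')) (evt v (d k')) (evt v (e k')))"

lemma rel1_mono: "rel1 k R \<rho> \<Longrightarrow> k \<le> k1 \<Longrightarrow> rel1 k1 R (\<lambda>w. \<rho> (dr k k1 w))"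
  unfolding rel1_def by auto

lemma rel2_app: "rel2 k R \<rho> \<Longrightarrow> arg k1 n \<Longrightarrow> k \<le> k1 \<Longrightarrow> rel1 k1 (R n) (\<lambda>w. \<rho> (dr k k1 w) (evt w (n k1)))"
  unfolding rel1_def rel2_def by (auto simp: arg_dr)

lemma rel3_app: "rel3 k R \<rho> \<Longrightarrow> arg k1 n \<Longrightarrow> k \<le> k1 \<Longrightarrow> rel2 k1 (R n) (\<lambda>w. \<rho> (dr k k1 w) (evt w (n k1)))"
  unfolding rel2_def rel3_def by (auto simp: arg_dr)

lemma rel5_app: "rel5 k R \<rho> \<Longrightarrow> arg k1 n \<Longrightarrow> k \<le> k1 \<Longrightarrow> rel4 k1 (R n) (\<lambda>w. \<rho> (dr k k1 w) (evt w (n k1)))"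
  unfolding rel4_def rel5_def by (auto simp: arg_dr)

lemma rel1_tm: "rel1 k R \<rho> \<Longrightarrow> tame P V k' (R a k' l)" by (simp add: rel1_def)
lemma rel2_tm: "rel2 k R \<rho> \<Longrightarrow> tame P V k' (R a b k' l)" by (simp add: rel2_def)
lemma rel3_tm: "rel3 k R \<rho> \<Longrightarrow> tame P V k' (R a b c k' l)" by (simp add: rel3_def)
lemma rel4_tm: "rel4 k R \<rho> \<Longrightarrow> tame P V k' (R a b c d k' l)" by (simp add: rel4_def)
lemma rel5_tm: "rel5 k R \<rho> \<Longrightarrow> tame P V k' (R a b c d e k' l)" by (simp add: rel5_def)
lemma rel1_sat: "rel1 k R \<rho> \<Longrightarrow> k \<le> k' \<Longrightarrow> sat v V (R a k' l) = \<rho> (dr k k' v) (evt v (a k'))" by (simp add: rel1_def)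
lemma rel2_sat: "rel2 k R \<rho> \<Longrightarrow> k \<le> k' \<Longrightarrow> sat v V (R a b k' l) = \<rho> (dr k k' v) (evt v (a k')) (evt v (b k'))" by (simp add: rel2_def)
lemma rel3_sat: "rel3 k R \<rho> \<Longrightarrow> k \<le> k' \<Longrightarrow> sat v V (R a b c k' l) = \<rho> (dr k k' v) (evt v (a k')) (evt v (b k')) (evt v (c k'))" by (simp add: rel3_def)
lemma rel4_sat: "rel4 k R \<rho> \<Longrightarrow> k \<le> k' \<Longrightarrow> sat v V (R a b c d k' l) =
  \<rho> (dr k k' v) (evt v (a k')) (evt v (b k')) (evt v (c k')) (evt v (d k'))" by (simp add: rel4_def)
lemma rel5_sat: "rel5 k R \<rho> \<Longrightarrow> k \<le> k' \<Longrightarrow> sat v V (R a b c d e k' l) =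
  \<rho> (dr k k' v) (evt v (a k')) (evt v (b k')) (evt v (c k')) (evt v (d k')) (evt v (e k'))" by (simp add: rel5_def)

section \<open>Truth and tameness of the building blocks of the sentence\<close>

lemma is_min:
  assumes B: "rel1 k0 B \<beta>" and k: "k0 \<le> k" and m: "arg k m"
  shows "sat v V (is_min B m k l) = rmin (\<beta> (dr k0 k v)) (evt v (m k))" "tame P V k (is_min B m k l)"
proof -
  show "sat v V (is_min B m k l) = rmin (\<beta> (dr k0 k v)) (evt v (m k))"
    unfolding is_min_def rmin_def using k by (simp add: rel1_sat[OF B] arg_Suc[OF m])
  show "tame P V k (is_min B m k l)" unfolding is_min_def
  proof (simp add: rel1_tm[OF B], rule tm_allI)
    fix v y w assume v: "\<forall>j<k. v j \<le> y" and s: "\<not> sat (case_nat w v) V ((B (bv k) \<^bold>\<longrightarrow> m \<^bold>\<le> bv k) (Suc k) l)"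
    then have "w < evt v (m k)" by (simp add: arg_Suc[OF m])
    then show "w \<le> P y" using arg_le[OF m v] P_ge[of w y] by simp
  qed (simp add: rel1_tm[OF B])
qed

text \<open>A counterexample to maximality can be any element, so the class itself has to be
  bounded; one to minimality is below \<open>m\<close> anyway.\<close>

lemma is_max:
  assumes B: "rel1 k0 B \<beta>" and k: "k0 \<le> k" and m: "arg k m"
    and bd: "\<And>v y x. \<forall>j<k. v j \<le> y \<Longrightarrow> \<beta> (dr k0 k v) x \<Longrightarrow> x \<le> P y"
  shows "sat v V (is_max B m k l) = rmax (\<beta> (dr k0 k v)) (evt v (m k))" "tame P V k (is_max B m k l)"
proof -
  show "sat v V (is_max B m k l) = rmax (\<beta> (dr k0 k v)) (evt v (m k))"
    unfolding is_max_def rmax_def using k by (simp add: rel1_sat[OF B] arg_Suc[OF m])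
  show "tame P V k (is_max B m k l)" unfolding is_max_def
  proof (simp add: rel1_tm[OF B], rule tm_allI)
    fix v y w assume v: "\<forall>j<k. v j \<le> y" and s: "\<not> sat (case_nat w v) V ((B (bv k) \<^bold>\<longrightarrow> bv k \<^bold>\<le> m) (Suc k) l)"
    then have "\<beta> (dr k0 k v) w" using k by (simp add: rel1_sat[OF B])
    then show "w \<le> P y" by (rule bd[OF v])
  qed (simp add: rel1_tm[OF B])
qed

lemma is_base:
  assumes B: "rel1 k0 B \<beta>" and k: "k0 \<le> k" and n: "arg k n" and b: "arg k b"
  shows "sat v V (is_base B n b k l) = rbase (\<beta> (dr k0 k v)) (evt v (n k)) (evt v (b k))" "tame P V k (is_base B n b k l)"
proof -
  have r: "rel1 k (\<lambda>x. B x \<^bold>\<and> x \<^bold>\<le> n) (\<lambda>w x. \<beta> (dr k0 k w) x \<and> x \<le> evt w (n k))"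
    unfolding rel1_def using k by (auto simp: rel1_tm[OF B] rel1_sat[OF B] arg_dr[OF n])
  have bd: "x \<le> P y" if "\<forall>j<k. v j \<le> y" "\<beta> (dr k0 k (dr k k v)) x \<and> x \<le> evt (dr k k v) (n k)" for v y x
    using that arg_le[OF n that(1)] by (intro P_ge) simp
  note mx = is_max[OF r order_refl b bd]
  show "sat v V (is_base B n b k l) = rbase (\<beta> (dr k0 k v)) (evt v (n k)) (evt v (b k))"
    unfolding is_base_def rbase_def using mx(1) is_min(1)[OF B k b] by simp
  show "tame P V k (is_base B n b k l)" unfolding is_base_def using mx(2) is_min(2)[OF B k b] by simp
qed

lemma below_succ:
  assumes B: "rel1 k0 B \<beta>" and k: "k0 \<le> k" and a: "arg k a" and c: "arg k c"
  shows "sat v V (below_succ B a c k l) = rbelow (\<beta> (dr k0 k v)) (evt v (a k)) (evt v (c k))" "tame P V k (below_succ B a c k l)"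
proof -
  show "sat v V (below_succ B a c k l) = rbelow (\<beta> (dr k0 k v)) (evt v (a k)) (evt v (c k))"
    unfolding below_succ_def rbelow_def using k by (simp add: rel1_sat[OF B] arg_Suc[OF a] arg_Suc[OF c])
  show "tame P V k (below_succ B a c k l)" unfolding below_succ_def
  proof (rule tm_allI)
    fix v y w assume v: "\<forall>j<k. v j \<le> y" and s: "\<not> sat (case_nat w v) V ((B (bv k) \<^bold>\<and> c \<^bold>< bv k \<^bold>\<longrightarrow> a \<^bold>< bv k) (Suc k) l)"
    then have "w \<le> evt v (a k)" by (simp add: arg_Suc[OF a])
    then show "w \<le> P y" using arg_le[OF a v] P_ge[of w y] by simp
  qed (simp add: rel1_tm[OF B])
qed

lemma is_decomp:
  assumes "arg k b" "arg k m" "arg k e" "arg k a" "arg k r"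
  shows "sat v V (is_decomp E b m e a r k l) = rdecomp pow (evt v (b k)) (evt v (m k)) (evt v (e k)) (evt v (a k)) (evt v (r k))"
    "tame P V k (is_decomp E b m e a r k l)"
proof -
  note A = assms[THEN arg_Suc2] assms[THEN arg_Suc]
  show "sat v V (is_decomp E b m e a r k l) = rdecomp pow (evt v (b k)) (evt v (m k)) (evt v (e k)) (evt v (a k)) (evt v (r k))"
    unfolding is_decomp_def rdecomp_def by (simp add: A E_iff)
  show "tame P V k (is_decomp E b m e a r k l)" unfolding is_decomp_def
  proof (intro tm_exI)
    fix v y w assume v: "\<forall>j<k. v j \<le> y" and s: "sat (case_nat w v) V ((\<^bold>\<exists>q. (b \<^bold>, e \<^bold>, bv k) \<^bold>\<in> E \<^bold>\<and> (b \<^bold>, e \<^bold>+ \<^bold>1 \<^bold>, q) \<^bold>\<in> E \<^bold>\<and>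
     m \<^bold>= bv k \<^bold>* a \<^bold>+ r \<^bold>\<and> bv k \<^bold>\<le> m \<^bold>\<and> m \<^bold>< q \<^bold>\<and> \<^bold>0 \<^bold>< a \<^bold>\<and> a \<^bold>< b \<^bold>\<and> r \<^bold>< bv k) (Suc k) l)"
    then have "w \<le> evt v (m k)" by (auto simp: A E_iff intro!: trans_le_add1)
    then show "w \<le> P y" using arg_le[OF assms(2) v] P_ge[of w y] by simp
  next
    fix v y w assume v: "\<forall>j<Suc k. v j \<le> y" and s: "sat (case_nat w v) V (((b \<^bold>, e \<^bold>, bv k) \<^bold>\<in> E \<^bold>\<and> (b \<^bold>, e \<^bold>+ \<^bold>1 \<^bold>, bv (Suc k)) \<^bold>\<in> E \<^bold>\<and>
     m \<^bold>= bv k \<^bold>* a \<^bold>+ r \<^bold>\<and> bv k \<^bold>\<le> m \<^bold>\<and> m \<^bold>< bv (Suc k) \<^bold>\<and> \<^bold>0 \<^bold>< a \<^bold>\<and> a \<^bold>< b \<^bold>\<and> r \<^bold>< bv k) (Suc (Suc k)) l)"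
    have arg: "arg (Suc k) b" "arg (Suc k) e" using assms arg_mono le_SucI by blast+
    have "w = evt v (b (Suc k)) ^ (evt v (e (Suc k)) + 1)" using s by (simp add: E_iff arg[THEN arg_Suc])
    then show "w \<le> P y" using P_pow[of "evt v (b (Suc k))" y "evt v (e (Suc k)) + 1"] arg[THEN arg_le, OF v] by simp
  qed simp
qed

lemma rdecomp_le: "rdecomp pow b m e a r \<Longrightarrow> e \<le> m" "rdecomp pow b m e a r \<Longrightarrow> a \<le> m" "rdecomp pow b m e a r \<Longrightarrow> r \<le> m"
  using greatest_exponent_less[of b m] unfolding rdecomp_iff by auto

lemma le_bound: "\<forall>j<k'. v j \<le> y \<Longrightarrow> n < k' \<Longrightarrow> v n \<le> y"
  by blast

lemma P_le: "\<forall>j<k'. v j \<le> y \<Longrightarrow> w \<le> v n \<Longrightarrow> n < k' \<Longrightarrow> w \<le> P y"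
  by (meson P_ge order_trans)

lemma P_pow_le: "\<forall>j<k'. v j \<le> y \<Longrightarrow> w = v m ^ v n \<Longrightarrow> m < k' \<Longrightarrow> n < k' \<Longrightarrow> w \<le> P y"
  using P_pow le_SucI by (metis Suc_eq_plus1)

lemma admissible:
  assumes C: "rel1 k0 C \<chi>" and U: "rel2 k0 U \<upsilon>" and K: "rel4 k0 K \<kappa>" and k: "k0 \<le> k"
    and args: "arg k n" "arg k b" "arg k c" "arg k x"
    and bU: "\<And>w y m u. \<forall>j<k0. w j \<le> y \<Longrightarrow> m \<le> y \<Longrightarrow> \<upsilon> w m u \<Longrightarrow> u \<le> P y"
  shows "sat v V (admissible C U K n b c x k l) =
      radm (\<chi> (dr k0 k v)) (\<upsilon> (dr k0 k v)) (\<kappa> (dr k0 k v)) (evt v (n k)) (evt v (b k)) (evt v (c k)) (evt v (x k))"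
    "tame P V k (admissible C U K n b c x k l)"
proof -
  note A = args[THEN arg_Suc2] args[THEN arg_Suc]
  show "sat v V (admissible C U K n b c x k l) =
      radm (\<chi> (dr k0 k v)) (\<upsilon> (dr k0 k v)) (\<kappa> (dr k0 k v)) (evt v (n k)) (evt v (b k)) (evt v (c k)) (evt v (x k))"
    unfolding admissible_def radm_def using k
    by (simp add: A rel1_sat[OF C] rel2_sat[OF U] rel4_sat[OF K] below_succ[OF C k args(4,3)])
  show "tame P V k (admissible C U K n b c x k l)" unfolding admissible_def
  proof (simp add: rel1_tm[OF C] rel4_tm[OF K] below_succ[OF C k args(4,3)], intro tm_exI)
    fix v y w assume v: "\<forall>j<k. v j \<le> y" and s: "sat (case_nat w v) V ((\<^bold>\<exists>w. n \<^bold>= bv k \<^bold>+ \<^bold>1 \<^bold>\<and> U (bv k) w \<^bold>\<and> w \<^bold>< x) (Suc k) l)"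
    then have "w \<le> evt v (n k)" by (simp add: A)
    then show "w \<le> P y" using arg_le[OF args(1) v] P_ge[of w y] by simp
  next
    fix v y w assume v: "\<forall>j<Suc k. v j \<le> y" and s: "sat (case_nat w v) V ((n \<^bold>= bv k \<^bold>+ \<^bold>1 \<^bold>\<and> U (bv k) (bv (Suc k)) \<^bold>\<and> bv (Suc k) \<^bold>< x) (Suc (Suc k)) l)"
    then have "\<upsilon> (dr k0 (Suc k) v) (v 0) w" using k by (simp add: rel2_sat[OF U] le_SucI)
    then show "w \<le> P y" using bU[OF dr_bound[OF v, of k0], of "v 0" w] k v by simp
  qed (simp add: rel2_tm[OF U])
qed

lemma is_change:
  assumes U: "rel2 k U \<upsilon>" and K: "rel4 k K \<kappa>"
    and truth: "\<And>w. rchange pow (\<upsilon> w) (\<kappa> w)"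
    and bU: "\<And>w y m u. \<forall>j<k. w j \<le> y \<Longrightarrow> m \<le> y \<Longrightarrow> \<upsilon> w m u \<Longrightarrow> u \<le> P y"
    and bK: "\<And>w y b c m u. \<forall>j<k. w j \<le> y \<Longrightarrow> b \<le> y \<Longrightarrow> c \<le> y \<Longrightarrow> m \<le> y \<Longrightarrow> \<kappa> w b c m u \<Longrightarrow> u \<le> P y"
  shows "holds k (is_change E U K k l)"
proof -
  have cK: "u \<le> P y" if "\<kappa> (dr k k' v) b c m u" "\<forall>j<k'. v j \<le> y" "k \<le> k'" "b \<le> y" "c \<le> y" "m \<le> y" for u y v b c m k'
    using bK[OF dr_bound[OF that(2,3)] that(4-6,1)] .
  have cU: "u \<le> P y" if "\<upsilon> (dr k k' v) m u" "\<forall>j<k'. v j \<le> y" "k \<le> k'" "m \<le> y" for u y v m k'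
    using bU[OF dr_bound[OF that(2,3)] that(4,1)] .
  have dec: "sat v V (is_decomp E (bv k) (bv (Suc (Suc k))) (bv (Suc (Suc (Suc (Suc k))))) (bv (Suc (Suc (Suc (Suc (Suc k)))))) (bv (Suc (Suc (Suc (Suc (Suc (Suc k))))))) (Suc (Suc (Suc (Suc (Suc (Suc (Suc k))))))) l)
    = rdecomp pow (v 6) (v 4) (v 2) (v 1) (v 0)"
    "tame P V (Suc (Suc (Suc (Suc (Suc (Suc (Suc k))))))) (is_decomp E (bv k) (bv (Suc (Suc k))) (bv (Suc (Suc (Suc (Suc k))))) (bv (Suc (Suc (Suc (Suc (Suc k)))))) (bv (Suc (Suc (Suc (Suc (Suc (Suc k))))))) (Suc (Suc (Suc (Suc (Suc (Suc (Suc k))))))) l)"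
    for v
    by (subst is_decomp; simp add: arg_var)+
  show ?thesis unfolding is_change_def
    apply (intro holds_all)
    unfolding holds_def
    apply (intro conjI allI)
     apply (intro tm_intros tm_exI rel2_tm[OF U] rel4_tm[OF K] dec(2))
           apply (simp_all add: dec(1) rel2_sat[OF U] rel4_sat[OF K] E_iff)
           apply (elim conjE exE, rule cK, assumption, assumption, simp_all add: le_bound)[1]
          apply (elim conjE exE, rule cU, assumption, assumption, simp_all add: le_bound)[1]
         apply (elim conjE exE, rule P_pow_le[OF _ refl], assumption, simp_all)[1]
        apply (elim conjE exE, rule cK, assumption, assumption, simp_all add: le_bound)[1]
       apply (elim conjE exE, rule P_le, assumption, erule rdecomp_le, simp)[1]
      apply (elim conjE exE, rule P_le, assumption, erule rdecomp_le, simp)[1]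
     apply (elim conjE exE, rule P_le, assumption, erule rdecomp_le, simp)[1]
    apply (subst truth[unfolded rchange_def, rule_format])
    apply simp
    done
qed

end

context frame
begin

text \<open>Tameness concerns every subformula under all assignments. The witnesses of a quantifier
  have to be bounded from its own scope alone; in particular \<open>bC\<close> has to cover numbers
  \<open>n\<close> below the minimum as well.\<close>

lemma is_upgrade:
  assumes B: "rel1 k B \<beta>" and C: "rel1 k C \<chi>" and U: "rel2 k U \<upsilon>" and K: "rel4 k K \<kappa>"
    and truth: "\<And>w. rup pow (\<beta> w) (\<chi> w) (\<upsilon> w) (\<kappa> w)"
    and bU: "\<And>w y m u. \<forall>j<k. w j \<le> y \<Longrightarrow> m \<le> y \<Longrightarrow> \<upsilon> w m u \<Longrightarrow> u \<le> P y"
    and bK: "\<And>w y b c m u. \<forall>j<k. w j \<le> y \<Longrightarrow> b \<le> y \<Longrightarrow> c \<le> y \<Longrightarrow> m \<le> y \<Longrightarrow> \<kappa> w b c m u \<Longrightarrow> u \<le> P y"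
    and bM: "\<And>w y m. \<forall>j<k. w j \<le> y \<Longrightarrow> rmin (\<beta> w) m \<Longrightarrow> m \<le> P y"
    and bB: "\<And>w y n b. \<forall>j<k. w j \<le> y \<Longrightarrow> n \<le> y \<Longrightarrow> rbase (\<beta> w) n b \<Longrightarrow> b \<le> P y"
    and bC: "\<And>w y n b c v. \<forall>j<k. w j \<le> y \<Longrightarrow> n \<le> y \<Longrightarrow> v \<le> y \<Longrightarrow> rbase (\<beta> w) n b \<Longrightarrow>
       radm (\<chi> w) (\<upsilon> w) (\<kappa> w) n b c v \<Longrightarrow> \<forall>c'<c. \<forall>v'. \<not> radm (\<chi> w) (\<upsilon> w) (\<kappa> w) n b c' v' \<Longrightarrow> c \<le> P y"
  shows "holds k (is_upgrade E B C U K k l)"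
proof -
  have cK: "u \<le> P y" if "radm (\<chi> (dr k k' v)) (\<upsilon> (dr k k' v)) (\<kappa> (dr k k' v)) n b c u" "\<forall>j<k'. v j \<le> y" "k \<le> k'" "b \<le> y" "c \<le> y" "n \<le> y" for u y v b c n k'
    using bK[OF dr_bound[OF that(2,3)] that(4-6)] that(1) unfolding radm_def by blast
  have cM: "m \<le> P y" if "rmin (\<beta> (dr k k' v)) m" "\<forall>j<k'. v j \<le> y" "k \<le> k'" for m y v k'
    using bM[OF dr_bound[OF that(2,3)] that(1)] .
  have cB: "b \<le> P y" if "rbase (\<beta> (dr k k' v)) n b" "\<forall>j<k'. v j \<le> y" "k \<le> k'" "n \<le> y" for n b y v k'
    using bB[OF dr_bound[OF that(2,3)] that(4,1)] .
  have cC: "c \<le> P y" if "radm (\<chi> (dr k k' v)) (\<upsilon> (dr k k' v)) (\<kappa> (dr k k' v)) n b c u"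
      "\<forall>c'<c. \<forall>v'. \<not> radm (\<chi> (dr k k' v)) (\<upsilon> (dr k k' v)) (\<kappa> (dr k k' v)) n b c' v'" "rbase (\<beta> (dr k k' v)) n b"
      "\<forall>j<k'. v j \<le> y" "k \<le> k'" "n \<le> y" "u \<le> y" for n b c u y v k'
    using bC[OF dr_bound[OF that(4,5)] that(6,7,3,1,2)] .
  note tm = is_min(2)[OF B _ arg_var] is_base(2)[OF B _ arg_var arg_var]
    admissible(2)[OF C U K _ arg_var arg_var arg_var arg_var bU]
  note st = is_min(1)[OF B _ arg_var] is_base(1)[OF B _ arg_var arg_var]
    admissible(1)[OF C U K _ arg_var arg_var arg_var arg_var bU]
  have ch: "holds k (is_change E U K k l)"
    by (rule is_change[OF U K _ bU bK]) (use truth in \<open>auto simp: rup_def\<close>)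
  show ?thesis unfolding is_upgrade_def
    apply (intro holds_and ch holds_all)
    unfolding holds_def
    apply (intro conjI allI)
     apply (intro tm_intros tm_exI tm_allI rel2_tm[OF U] tm)
          apply (simp_all add: st rel2_sat[OF U] del: not_ex)
         apply (rule cK, assumption, assumption, simp_all add: le_bound)[1]
        apply (elim conjE, rule P_le, assumption, erule less_imp_le, simp)[1]
       apply (elim conjE, rule cC, assumption, blast, assumption, assumption, simp_all add: le_bound)[1]
      apply (elim conjE, rule cB, assumption, assumption, simp_all add: le_bound)[1]
     apply (elim conjE, rule cM, assumption, assumption, simp)[1]
    apply (subst truth[unfolded rup_def, THEN conjunct2, rule_format])
    apply simp
    done
qed

lemma is_stages:
  assumes B: "rel1 k B \<beta>" and St: "rel2 k St \<sigma>" and U: "rel3 k U \<upsilon>" and K: "rel5 k K \<kappa>" and D: "rel3 k D \<delta>"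
    and i: "\<And>v k'. k \<le> k' \<Longrightarrow> evt v (i k') = \<iota> (dr k k' v)"
    and truth: "\<And>w. rstage pow (\<beta> w) (\<iota> w) (\<sigma> w) (\<upsilon> w) (\<kappa> w) (\<delta> w)"
    and bi: "\<And>w y. \<forall>j<k. w j \<le> y \<Longrightarrow> \<iota> w \<le> P y"
    and bpos: "\<And>w b. \<beta> w b \<Longrightarrow> 0 < b"
    and bU: "\<And>w y n m u. \<forall>j<k. w j \<le> y \<Longrightarrow> n \<le> y \<Longrightarrow> m \<le> y \<Longrightarrow> \<upsilon> w n m u \<Longrightarrow> u \<le> P y"
    and bK: "\<And>w y n b c m u. \<forall>j<k. w j \<le> y \<Longrightarrow> n \<le> y \<Longrightarrow> b \<le> y \<Longrightarrow> c \<le> y \<Longrightarrow> m \<le> y \<Longrightarrow> \<kappa> w n b c m u \<Longrightarrow> u \<le> P y"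
    and bS: "\<And>w y n x. \<forall>j<k. w j \<le> y \<Longrightarrow> n \<le> y \<Longrightarrow> \<sigma> w n x \<Longrightarrow> x \<le> P y"
    and bD: "\<And>w y n j d. \<forall>j<k. w j \<le> y \<Longrightarrow> n \<le> y \<Longrightarrow> j \<le> y \<Longrightarrow> \<delta> w n j d \<Longrightarrow> d \<le> P y"
    and bM: "\<And>w y m. \<forall>j<k. w j \<le> y \<Longrightarrow> rmin (\<beta> w) m \<Longrightarrow> m \<le> P y"
    and bB: "\<And>w y n b. \<forall>j<k. w j \<le> y \<Longrightarrow> n \<le> y \<Longrightarrow> rbase (\<beta> w) n b \<Longrightarrow> b \<le> P y"
    and bC: "\<And>w y s n b c v. \<forall>j<k. w j \<le> y \<Longrightarrow> n \<le> y \<Longrightarrow> v \<le> y \<Longrightarrow> rbase (\<beta> w) n b \<Longrightarrow>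
       radm (\<sigma> w s) (\<upsilon> w s) (\<kappa> w s) n b c v \<Longrightarrow> \<forall>c'<c. \<forall>v'. \<not> radm (\<sigma> w s) (\<upsilon> w s) (\<kappa> w s) n b c' v' \<Longrightarrow> c \<le> P y"
  shows "holds k (is_stages E B i St U K D k l)"
proof -
  have k1: "k \<le> Suc k" by simp
  have a1: "arg (Suc k) (bv k)" by (rule arg_var) simp
  have up: "holds (Suc k) (is_upgrade E B (St (bv k)) (U (bv k)) (K (bv k)) (Suc k) l)"
    apply (rule is_upgrade[OF rel1_mono[OF B k1] rel2_app[OF St a1 k1] rel3_app[OF U a1 k1] rel5_app[OF K a1 k1]])
    subgoal for w by (rule truth[unfolded rstage_def, THEN conjunct1, rule_format])
    subgoal premises p for w y m u using bU[OF dr_bound[OF p(1) k1], of "w 0" m u] p by simp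
    subgoal premises p for w y b c m u using bK[OF dr_bound[OF p(1) k1], of "w 0" b c m u] p by simp
    subgoal premises p for w y m using bM[OF dr_bound[OF p(1) k1] p(2)] .
    subgoal premises p for w y n b using bB[OF dr_bound[OF p(1) k1] p(2,3)] .
    subgoal premises p for w y n b c v using bC[OF dr_bound[OF p(1) k1] p(2-6)] .
    done
  have cK: "u \<le> P y" if "\<kappa> (dr k k' v) n b c m u" "\<forall>j<k'. v j \<le> y" "k \<le> k'" "n \<le> y" "b \<le> y" "c \<le> y" "m \<le> y" for u y v n b c m k'
    using bK[OF dr_bound[OF that(2,3)] that(4-7)] that(1) by blast
  have cM: "m \<le> P y" if "rmin (\<beta> (dr k k' v)) m" "\<forall>j<k'. v j \<le> y" "k \<le> k'" for m y v k'
    using bM[OF dr_bound[OF that(2,3)] that(1)] .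
  have cB: "b \<le> P y" if "rbase (\<beta> (dr k k' v)) n b" "\<forall>j<k'. v j \<le> y" "k \<le> k'" "n \<le> y" for n b y v k'
    using bB[OF dr_bound[OF that(2,3)] that(4,1)] .
  have cS: "x \<le> P y" if "\<sigma> (dr k k' v) n x" "\<forall>j<k'. v j \<le> y" "k \<le> k'" "n \<le> y" for n x y v k'
    using bS[OF dr_bound[OF that(2,3)] that(4,1)] .
  have cD: "d \<le> P y" if "\<delta> (dr k k' v) n j d" "\<forall>j<k'. v j \<le> y" "k \<le> k'" "n \<le> y" "j \<le> y" for n j d y v k'
    using bD[OF dr_bound[OF that(2,3)] that(4,5,1)] .
  have ci: "w \<le> P y" if "w \<le> \<iota> (dr k k' v)" "\<forall>j<k'. v j \<le> y" "k \<le> k'" for w y v k'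
    using bi[OF dr_bound[OF that(2,3)]] that(1) by simp
  have mx: "sat v V (is_max (St (bv k1)) (bv k2) k' l) = rmax (\<sigma> (dr k k' v) (v (k' - Suc k1))) (v (k' - Suc k2))"
    "tame P V k' (is_max (St (bv k1)) (bv k2) k' l)" if "k1 < k'" "k2 < k'" "k \<le> k'" for v k1 k2 k'
  proof -
    note m = is_max[OF rel2_app[OF St arg_var[OF that(1)] that(3)] order_refl arg_var[OF that(2)]]
    have bd: "x \<le> P y" if v: "\<forall>j<k'. v j \<le> y" "\<sigma> (dr k k' (dr k' k' v)) (evt (dr k' k' v) (bv k1 k')) x" for v y x
      using cS[OF _ v(1) \<open>k \<le> k'\<close>, of "v (k' - Suc k1)" x] v \<open>k1 < k'\<close> by simp
    show "sat v V (is_max (St (bv k1)) (bv k2) k' l) = rmax (\<sigma> (dr k k' v) (v (k' - Suc k1))) (v (k' - Suc k2))"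
      using m(1)[OF bd] by simp
    show "tame P V k' (is_max (St (bv k1)) (bv k2) k' l)" using m(2)[OF bd] .
  qed
  have bpos': "0 < b" if "rbase (\<beta> w) n b" for w n b
    using that bpos unfolding rbase_def rmax_def rmin_def by blast
  note tm = rel3_tm[OF D] rel3_tm[OF U] rel5_tm[OF K] rel2_tm[OF St] rel1_tm[OF B] is_min(2)[OF B _ arg_var] is_base(2)[OF B _ arg_var arg_var] mx(2)
  note st = rel3_sat[OF D] rel3_sat[OF U] rel5_sat[OF K] rel2_sat[OF St] rel1_sat[OF B] is_min(1)[OF B _ arg_var] is_base(1)[OF B _ arg_var arg_var] mx(1) i
  have le_multI: "n = m * q \<Longrightarrow> 0 < m \<Longrightarrow> q \<le> n" for n m q :: nat by simp
  have rmaxD: "rmax R x \<Longrightarrow> R x" for R x by (simp add: rmax_def)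
  show ?thesis unfolding is_stages_def
    apply (intro holds_and holds_all up)
    unfolding holds_def
     apply (intro conjI allI)
      apply (intro tm_intros tm_exI tm_allI tm)
           apply (simp_all add: st del: not_ex)[11]
         apply (elim conjE, rule cB, assumption, assumption, simp_all add: le_bound)[1]
        apply (elim conjE exE, rule cD, assumption, assumption, simp_all add: le_bound)[1]
       apply (elim conjE exE, rule P_le[where n = 2], assumption, simp, simp)[1]
      apply (elim conjE exE, rule P_le[where n = 2], assumption, simp, simp)[1]
     apply (subst truth[unfolded rstage_def, THEN conjunct2, THEN conjunct1, rule_format])
     apply simp
    apply (intro conjI allI)
     apply (intro tm_intros tm_exI tm_allI tm)
                        apply (simp_all add: st del: not_ex)
              apply (elim conjE, rule P_le, assumption, erule less_imp_le, simp)[1]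
             apply (elim conjE, rule P_le[where n = 5], assumption, erule le_multI, rule gr0I, simp, simp)[1]
            apply (elim conjE exE, rule cK, assumption, assumption, simp_all add: le_bound)[1]
           apply (elim conjE exE, rule cS, rule rmaxD, assumption, assumption, simp_all add: le_bound)[1]
          apply (elim conjE exE, rule cB, assumption, assumption, simp_all add: le_bound)[1]
         apply (elim conjE exE, rule ci, assumption, assumption, simp)[1]
        apply (elim conjE exE, frule bpos', rule P_le[where n = 4], assumption, erule le_multI, assumption, simp)[1]
       apply (elim conjE, rule cB, assumption, assumption, simp_all add: le_bound)[1]
      apply (elim conjE exE, rule P_le[where n = 2], assumption, simp, simp)[1]
     apply (elim conjE, rule cM, assumption, assumption, simp)[1]
    apply (subst truth[unfolded rstage_def, THEN conjunct2, THEN conjunct2, rule_format])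
    apply simp
    done
qed

end

text \<open>From the minimum on, the value is at least the base. Below the minimum the value does
  not depend on the base, so only minimality bounds it: \<open>Inf B + 1\<close> is admissible,
  too.\<close>

lemma radm_least_le:
  assumes B: "B \<noteq> {}" "0 \<notin> B" "1 \<notin> B" and C: "Inf B + 1 \<in> C" "\<And>x. x \<in> C \<Longrightarrow> Inf B < x"
    and b: "rbase (\<lambda>x. x \<in> B) n b" and r: "radm (\<lambda>x. x \<in> C) (ug B C) (cg B C) n b c v"
    and least: "\<forall>c'<c. \<forall>v'. \<not> radm (\<lambda>x. x \<in> C) (ug B C) (cg B C) n b c' v'"
  shows "c \<le> v \<or> c \<le> Inf B + 1"
proof -
  have be: "b = base_of B n" using b rbase_iff[OF B(1)] by simp
  have chg: "change (upgrade B C) b c n = enat v" using r by (simp add: radm_def)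
  show ?thesis
  proof (cases "Inf B \<le> n")
    case True
    have "b \<in> B" using b unfolding rbase_def rmax_def rmin_def by blast
    then have "b \<noteq> 0" "b \<noteq> 1" using B by metis+
    then have "2 \<le> b" by simp
    moreover have "b \<le> n" unfolding be by (rule base_of_le[OF B(1) True])
    ultimately have "c \<le> v" by (intro change_ge[OF upgrade_pos _ _ chg])
    then show ?thesis ..
  next
    case False
    then have bn: "n < b" unfolding be by (simp add: base_of_def)
    have chn: "change (upgrade B C) b d n = upgrade B C n" for d using bn by (subst change.simps) simp
    have un: "upgrade B C n = enat n" using False by (subst upgrade.simps) simp
    have vn: "v = n" using chg chn un by simp
    have "rbelow (\<lambda>x. x \<in> C) v (Inf B + 1)" using False C(2) vn unfolding rbelow_def by fastforce
    then have "radm (\<lambda>x. x \<in> C) (ug B C) (cg B C) n b (Inf B + 1) v"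
      using r C(1) chn un vn unfolding radm_def by simp
    then show ?thesis using least by (meson not_le)
  qed
qed

section \<open>The true graphs of the process\<close>

context process
begin

definition "setE = {c \<rhd> e \<rhd> v | c e v. v = c ^ e}"
definition "setM = {i \<rhd> x | i x. x \<in> BB i}"
definition "setW = {i \<rhd> n \<rhd> x | i n x. x \<in> stage (BB i) (Suc i) n}"
definition "setV = {i \<rhd> n \<rhd> m \<rhd> v | i n m v. ug (BB i) (stage (BB i) (Suc i) n) m v}"
definition "setH = {i \<rhd> n \<rhd> b \<rhd> c \<rhd> m \<rhd> v | i n b c m v. cg (BB i) (stage (BB i) (Suc i) n) b c m v}"
definition "setD = {i \<rhd> n \<rhd> j \<rhd> d | i n j d. Dg (BB i) (Suc i) n j d}"
definition "setU = {i \<rhd> m \<rhd> v | i m v. ug (BB i) (BB (Suc i)) m v}"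
definition "setK = {i \<rhd> b \<rhd> c \<rhd> m \<rhd> v | i b c m v. cg (BB i) (BB (Suc i)) b c m v}"
definition "setG = {n \<rhd> i \<rhd> v | n i v. goodstein B0 n i = enat v}"

lemma set_iff:
  "c \<rhd> e \<rhd> v \<in> setE \<longleftrightarrow> v = c ^ e" "i \<rhd> x \<in> setM \<longleftrightarrow> x \<in> BB i"
  "i \<rhd> n \<rhd> x \<in> setW \<longleftrightarrow> x \<in> stage (BB i) (Suc i) n"
  "i \<rhd> n \<rhd> m \<rhd> v \<in> setV \<longleftrightarrow> ug (BB i) (stage (BB i) (Suc i) n) m v"
  "i \<rhd> n \<rhd> b \<rhd> c \<rhd> m \<rhd> v \<in> setH \<longleftrightarrow> cg (BB i) (stage (BB i) (Suc i) n) b c m v"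
  "i \<rhd> n \<rhd> j \<rhd> d \<in> setD \<longleftrightarrow> Dg (BB i) (Suc i) n j d"
  "i \<rhd> m \<rhd> v \<in> setU \<longleftrightarrow> ug (BB i) (BB (Suc i)) m v"
  "i \<rhd> b \<rhd> c \<rhd> m \<rhd> v \<in> setK \<longleftrightarrow> cg (BB i) (BB (Suc i)) b c m v"
  "n \<rhd> i \<rhd> v \<in> setG \<longleftrightarrow> goodstein B0 n i = enat v"
  unfolding setE_def setM_def setW_def setV_def setH_def setD_def setU_def setK_def setG_def by auto

definition sets :: "nat \<Rightarrow> nat set" where
  "sets = case_nat setG (case_nat setK (case_nat setU (case_nat setD (case_nat setH (case_nat setV
     (case_nat setW (case_nat setM (case_nat setE (\<lambda>_. B0)))))))))"

text \<open>
  The set variables of \<^const>\<open>goodstein_terminates\<close>, in the order in which they are bound, as functions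
  of the number of set quantifiers in scope; \<open>lev\<close> is that number for the matrix of the formula.
\<close>

abbreviation "ixX \<equiv> (\<lambda>l. l - 1)"
abbreviation "ixE \<equiv> (\<lambda>l. l - Suc 1)"
abbreviation "ixM \<equiv> (\<lambda>l. l - Suc (Suc 1))"
abbreviation "ixW \<equiv> (\<lambda>l. l - Suc (Suc (Suc 1)))"
abbreviation "ixV \<equiv> (\<lambda>l. l - Suc (Suc (Suc (Suc 1))))"
abbreviation "ixH \<equiv> (\<lambda>l. l - Suc (Suc (Suc (Suc (Suc 1)))))"
abbreviation "ixD \<equiv> (\<lambda>l. l - Suc (Suc (Suc (Suc (Suc (Suc 1))))))"
abbreviation "ixU \<equiv> (\<lambda>l. l - Suc (Suc (Suc (Suc (Suc (Suc (Suc 1)))))))"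
abbreviation "ixK \<equiv> (\<lambda>l. l - Suc (Suc (Suc (Suc (Suc (Suc (Suc (Suc 1))))))))"
abbreviation "ixG \<equiv> (\<lambda>l. l - Suc (Suc (Suc (Suc (Suc (Suc (Suc (Suc (Suc 1)))))))))"
abbreviation "lev \<equiv> Suc (Suc (Suc (Suc (Suc (Suc (Suc (Suc (Suc 1))))))))"

lemma sets_eval:
  "sets 0 = setG"
  "sets (Suc 0) = setK"
  "sets (Suc (Suc 0)) = setU"
  "sets (Suc (Suc (Suc 0))) = setD"
  "sets (Suc (Suc (Suc (Suc 0)))) = setH"
  "sets (Suc (Suc (Suc (Suc (Suc 0))))) = setV"
  "sets (Suc (Suc (Suc (Suc (Suc (Suc 0)))))) = setW"
  "sets (Suc (Suc (Suc (Suc (Suc (Suc (Suc 0))))))) = setM"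
  "sets (Suc (Suc (Suc (Suc (Suc (Suc (Suc (Suc 0)))))))) = setE"
  "sets (Suc (Suc (Suc (Suc (Suc (Suc (Suc (Suc (Suc 0))))))))) = B0"
  by (simp_all add: sets_def)

abbreviation "graphs \<equiv> goodstein_graphs ixX ixE ixM ixW ixV ixH ixD ixU ixK ixG 0 lev"

lemma stage_low: "Inf (BB i) + 1 \<in> stage (BB i) (Suc i) n" "x \<in> stage (BB i) (Suc i) n \<Longrightarrow> Inf (BB i) < x"
proof -
  interpret ouro "BB i" "Suc i" by (rule ouro_BB)
  show "Inf (BB i) + 1 \<in> stage (BB i) (Suc i) n" using S_mono[of 0 n] S_low[of 0] by auto
  assume "x \<in> stage (BB i) (Suc i) n"
  then have "x \<in> C" using C_eq by blast
  then show "Inf (BB i) < x" using mu_C(1) cInf_lower[of x C] by simp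
qed

lemma BB_Suc_low: "Inf (BB i) + 1 \<in> BB (Suc i)" "x \<in> BB (Suc i) \<Longrightarrow> Inf (BB i) < x"
  using stage_low unfolding base_seq.simps ouroboros_def by blast+

lemma graphs_hold:
  assumes P: "\<And>y. bound_all (Inf B0) y \<le> P y"
  shows "tame P sets 0 graphs \<and> (\<forall>v. sat v sets graphs)"
proof -
  interpret F: frame sets P lev ixE
  proof
    show "(y + 1) ^ (y + 1) \<le> P y" for y using P[of y] by (simp add: bound_all_def)
    show "c \<rhd> e \<rhd> v \<in> sets (lev - Suc 1) \<longleftrightarrow> v = c ^ e" for c e v by (simp add: sets_eval set_iff)
  qed
  have muP: "Inf B0 + y + 1 \<le> P y" for y using P[of y] by (simp add: bound_all_def)
  have ugP: "u \<le> P y" if "u \<le> bound_upgrade (Inf B0) y" for u y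
    using that bound_upgrade_le[of y] P[of y] by simp
  have BB1: "1 \<notin> BB i" for i using ouro.B[OF ouro_BB, of i] by simp
  have w0: "w 0 \<le> y" if "\<forall>j<1. w j \<le> y" for w :: "nat \<Rightarrow> nat" and y using that by simp
  have bM: "m \<le> P y" if "\<forall>j<1. w j \<le> y" "rmin (\<lambda>x. x \<in> BB (w 0)) m" for w :: "nat \<Rightarrow> nat" and y m
    using w0[OF that(1)] that(2) muP[of y] by (simp add: rmin_iff[OF BB_ok(1)] Inf_BB)
  have bB: "b \<le> P y" if "\<forall>j<1. w j \<le> y" "n \<le> y" "rbase (\<lambda>x. x \<in> BB (w 0)) n b" for w :: "nat \<Rightarrow> nat" and y n b
    using that bM[OF that(1), of b] F.P_ge[of b y] unfolding rbase_def rmax_def by auto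
  have low: "c \<le> P y" if "\<forall>j<1. w j \<le> y" "v \<le> y" "c \<le> v \<or> c \<le> Inf (BB (w 0)) + 1" for w :: "nat \<Rightarrow> nat" and y c v
    using that(2,3) w0[OF that(1)] muP[of y] F.P_ge[of c y] by (auto simp: Inf_BB)
  have mem: "tame P V k ((t \<^bold>\<in> X) k' l)" for V k k' l t X by (simp add: memP_def)
  note ev = sets_eval set_iff dr_def mem
  let ?i = "\<lambda>k'. Var (k' - Suc 0)"
  have rM: "F.rel1 1 (\<lambda>x. ?i \<^bold>, x \<^bold>\<in> ixM) (\<lambda>w x. x \<in> BB (w 0))"
    unfolding F.rel1_def by (simp add: ev)
  have rM1: "F.rel1 1 (\<lambda>x. ?i \<^bold>+ \<^bold>1 \<^bold>, x \<^bold>\<in> ixM) (\<lambda>w x. x \<in> BB (Suc (w 0)))"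
    unfolding F.rel1_def by (simp add: ev)
  have rW: "F.rel2 1 (\<lambda>n x. ?i \<^bold>, n \<^bold>, x \<^bold>\<in> ixW) (\<lambda>w n x. x \<in> stage (BB (w 0)) (Suc (w 0)) n)"
    unfolding F.rel2_def by (simp add: ev)
  have rV: "F.rel3 1 (\<lambda>n m v. ?i \<^bold>, n \<^bold>, m \<^bold>, v \<^bold>\<in> ixV) (\<lambda>w n. ug (BB (w 0)) (stage (BB (w 0)) (Suc (w 0)) n))"
    unfolding F.rel3_def by (simp add: ev)
  have rH: "F.rel5 1 (\<lambda>n b c m v. ?i \<^bold>, n \<^bold>, b \<^bold>, c \<^bold>, m \<^bold>, v \<^bold>\<in> ixH) (\<lambda>w n. cg (BB (w 0)) (stage (BB (w 0)) (Suc (w 0)) n))"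
    unfolding F.rel5_def by (simp add: ev)
  have rD: "F.rel3 1 (\<lambda>n j d. ?i \<^bold>, n \<^bold>, j \<^bold>, d \<^bold>\<in> ixD) (\<lambda>w. Dg (BB (w 0)) (Suc (w 0)))"
    unfolding F.rel3_def by (simp add: ev)
  have rU: "F.rel2 1 (\<lambda>m v. ?i \<^bold>, m \<^bold>, v \<^bold>\<in> ixU) (\<lambda>w. ug (BB (w 0)) (BB (Suc (w 0))))"
    unfolding F.rel2_def by (simp add: ev)
  have rK: "F.rel4 1 (\<lambda>b c m v. ?i \<^bold>, b \<^bold>, c \<^bold>, m \<^bold>, v \<^bold>\<in> ixK) (\<lambda>w. cg (BB (w 0)) (BB (Suc (w 0))))"
    unfolding F.rel4_def by (simp add: ev)
  have st: "F.holds 1 (is_stages ixE (\<lambda>x. ?i \<^bold>, x \<^bold>\<in> ixM) (?i \<^bold>+ \<^bold>1)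
        (\<lambda>n x. ?i \<^bold>, n \<^bold>, x \<^bold>\<in> ixW)
        (\<lambda>n m v. ?i \<^bold>, n \<^bold>, m \<^bold>, v \<^bold>\<in> ixV)
        (\<lambda>n b c m v. ?i \<^bold>, n \<^bold>, b \<^bold>, c \<^bold>, m \<^bold>, v \<^bold>\<in> ixH)
        (\<lambda>n j d. ?i \<^bold>, n \<^bold>, j \<^bold>, d \<^bold>\<in> ixD) 1 lev)"
    apply (rule F.is_stages[OF rM rW rV rH rD, where \<iota> = "\<lambda>w. Suc (w 0)"])
    subgoal for v k' by (simp add: dr_def)
    subgoal for w by (rule rstage_ex[OF BB_ok, of "w 0" "Suc (w 0)"])
    subgoal premises p for w y using w0[OF p] muP[of y] by linarith
    subgoal for w b using BB_pos[of b "w 0"] by simp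
    subgoal premises p for w y n m u by (rule ugP[OF upgrade_stage_bound[OF w0[OF p(1)] p(2-4)]])
    subgoal premises p for w y n b c m u
      by (rule order_trans[OF change_bound[OF p(4,5) upgrade_stage_bound[OF w0[OF p(1)] p(2)] p(6)] P])
    subgoal premises p for w y n x
      using stage_bound[OF w0[OF p(1)] p(2,3)] bound_stage_le_upgrade[of y] by (intro ugP) simp
    subgoal premises p for w y n j d by (rule order_trans[OF Dg_bound[OF w0[OF p(1)] p(2-4)] P])
    subgoal for w y m by (rule bM)
    subgoal for w y n b by (rule bB)
    subgoal premises p for w y s n b c v
      by (rule low[OF p(1,3) radm_least_le[OF BB_ok BB1 stage_low p(4-6)]])
    done
  have up: "F.holds 1 (is_upgrade ixE (\<lambda>x. ?i \<^bold>, x \<^bold>\<in> ixM) (\<lambda>x. ?i \<^bold>+ \<^bold>1 \<^bold>, x \<^bold>\<in> ixM)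
        (\<lambda>m v. ?i \<^bold>, m \<^bold>, v \<^bold>\<in> ixU)
        (\<lambda>b c m v. ?i \<^bold>, b \<^bold>, c \<^bold>, m \<^bold>, v \<^bold>\<in> ixK) 1 lev)"
    apply (rule F.is_upgrade[OF rM rM1 rU rK])
    subgoal for w by (rule rup_ex[OF BB_ok, of "w 0" "BB (Suc (w 0))"])
    subgoal premises p for w y m u by (rule ugP[OF upgrade_bound[OF w0[OF p(1)] p(2,3)]])
    subgoal premises p for w y b c m u
      by (rule order_trans[OF change_bound[OF p(3,4) upgrade_bound[OF w0[OF p(1)]] p(5)] P])
    subgoal for w y m by (rule bM)
    subgoal for w y n b by (rule bB)
    subgoal premises p for w y n b c v
      by (rule low[OF p(1,3) radm_least_le[OF BB_ok BB1 BB_Suc_low p(4-6)]])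
    done
  have ex: "F.holds 0 (is_exp ixE 0 lev)" unfolding is_exp_def
    apply (intro F.holds_all)
    unfolding F.holds_def
    apply (intro conjI allI)
     apply (intro F.tm_intros F.tm_exI)
      apply (simp_all add: ev)
      apply (rule F.P_pow_le[OF _ refl], assumption, simp_all)[1]
     apply (elim conjE exE, rule F.P_le[where n = 1], assumption, simp, simp)[1]
    subgoal for v by (cases "v 1") (auto simp: mult.commute)
    done
  have m0: "F.holds 0 ((\<^bold>\<forall>x. \<^bold>0 \<^bold>, x \<^bold>\<in> ixM \<^bold>\<longleftrightarrow> x \<^bold>\<in> ixX) 0 lev)"
    by (intro F.holds_all, unfold F.holds_def, intro conjI allI F.tm_intros) (simp add: ev)
  have ms: "F.holds 0 ((\<^bold>\<forall>i. \<^bold>\<forall>x. (i \<^bold>+ \<^bold>1 \<^bold>, x) \<^bold>\<in> ixM \<^bold>\<longleftrightarrow> (\<^bold>\<exists>n. (i \<^bold>, n \<^bold>, x) \<^bold>\<in> ixW)) 0 lev)"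
  proof (intro F.holds_all, unfold F.holds_def, intro conjI allI F.tm_intros F.tm_exI', goal_cases)
    case (1 v y w)
    let ?x = "v 0" and ?i = "v 1"
    have "?x \<in> BB (Suc ?i)" using 1(2) by (auto simp: ev base_seq.simps(2) ouroboros_def)
    then obtain n where "n \<le> ?x" "?x \<in> stage (BB ?i) (Suc ?i) n"
      using ouro.in_C_stage[OF ouro_BB, of ?x ?i] by (auto simp: base_seq.simps(2))
    moreover have "n \<le> P y" using F.P_ge[of n y] 1(1) calculation(1) by (meson le_trans zero_less_Suc)
    ultimately show ?case by (intro exI[of _ n]) (simp add: ev)
  next
    case (2 v)
    show ?case by (simp add: ev base_seq.simps(2) ouroboros_def)
  qed
  have gd: "F.holds 0 ((\<^bold>\<forall>n. \<^bold>\<forall>i. \<^bold>\<forall>v. (n \<^bold>, i \<^bold>, v) \<^bold>\<in> ixG \<^bold>\<longleftrightarrow>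
        (i \<^bold>= \<^bold>0 \<^bold>\<and> v \<^bold>= n) \<^bold>\<or>
        (\<^bold>\<exists>i'. \<^bold>\<exists>w. i \<^bold>= i' \<^bold>+ \<^bold>1 \<^bold>\<and> (n \<^bold>, i' \<^bold>, w) \<^bold>\<in> ixG \<^bold>\<and>
           ((w \<^bold>= \<^bold>0 \<^bold>\<and> v \<^bold>= \<^bold>0) \<^bold>\<or> (\<^bold>0 \<^bold>< w \<^bold>\<and> (i' \<^bold>, w \<^bold>, v \<^bold>+ \<^bold>1) \<^bold>\<in> ixU)))) 0 lev)"
    apply (intro F.holds_all)
    unfolding F.holds_def
    apply (intro conjI allI)
     apply (intro F.tm_intros F.tm_exI)
      apply (simp_all add: ev)
    subgoal premises p for v y w
    proof -
      \<comment> \<open>Terms of the sequence are only traced backwards: upgrades do not decrease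
        numbers, so the preceding term is at most \<open>v + 1\<close>.\<close>
      have "w \<le> Suc (v 1)" using p(2) up_ge[of w "v 0"] by (auto simp: upgrade_up)
      then show ?thesis using p(1) F.P_gt[of y] by (metis Suc_leI le_trans less_Suc_eq_le not_less_eq_eq One_nat_def Suc_less_eq zero_less_Suc)
    qed
     apply (elim conjE exE, rule F.P_le[where n = 1], assumption, simp, simp)[1]
    subgoal for v using goodstein_iff[of B0 "v (Suc (Suc 0))" "v (Suc 0)" "v 0"] by (simp add: numeral_2_eq_2)
    done
  have "F.holds 0 graphs" unfolding goodstein_graphs_def
    by (intro F.holds_and ex m0 ms gd) (rule F.holds_all, use st up in simp)+
  then show ?thesis unfolding F.holds_def .
qed

end

section \<open>Independence\<close>

lemma case_nat_const: "case_nat (\<lambda>_. a) (\<lambda>n _. f n) = (\<lambda>n (_ :: nat). case_nat a f n)"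
  by (intro ext) (simp split: nat.split)

lemma forces_AllS_D: "forces (AllS A) p v V \<Longrightarrow> forces A p v (case_nat X V)"
  by simp

context process
begin

lemma not_provable:
  assumes g: "gap 0 b (Inf B0)" and d: "Pi0 1 d" "sat (\<lambda>_. 0) (\<lambda>_. B0) d"
  shows "\<not> (RCA0 \<union> Sigma0_IND 2 \<turnstile> goodstein_sentence d)"
proof
  assume deriv: "RCA0 \<union> Sigma0_IND 2 \<turnstile> goodstein_sentence d"
  have "tame_growth (\<lambda>x. bound_all (Inf B0) x + (x + 1) * (x + 1))"
    by (intro tame_growth_add tame_growth_bound_all tame_growth_sq)
  then obtain q where q: "\<And>x. bound_all (Inf B0) x + (x + 1) * (x + 1) \<le> Phi q Suc x"
    unfolding tame_growth_def by blast
  \<comment> \<open>A single function that bounds all witnesses of the formula for the graphs and is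
    good, at a level \<open>q\<close> independent of the index.\<close>
  define f where "f = Phi q Suc"
  have f: "infl f" "tame_growth f" unfolding f_def by (auto intro: infl_Phi infl_Suc tame_growthI)
  have fb: "bound_all (Inf B0) x \<le> f x" "(x + 1) * (x + 1) \<le> f x" for x
    using q[of x] unfolding f_def by simp_all
  define c where "c = b * Inf B0"
  obtain s where s: "\<And>x. c + s \<le> x \<Longrightarrow> Phi (x - s) f (c + x) < Phi x Suc x"
    using Phi_Suc_dominates[OF f, of c] by blast
  \<comment> \<open>At index \<open>i\<close> the segment contains the starting value
    \<open>c + i\<close> and stays below \<open>Phi i Suc i\<close>, before which its sequence does
    not end. By the choice of \<open>s\<close> there is room for \<open>i - s\<close>
    levels.\<close>
  define p where "p = Cond sequentially (\<lambda>i. c + i) (\<lambda>_. f) (\<lambda>i. Phi i Suc i) (\<lambda>i. i - s)"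
  have p_sel: "flt p = sequentially" "lo p = (\<lambda>i. c + i)" "fn p = (\<lambda>_. f)" "hi p = (\<lambda>i. Phi i Suc i)" "lv p = (\<lambda>i. i - s)"
    by (simp_all add: p_def)
  have ok: "ok p"
    unfolding ok_def p_sel good_def eventually_sequentially
    using f fb s by (auto intro: filterlim_minus_const_nat_at_top)
  let ?v = "\<lambda>_ _. 0 :: nat" and ?V = "\<lambda>(_ :: nat) (_ :: nat). B0"
  have "forces (goodstein_sentence d) p ?v ?V"
    by (rule soundness[OF deriv ok]) (use valid_axioms ok dom_const in \<open>auto simp: valid_def\<close>)
  then have "forces (Imp d (goodstein_terminates ixX 0 1)) p ?v (case_nat (\<lambda>_. B0) ?V)"
    unfolding goodstein_sentence_def by simp
  moreover have "case_nat (\<lambda>_. B0) ?V = ?V" by (intro ext) (simp split: nat.split)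
  \<comment> \<open>A true universal statement remains true when its quantifier is restricted to the
    segment.\<close>
  moreover have "forces d p ?v ?V"
  proof -
    obtain A where A: "d = AllN A" "bounded A" using d(1) unfolding One_nat_def by auto
    show ?thesis unfolding A forces.simps
    proof (intro allI HOL.impI)
      fix r x assume r: "r \<preceq> p" "dom r x"
      show "forces A r (case_nat x ?v) ?V"
        using forces_iff_sat_bounded[OF ext_ok[OF r(1)] dom_case_nat[OF r(2)] A(2), of ?v ?V] dom_const d(2)
        by (simp add: case_nat_eta A)
    qed
  qed
  ultimately have "forces (goodstein_terminates ixX 0 1) p ?v ?V"
    using forces_Imp_mp ok by metis
  moreover have "goodstein_terminates ixX 0 1 = AllS (AllS (AllS (AllS (AllS (AllS (AllS (AllS (AllS (Imp graphs
      ((\<^bold>\<forall>n. \<^bold>\<exists>i. (n \<^bold>, i \<^bold>, \<^bold>0) \<^bold>\<in> ixG) 0 lev))))))))))"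
    by (simp only: goodstein_terminates_def allSP_def impP_def)
  ultimately have "forces (AllS (AllS (AllS (AllS (AllS (AllS (AllS (AllS (AllS (Imp graphs
      ((\<^bold>\<forall>n. \<^bold>\<exists>i. (n \<^bold>, i \<^bold>, \<^bold>0) \<^bold>\<in> ixG) 0 lev)))))))))))
      p ?v ?V" by (simp only:)
  from this[THEN forces_AllS_D[where X = "\<lambda>_. setE"], THEN forces_AllS_D[where X = "\<lambda>_. setM"], THEN forces_AllS_D[where X = "\<lambda>_. setW"], THEN forces_AllS_D[where X = "\<lambda>_. setV"], THEN forces_AllS_D[where X = "\<lambda>_. setH"], THEN forces_AllS_D[where X = "\<lambda>_. setD"], THEN forces_AllS_D[where X = "\<lambda>_. setU"], THEN forces_AllS_D[where X = "\<lambda>_. setK"], THEN forces_AllS_D[where X = "\<lambda>_. setG"]]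
  have imp: "forces (Imp graphs
      ((\<^bold>\<forall>n. \<^bold>\<exists>i. (n \<^bold>, i \<^bold>, \<^bold>0) \<^bold>\<in> ixG) 0 lev)) p ?v (\<lambda>n _. sets n)"
    by (simp only: case_nat_const sets_def)
  have "forces graphs p ?v (\<lambda>n _. sets n)"
  proof (rule forces_iff_sat[OF ok, where P = "\<lambda>_. f" and n = 1, THEN iffD2])
    show "\<forall>k. dom p (\<lambda>_. 0)" using dom_const by blast
    show "\<forall>\<^sub>F i in flt p. tame f (\<lambda>X. sets X) 0 graphs" using graphs_hold[of f] fb(1) by simp
    show "\<forall>\<^sub>F i in flt p. \<forall>y. f y \<le> (fn p i ^^ 1) y" by (simp add: p_sel)
    show "\<forall>\<^sub>F i in flt p. sat (\<lambda>k. 0) (\<lambda>X. sets X) graphs" using graphs_hold[of f] fb(1) by simp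
  qed
  then have "forces ((\<^bold>\<forall>n. \<^bold>\<exists>i. (n \<^bold>, i \<^bold>, \<^bold>0) \<^bold>\<in> ixG) 0 lev) p ?v (\<lambda>n _. sets n)"
    using forces_Imp_mp[OF imp] ok by blast
  moreover have "dom p (\<lambda>i. c + i)" unfolding dom_def p_sel by (intro exI[of _ 0]) simp
  ultimately have "forces (ExN ((((\<lambda>k'. Var (k' - Suc 0)) \<^bold>, (\<lambda>k'. Var (k' - Suc (Suc 0))) \<^bold>, \<^bold>0) \<^bold>\<in> ixG)
      (Suc (Suc 0)) lev)) p (case_nat (\<lambda>i. c + i) ?v) (\<lambda>n _. sets n)"
    unfolding allP_def exP_def forces.simps using ext_refl[OF ok] by blast
  then obtain r x where r: "r \<preceq> p" "dom r x"
    and "forces ((((\<lambda>k'. Var (k' - Suc 0)) \<^bold>, (\<lambda>k'. Var (k' - Suc (Suc 0))) \<^bold>, \<^bold>0) \<^bold>\<in> ixG)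
      (Suc (Suc 0)) lev) r (case_nat x (case_nat (\<lambda>i. c + i) ?v)) (\<lambda>n _. sets n)"
    unfolding forces_ExN using ext_refl[OF ok] by blast
  then have "\<forall>\<^sub>F i in flt r. goodstein B0 (c + i) (x i) = 0"
    by (simp add: memP_def case_nat_eta sets_eval set_iff zero_enat_def)
  moreover have "\<forall>\<^sub>F i in flt r. hi r i \<le> Phi i Suc i"
    using r(1) unfolding ext_def p_sel by (auto elim: eventually_mono)
  ultimately have "\<forall>\<^sub>F i in flt r. False" using dom_less_hi[OF ext_ok[OF r(1)] r(2)]
  proof eventually_elim
    case (elim i)
    \<comment> \<open>The time \<open>x i\<close> of the alleged zero is below
      \<open>hi r i\<close>, hence below \<open>Phi i Suc i\<close>.\<close>
    have "goodstein B0 (c + i) (x i) \<noteq> 0"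
      by (rule lasts_goodstein[OF lasts_Phi[OF g, of i]]) (use elim in \<open>auto simp: c_def\<close>)
    then show ?case using elim(1) by simp
  qed
  then show False using not_eventually_False ext_ok r(1) by blast
qed

end

theorem theorem8p7:
  fixes B0 :: "nat set" and d :: fm
  assumes "base_hierarchy B0"
    and "\<not> (\<exists>k\<ge>2. (\<forall>b\<in>B0. succ_base B0 b \<le> enat (b * Inf B0)) \<and> Inf B0 \<le> k)"
    and "Pi0 1 d" and "fv_below 0 1 d" and "sat (\<lambda>_. 0) (\<lambda>_. B0) d"
  shows "\<not> (RCA0 \<union> Sigma0_IND 2 \<turnstile> goodstein_sentence d)"
proof -
  interpret process B0 using assms(1) by unfold_locales (auto simp: base_hierarchy_def)
  have "2 \<le> Inf B0" using BB_pos[of "Inf B0" 0] Inf_nat_def1[OF B0(1)] by simp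
  \<comment> \<open>The hypothesis is applied to \<open>k = Inf B0\<close>; what remains is that
    some base has a large successor.\<close>
  then obtain b where b: "b \<in> B0" "\<not> succ_base B0 b \<le> enat (b * Inf B0)" using assms(2) by blast
  then have "rbelow (\<lambda>x. x \<in> B0) (b * Inf B0) b" unfolding rbelow_iff by simp
  then have "gap 0 b (Inf B0)" using b(1) by (simp add: gap_def rbelow_def)
  then show ?thesis using assms(3,5) by (rule not_provable)
qed


end
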